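(* Let $d>2$ be an integer and set $\widetilde p_d=2-\frac{4}{2+d(2^{d}+2)}$. For every $\widetilde p_{d}< p\leq 2$ there is a constant $C=C(p,d)>0$ such that for all $N\in\mathbb{N}$ and every function $f:\mathbb{Z}\to\mathbb{R}$, $$\|A^{d}_{N}f\|_{p'}\leq C\, N^{d/p'-d/p}\|f\|_p,$$ where $A^d_N f(x)=\frac{1}{N}\sum_{k=1}^{N} f(x+k^d)$ for $x\in\mathbb{Z}$.
   Context: For $f:\mathbb{Z}\to\mathbb{R}$, $\|f\|_p$ denotes the $\ell^p(\mathbb{Z})$-norm, and $p'=\frac{p}{p-1}$ is the conjugate exponent. *)

theory Defs
  imports "HOL-Analysis.Analysis"
begin

definition in_lp :: "real \<Rightarrow> (int \<Rightarrow> real) \<Rightarrow> bool" where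
  "in_lp p f \<longleftrightarrow> (\<lambda>x. \<bar>f x\<bar> powr p) summable_on UNIV"

definition lp_norm :: "real \<Rightarrow> (int \<Rightarrow> real) \<Rightarrow> real" where
  "lp_norm p f = (\<Sum>\<^sub>\<infinity>x\<in>UNIV. \<bar>f x\<bar> powr p) powr (1 / p)"

definition conj_exp :: "real \<Rightarrow> real" where
  "conj_exp p = p / (p - 1)"

definition avg_op :: "nat \<Rightarrow> nat \<Rightarrow> (int \<Rightarrow> real) \<Rightarrow> int \<Rightarrow> real" where
  "avg_op d N f x = (1 / real N) * (\<Sum>k = 1..N. f (x + int k ^ d))"

definition p_tilde :: "nat \<Rightarrow> real" where
  "p_tilde d = 2 - 4 / (2 + real d * (2 ^ d + 2))"

end

theory Submission
  imports Defs "HOL-Analysis.Kronecker_Approximation_Theorem" "HOL-Computational_Algebra.Primes"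
begin

text \<open>
  Put \<open>r = d (2\<^sup>d\<^sup>-\<^sup>1 + 1)\<close> and \<open>S(\<alpha>) = \<Sum>k\<le>N. e(\<alpha> k\<^sup>d)\<close>; the hypothesis on \<open>p\<close> says that
  \<open>2/p - 1 < 1/r\<close>. The heart of the matter is the mean value bound
  \<open>\<Sum>j<M. |S(j/M)|\<^sup>r \<le> C M N\<^sup>r\<^sup>-\<^sup>d\<close> for large \<open>M\<close>, without any loss of \<open>N\<^sup>\<epsilon>\<close>. If the Dirichlet
  denominator \<open>q\<close> of \<open>\<alpha>\<close> exceeds \<open>N\<^sup>1\<^sup>-\<^sup>\<eta>\<close>, Weyl's inequality alone gives \<open>|S(\<alpha>)|\<^sup>r \<le> C N\<^sup>r\<^sup>-\<^sup>d\<close>. For smaller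
  \<open>q\<close>, summation by parts gives \<open>S(a/q + \<beta>) = q\<inverse> S\<^sub>q(a/q) S(\<beta>) + O(q (1 + N\<^sup>d |\<beta>|))\<close>; the complete sum
  is again controlled by Weyl's inequality, and \<open>S(\<beta>)\<close> decays like \<open>|\<beta>|\<^sup>-\<^sup>1\<^sup>/\<^sup>d\<close>.

  By finite Fourier analysis and Hoelder this bounds the number of pairs \<open>(x, k)\<close> with \<open>x \<in> G\<close> and
  \<open>x + k\<^sup>d \<in> F\<close> by \<open>C N\<^sup>1\<^sup>-\<^sup>d\<^sup>/\<^sup>r (|F| |G|)\<^sup>(\<^sup>1\<^sup>+\<^sup>1\<^sup>/\<^sup>r\<^sup>)\<^sup>/\<^sup>2\<close>, next to the trivial \<open>N (|F| |G|)\<^sup>1\<^sup>/\<^sup>2\<close>. Splitting both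
  functions of the bilinear form into dyadic level sets and taking the better of the two bounds for
  each pair of levels gives geometric decay away from the scale-invariant one; duality concludes.
\<close>

section \<open>Weyl's inequality\<close>

text \<open>The estimate is scale invariant, so even a factor \<open>N powr \<epsilon>\<close> in
  the mean value bound would ruin a constant uniform in \<open>N\<close>; yet Weyl's inequality
  loses such a factor. The extra \<open>d\<close> in r = d * 2 ^ (d - 1) + d pays for it. With k = 2
  ^ (d - 1), Weyl's inequality at a denominator near N powr (1 - \<eta>) saves N powr ((1 - \<eta> -
  \<epsilon>) / k), and the power d * (k + 1) turns this into all of N ^ d as soon as \<eta> +
  \<epsilon> \<le> 1 / (k + 1). The price is that major arcs reach up to denominators N powr (1 -
  \<eta>), with errors of that size; they are affordable because \<eta> * r can still be at least 2
  when d \<ge> 3. The critical exponent \<open>p_tilde d\<close> equals 2 * r / (r + 1): there the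
  arithmetic bound for pairs of level sets stops decaying on one side of the balance point. At p = 2
  decay fails on the other side, but an elementary inequality takes over. Frequencies are sampled at
  j / M with M large instead of integrating over the circle, which turns orthogonality and Parseval
  into finite identities.\<close>

lemma card_divisors_mult_prime_power_le:
  fixes m p a :: nat
  assumes "prime p" "m > 0"
  shows "card {e. e dvd p ^ a * m} \<le> (a + 1) * card {e. e dvd m}"
proof -
  have "{e. e dvd p ^ a * m} \<subseteq> (\<lambda>(i, e). p ^ i * e) ` ({..a} \<times> {e. e dvd m})"
  proof
    fix e assume "e \<in> {e. e dvd p ^ a * m}"
    then obtain b c where "e = b * c" "b dvd p ^ a" "c dvd m"
      using division_decomp[of e "p ^ a" m] by auto
    moreover from this assms obtain i where "i \<le> a" "b = p ^ i"
      using divides_primepow_nat by blast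
    ultimately show "e \<in> (\<lambda>(i, e). p ^ i * e) ` ({..a} \<times> {e. e dvd m})"
      by auto
  qed
  moreover have fin: "finite ({..a} \<times> {e. e dvd m})"
    using assms by (simp add: finite_divisors_nat)
  ultimately have "card {e. e dvd p ^ a * m} \<le> card ({..a} \<times> {e. e dvd m})"
    by (rule surj_card_le[rotated])
  then show ?thesis by (simp add: card_cartesian_product)
qed

text \<open>The divisor function is a product of factors a + 1 over the prime powers p ^ a exactly
  dividing n. Once p powr \<epsilon> \<ge> 2, such a factor is at most 2 ^ a and hence at most (p ^
  a) powr \<epsilon>; the finitely many smaller primes cost a fixed factor \<open>K\<close>
  each.\<close>

lemma divisor_bound:
  fixes \<epsilon> :: real
  assumes "\<epsilon> > 0"
  obtains C where "C \<ge> 1" "\<And>n::nat. n > 0 \<Longrightarrow> real (card {e. e dvd n}) \<le> C * real n powr \<epsilon>"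
proof -
  \<comment> \<open>\<open>K\<close> is chosen so that a + 1 \<le> K * (1 + a * \<epsilon> * ln 2)
    for every a, and the bracket is at most 2 powr (a * \<epsilon>).\<close>
  define K where "K = 1 + 1 / (\<epsilon> * ln 2)"
  have K1: "K \<ge> 1" using assms by (simp add: K_def)
  obtain P :: nat where P: "2 powr (1 / \<epsilon>) \<le> real P"
    using real_arch_simple by blast
  have small: "real (a + 1) \<le> K * (real p powr \<epsilon>) ^ a" if "prime p" for p a :: nat
  proof -
    have p2: "real p \<ge> 2" using prime_ge_2_nat[OF that] by simp
    have "real (a + 1) \<le> K * (1 + a * (\<epsilon> * ln 2))"
    proof -
      have "K * (1 + a * (\<epsilon> * ln 2)) = 1 + a * (\<epsilon> * ln 2) + 1 / (\<epsilon> * ln 2) + a"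
        using assms unfolding K_def by (simp add: field_simps)
      then show ?thesis using assms by simp
    qed
    also have "\<dots> \<le> K * exp (a * (\<epsilon> * ln 2))"
      using K1 by (intro mult_left_mono) (auto simp: exp_ge_add_one_self)
    also have "exp (a * (\<epsilon> * ln 2)) = (2 powr \<epsilon>) ^ a"
      by (simp add: powr_def exp_of_nat_mult)
    also have "K * \<dots> \<le> K * (real p powr \<epsilon>) ^ a"
      using K1 p2 assms by (intro mult_left_mono power_mono powr_mono2) auto
    finally show ?thesis .
  qed
  have large: "real (a + 1) \<le> (real p powr \<epsilon>) ^ a" if "prime p" "p > P" for p a :: nat
  proof -
    have "a + 1 \<le> 2 ^ a" using Suc_leI[OF less_exp[of a]] by simp
    then have "real (a + 1) \<le> 2 ^ a" by (metis of_nat_le_iff of_nat_numeral of_nat_power)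
    also have "(2::real) ^ a \<le> (real p powr \<epsilon>) ^ a"
    proof (intro power_mono)
      have "(2 powr (1 / \<epsilon>)) powr \<epsilon> \<le> real p powr \<epsilon>"
        using P that assms by (intro powr_mono2) auto
      then show "2 \<le> real p powr \<epsilon>" using assms by (simp add: powr_powr)
    qed simp
    finally show ?thesis .
  qed
  have main: "real (card {e. e dvd n}) \<le> K ^ card (prime_factors n \<inter> {..P}) * real n powr \<epsilon>"
    if "n > 0" for n :: nat
    using that
  proof (induction n rule: less_induct)
    case (less n)
    show ?case
    proof (cases "n = 1")
      case True then show ?thesis by simp
    next
      case False
      then obtain p where p: "prime p" "p dvd n" using prime_factor_nat by blast
      obtain m where m: "n = p ^ multiplicity p n * m" "\<not> p dvd m"
      proof (rule multiplicity_decompose'[of n p])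
        show "n \<noteq> 0" "\<not> is_unit p" using less.prems p by auto
      qed auto
      define a where "a = multiplicity p n"
      have a: "a > 0" using p less.prems by (simp add: a_def prime_multiplicity_gt_zero_iff)
      have m0: "m > 0" using m less.prems by (metis mult_0_right neq0_conv)
      have "p ^ a \<ge> p ^ 1" using prime_gt_0_nat[OF p(1)] a by (intro power_increasing) auto
      then have "1 < p ^ a" using prime_ge_2_nat[OF p(1)] by simp
      then have "m < p ^ a * m" using m0 by simp
      then have "m < n" by (simp only: m(1)[folded a_def, symmetric])
      have pf: "prime_factors n = insert p (prime_factors m)"
      proof -
        have "n = p ^ a * m" by (rule m(1)[folded a_def])
        then have "prime_factors n = prime_factors (p ^ a) \<union> prime_factors m"
          using m0 prime_gt_0_nat[OF p(1)] by (simp add: prime_factors_product)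
        then show ?thesis using a p(1) by (simp add: prime_factorization_prime_power)
      qed
      have pnot: "p \<notin> prime_factors m" using m(2) by auto
      have "real (card {e. e dvd n}) \<le> real (a + 1) * real (card {e. e dvd m})"
        using card_divisors_mult_prime_power_le[OF p(1) m0, of a] m(1)[folded a_def]
        by (simp only: of_nat_mult[symmetric] of_nat_le_iff)
      also have "\<dots> \<le> real (a + 1) * (K ^ card (prime_factors m \<inter> {..P}) * real m powr \<epsilon>)"
        by (intro mult_left_mono less.IH \<open>m < n\<close> m0) auto
      \<comment> \<open>The exponent of the new power of \<open>K\<close> is 1 when
        \<open>p \<le> P\<close> and 0 otherwise, so \<open>K\<close> is spent once per small
        prime.\<close>
      also have "\<dots> \<le> (K ^ (card (prime_factors n \<inter> {..P}) - card (prime_factors m \<inter> {..P}))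
            * (real p powr \<epsilon>) ^ a) * (K ^ card (prime_factors m \<inter> {..P}) * real m powr \<epsilon>)"
      proof (intro mult_right_mono)
        show "real (a + 1) \<le> K ^ (card (prime_factors n \<inter> {..P}) - card (prime_factors m \<inter> {..P}))
            * (real p powr \<epsilon>) ^ a"
        proof (cases "p \<le> P")
          case True
          then have "card (prime_factors n \<inter> {..P}) = Suc (card (prime_factors m \<inter> {..P}))"
            using pf pnot by simp
          then show ?thesis using small[OF p(1), of a] by simp
        next
          case False
          then show ?thesis using large[OF p(1), of a] pf by simp
        qed
      qed (use K1 in auto)
      also have "\<dots> = K ^ card (prime_factors n \<inter> {..P}) * ((real p powr \<epsilon>) ^ a * real m powr \<epsilon>)"
      proof -
        have "card (prime_factors m \<inter> {..P}) \<le> card (prime_factors n \<inter> {..P})"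
          using pf by (intro card_mono) auto
        then show ?thesis by (simp add: power_add[symmetric] mult.assoc mult.left_commute)
      qed
      also have "(real p powr \<epsilon>) ^ a * real m powr \<epsilon> = real n powr \<epsilon>"
      proof -
        have "real n = real p ^ a * real m" using m(1)[folded a_def] by (simp only: of_nat_mult of_nat_power)
        moreover have "(real p powr \<epsilon>) ^ a = (real p ^ a) powr \<epsilon>"
          using prime_gt_0_nat[OF p(1)]
          by (induction a) (auto simp: powr_mult)
        ultimately show ?thesis by (simp add: powr_mult)
      qed
      finally show ?thesis .
    qed
  qed
  show ?thesis
  proof (rule that[of "K ^ (P + 1)"])
    show "K ^ (P + 1) \<ge> 1" using K1 by (rule one_le_power)
    fix n :: nat assume "n > 0"
    have "card (prime_factors n \<inter> {..P}) \<le> card {..P}" by (intro card_mono) auto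
    then have "K ^ card (prime_factors n \<inter> {..P}) \<le> K ^ (P + 1)"
      using K1 by (intro power_increasing) auto
    then show "real (card {e. e dvd n}) \<le> K ^ (P + 1) * real n powr \<epsilon>"
      using main[OF \<open>n > 0\<close>] by (meson mult_right_mono order_trans powr_ge_zero)
  qed
qed

text \<open>Jensen's inequality for x ^ (n + 1) after dividing the weights by their total. Unit
  weights serve in Weyl differencing; products of Fourier coefficients are the weights in the
  counting bound.\<close>

lemma weighted_power_mean:
  fixes w x :: "'a \<Rightarrow> real"
  assumes "finite A" "\<And>i. i \<in> A \<Longrightarrow> w i \<ge> 0" "\<And>i. i \<in> A \<Longrightarrow> x i \<ge> 0"
  shows "(\<Sum>i\<in>A. w i * x i) ^ Suc n \<le> (\<Sum>i\<in>A. w i) ^ n * (\<Sum>i\<in>A. w i * x i ^ Suc n)"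
proof (cases "(\<Sum>i\<in>A. w i) = 0")
  case True
  then have "w i = 0" if "i \<in> A" for i using assms that by (simp add: sum_nonneg_eq_0_iff)
  then show ?thesis by simp
next
  case False
  define W where "W = (\<Sum>i\<in>A. w i)"
  have W: "W > 0" using False assms(2) sum_nonneg[of A w] by (auto simp: W_def less_le)
  have ne: "A \<noteq> {}" using False by auto
  have cv: "convex_on {0::real..} (\<lambda>x. x ^ Suc n)"
    by (cases "even (Suc n)")
      (auto intro: convex_on_subset[OF convex_power_even] convex_power_odd simp del: power_Suc)
  have "(\<Sum>i\<in>A. (w i / W) *\<^sub>R x i) ^ Suc n \<le> (\<Sum>i\<in>A. (w i / W) * x i ^ Suc n)"
    by (rule convex_on_sum[OF assms(1) ne cv])
      (use assms W in \<open>auto simp: sum_divide_distrib[symmetric] W_def[symmetric]\<close>)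
  then have "((\<Sum>i\<in>A. w i * x i) / W) ^ Suc n \<le> (\<Sum>i\<in>A. w i * x i ^ Suc n) / W"
    by (simp add: sum_divide_distrib)
  then have "(\<Sum>i\<in>A. w i * x i) ^ Suc n / (W ^ n * W) \<le> (\<Sum>i\<in>A. w i * x i ^ Suc n) / W"
    by (simp add: power_divide mult.commute)
  then show ?thesis using W unfolding W_def[symmetric] by (simp add: field_simps)
qed

section \<open>Additive characters and the distance to the nearest integer\<close>

definition unit_exp :: "real \<Rightarrow> complex" where
  "unit_exp x = cis (2 * pi * x)"

lemma unit_exp_add: "unit_exp (x + y) = unit_exp x * unit_exp y"
  by (simp add: unit_exp_def cis_mult ring_distribs)

lemma norm_unit_exp [simp]: "norm (unit_exp x) = 1"
  by (simp add: unit_exp_def)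

lemma cnj_unit_exp: "cnj (unit_exp x) = unit_exp (- x)"
  by (simp add: unit_exp_def cis_cnj)

lemma unit_exp_diff: "unit_exp (x - y) = unit_exp x * cnj (unit_exp y)"
  using unit_exp_add[of x "- y"] by (simp add: cnj_unit_exp)

lemma unit_exp_of_int [simp]: "unit_exp (of_int n) = 1"
  by (simp add: unit_exp_def)

lemma unit_exp_power: "unit_exp x ^ n = unit_exp (real n * x)"
  by (simp add: unit_exp_def Complex.DeMoivre mult.commute mult.left_commute)

lemma norm_unit_exp_minus_one: "norm (unit_exp x - 1) = 2 * \<bar>sin (pi * x)\<bar>"
  using dist_exp_i_1[of "2 * pi * x"] by (simp add: unit_exp_def cis_conv_exp)

lemma norm_unit_exp_minus_one_le: "norm (unit_exp x - 1) \<le> 2 * pi * \<bar>x\<bar>"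
proof -
  have "\<bar>sin (pi * x)\<bar> \<le> \<bar>pi * x\<bar>" by (rule abs_sin_x_le_abs_x)
  then show ?thesis by (simp add: norm_unit_exp_minus_one abs_mult)
qed

definition dist_int :: "real \<Rightarrow> real" where
  "dist_int x = \<bar>x - of_int (round x)\<bar>"

lemma dist_int_le: "dist_int x \<le> \<bar>x - of_int m\<bar>"
  unfolding dist_int_def by (rule round_diff_minimal)

lemma dist_int_nonneg [simp]: "dist_int x \<ge> 0"
  by (simp add: dist_int_def)

lemma dist_int_minus: "dist_int (- x) = dist_int x"
proof -
  have "dist_int (- y) \<le> dist_int y" for y
    using dist_int_le[of "- y" "- round y"] by (simp add: dist_int_def)
  from this[of x] this[of "- x"] show ?thesis by simp
qed

lemma norm_unit_exp_minus_one_ge: "4 * dist_int x \<le> norm (unit_exp x - 1)"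
proof -
  define y where "y = \<bar>x - of_int (round x)\<bar>"
  have y: "0 \<le> y" "y \<le> 1/2" using of_int_round_abs_le[of x] by (auto simp: y_def abs_minus_commute)
  have "unit_exp x = unit_exp (x - of_int (round x))"
    by (simp add: unit_exp_diff)
  then have "norm (unit_exp x - 1) = 2 * \<bar>sin (pi * (x - of_int (round x)))\<bar>"
    by (simp add: norm_unit_exp_minus_one)
  also have "\<bar>sin (pi * (x - of_int (round x)))\<bar> = \<bar>sin (pi * y)\<bar>"
  proof -
    have "y = x - of_int (round x) \<or> y = - (x - of_int (round x))" by (auto simp: y_def)
    then have "sin (pi * y) = sin (pi * (x - of_int (round x))) \<or>
        sin (pi * y) = - sin (pi * (x - of_int (round x)))"
      by (metis mult_minus_right sin_minus)
    then show ?thesis by auto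
  qed
  finally have *: "norm (unit_exp x - 1) = 2 * \<bar>sin (pi * y)\<bar>" .
  \<comment> \<open>Jordan's inequality: on [0, pi/2] the concave sine lies above its chord.\<close>
  have "\<bar>sin (pi * y)\<bar> \<ge> 2 * y"
  proof -
    have "concave_on {0..pi/2} (sin :: real \<Rightarrow> real)"
      by (rule f''_le0_imp_concave[where f' = cos and f'' = "\<lambda>x. - sin x"])
        (auto intro!: derivative_eq_intros sin_ge_zero)
    then have "sin ((1 - 2*y) *\<^sub>R 0 + (2*y) *\<^sub>R (pi/2)) \<ge> (1 - 2*y) * sin 0 + (2*y) * sin (pi/2)"
      using y by (intro concave_onD) auto
    then show ?thesis by (simp add: mult.commute)
  qed
  with * show ?thesis by (simp add: dist_int_def y_def)
qed

section \<open>Polynomial phases and Weyl differencing\<close>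

text \<open>
  Polynomials of degree \<open>j\<close>, characterised by their iterated differences; \<open>c\<close> is \<open>j!\<close> times the
  leading coefficient, so that differencing with step \<open>h\<close> just multiplies \<open>c\<close> by \<open>h\<close>.
\<close>

fun polynomial_phase :: "nat \<Rightarrow> real \<Rightarrow> (int \<Rightarrow> real) \<Rightarrow> bool" where
  "polynomial_phase 0 c \<phi> \<longleftrightarrow> (\<forall>x. \<phi> x = c)"
| "polynomial_phase (Suc j) c \<phi> \<longleftrightarrow>
     (\<forall>h. polynomial_phase j (of_int h * c) (\<lambda>x. \<phi> (x + h) - \<phi> x))"

lemma polynomial_phase_add:
  "polynomial_phase j c \<phi> \<Longrightarrow> polynomial_phase j c' \<psi> \<Longrightarrow>
    polynomial_phase j (c + c') (\<lambda>x. \<phi> x + \<psi> x)"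
proof (induction j arbitrary: c c' \<phi> \<psi>)
  case (Suc j)
  show ?case unfolding polynomial_phase.simps
  proof
    fix h
    have "polynomial_phase j (of_int h * c + of_int h * c')
      (\<lambda>x. (\<phi> (x + h) - \<phi> x) + (\<psi> (x + h) - \<psi> x))"
      using Suc by (intro Suc.IH) auto
    then show "polynomial_phase j (of_int h * (c + c')) (\<lambda>x. \<phi> (x + h) + \<psi> (x + h) - (\<phi> x + \<psi> x))"
      by (simp add: algebra_simps)
  qed
qed auto

lemma polynomial_phase_scale:
  "polynomial_phase j c \<phi> \<Longrightarrow> polynomial_phase j (s * c) (\<lambda>x. s * \<phi> x)"
proof (induction j arbitrary: c \<phi>)
  case (Suc j)
  show ?case unfolding polynomial_phase.simps
  proof
    fix h
    have "polynomial_phase j (s * (of_int h * c)) (\<lambda>x. s * (\<phi> (x + h) - \<phi> x))"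
      using Suc by auto
    then show "polynomial_phase j (of_int h * (s * c)) (\<lambda>x. s * \<phi> (x + h) - s * \<phi> x)"
      by (simp add: algebra_simps)
  qed
qed auto

lemma polynomial_phase_shift:
  "polynomial_phase j c \<phi> \<Longrightarrow> polynomial_phase j c (\<lambda>x. \<phi> (x + t))"
proof (induction j arbitrary: c \<phi>)
  case (Suc j)
  show ?case unfolding polynomial_phase.simps
  proof
    fix h
    have "polynomial_phase j (of_int h * c) (\<lambda>x. \<phi> ((x + t) + h) - \<phi> (x + t))"
      using Suc by auto
    then show "polynomial_phase j (of_int h * c) (\<lambda>x. \<phi> (x + h + t) - \<phi> (x + t))"
      by (simp add: add_ac)
  qed
qed auto

text \<open>Product rule: the h-difference of x * \<phi> x is x times the difference of \<phi> plus
  h * \<phi> (x + h). Induction handles the first summand, and the second raises the factor from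
  \<open>Suc j\<close> to \<open>Suc (Suc j)\<close>. Iterating from a constant produces the d! of
  the monomial.\<close>

lemma polynomial_phase_times_id:
  "polynomial_phase j c \<phi> \<Longrightarrow> polynomial_phase (Suc j) (real (Suc j) * c) (\<lambda>x. of_int x * \<phi> x)"
proof (induction j arbitrary: c \<phi>)
  case 0
  then show ?case by (auto simp: algebra_simps)
next
  case (Suc j)
  show ?case unfolding polynomial_phase.simps(2)[of "Suc j"]
  proof
    fix h
    have "polynomial_phase j (of_int h * c) (\<lambda>x. \<phi> (x + h) - \<phi> x)"
      using Suc.prems by auto
    from Suc.IH[OF this] have "polynomial_phase (Suc j) (real (Suc j) * (of_int h * c) + of_int h * c)
       (\<lambda>x. of_int x * (\<phi> (x + h) - \<phi> x) + of_int h * \<phi> (x + h))"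
      by (intro polynomial_phase_add polynomial_phase_scale polynomial_phase_shift Suc.prems)
    moreover have "(\<lambda>x. of_int x * (\<phi> (x + h) - \<phi> x) + of_int h * \<phi> (x + h)) =
        (\<lambda>x. of_int (x + h) * \<phi> (x + h) - of_int x * \<phi> x)"
      by (auto simp: algebra_simps)
    moreover have "real (Suc j) * (of_int h * c) + of_int h * c = of_int h * (real (Suc (Suc j)) * c)"
      by (simp add: algebra_simps)
    ultimately show "polynomial_phase (Suc j) (of_int h * (real (Suc (Suc j)) * c))
        (\<lambda>x. of_int (x + h) * \<phi> (x + h) - of_int x * \<phi> x)" by simp
  qed
qed

lemma polynomial_phase_monomial:
  "polynomial_phase d (fact d * \<alpha>) (\<lambda>x. \<alpha> * of_int x ^ d)"
proof (induction d)
  case (Suc d)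
  have "polynomial_phase (Suc d) (real (Suc d) * (fact d * \<alpha>)) (\<lambda>x. of_int x * (\<alpha> * of_int x ^ d))"
    by (rule polynomial_phase_times_id[OF Suc.IH])
  then show ?case by (simp add: algebra_simps del: polynomial_phase.simps)
qed auto

text \<open>This is \<open>min N (1 / dist_int x)\<close>, except that the value is \<open>N\<close> when \<open>dist_int x = 0\<close>.\<close>

definition geom_bound :: "nat \<Rightarrow> real \<Rightarrow> real" where
  "geom_bound N x = (if real N * dist_int x \<le> 1 then real N else 1 / dist_int x)"

lemma geom_bound_nonneg [simp]: "geom_bound N x \<ge> 0"
  by (simp add: geom_bound_def)

lemma geom_bound_le: "geom_bound N x \<le> real N"
proof (cases "real N * dist_int x \<le> 1")
  case False
  then have "dist_int x > 0" by (smt (verit) dist_int_nonneg mult_nonneg_nonpos of_nat_0_le_iff)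
  with False show ?thesis by (simp add: geom_bound_def field_simps)
qed (simp add: geom_bound_def)

lemma geom_bound_le_inverse: "dist_int x > 0 \<Longrightarrow> geom_bound N x \<le> 1 / dist_int x"
  by (simp add: geom_bound_def field_simps)

lemma geom_bound_minus [simp]: "geom_bound N (- x) = geom_bound N x"
  by (simp add: geom_bound_def dist_int_minus)

text \<open>Multiplication by \<open>unit_exp \<beta> - 1\<close> telescopes the geometric sum to
  two boundary terms. The interval is arbitrary up to its length, since differencing moves and
  shortens it.\<close>

lemma norm_sum_linear_phase_le:
  fixes a b :: int
  assumes "card {a..b} \<le> N"
  shows "norm (\<Sum>x\<in>{a..b}. unit_exp (\<beta> * of_int x + \<gamma>)) \<le> geom_bound N \<beta>"
proof -
  let ?S = "\<Sum>x\<in>{a..b}. unit_exp (\<beta> * of_int x + \<gamma>)"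
  have triv: "norm ?S \<le> real N"
  proof -
    have "norm ?S \<le> (\<Sum>x\<in>{a..b}. norm (unit_exp (\<beta> * of_int x + \<gamma>)))" by (rule norm_sum)
    also have "\<dots> = real (card {a..b})" by simp
    also have "\<dots> \<le> real N" using assms by linarith
    finally show ?thesis .
  qed
  show ?thesis
  proof (cases "real N * dist_int \<beta> \<le> 1 \<or> b < a")
    case True
    then show ?thesis using triv by (auto simp: geom_bound_def)
  next
    case False
    then have pos: "dist_int \<beta> > 0" and ab: "a \<le> b"
      by (smt (verit) dist_int_nonneg mult_nonneg_nonpos of_nat_0_le_iff)+
    define E where "E x = unit_exp (\<beta> * of_int x + \<gamma>)" for x :: int
    have step: "E (x + 1) = unit_exp \<beta> * E x" for x
      unfolding E_def by (simp flip: unit_exp_add add: algebra_simps)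
    have tele: "(\<Sum>x\<in>{a..a + int n}. E (x + 1) - E x) = E (a + int n + 1) - E a" for n
    proof (induction n)
      case (Suc n)
      have "{a..a + int (Suc n)} = insert (a + int n + 1) {a..a + int n}" by auto
      with Suc show ?case by (simp add: algebra_simps)
    qed simp
    have "(unit_exp \<beta> - 1) * ?S = (\<Sum>x\<in>{a..b}. E (x + 1) - E x)"
      unfolding sum_distrib_left step E_def[symmetric] by (simp add: algebra_simps)
    also have "\<dots> = E (b + 1) - E a" using tele[of "nat (b - a)"] ab by simp
    finally have "norm (unit_exp \<beta> - 1) * norm ?S = norm (E (b + 1) - E a)"
      by (metis norm_mult)
    also have "\<dots> \<le> 2" using norm_triangle_ineq4[of "E (b + 1)" "E a"] by (simp add: E_def)
    finally have "norm (unit_exp \<beta> - 1) * norm ?S \<le> 2" .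
    moreover have "4 * dist_int \<beta> * norm ?S \<le> norm (unit_exp \<beta> - 1) * norm ?S"
      by (intro mult_right_mono norm_unit_exp_minus_one_ge) auto
    ultimately have "4 * dist_int \<beta> * norm ?S \<le> 2" by linarith
    then have "norm ?S \<le> 1 / dist_int \<beta>" using pos by (simp add: field_simps)
    then show ?thesis using False by (simp add: geom_bound_def)
  qed
qed

text \<open>This is the sum of F (h1 * ... * hj) over all tuples of shifts between -N and N. The
  recursion matches differencing, where each step multiplies the leading coefficient of the phase by
  its shift.\<close>

primrec nested_sum :: "nat \<Rightarrow> nat \<Rightarrow> (int \<Rightarrow> real) \<Rightarrow> real" where
  "nested_sum N 0 F = F 1"
| "nested_sum N (Suc j) F = (\<Sum>h\<in>{- int N..int N}. nested_sum N j (\<lambda>m. F (h * m)))"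

lemma nested_sum_nonneg: "(\<And>m. F m \<ge> 0) \<Longrightarrow> nested_sum N j F \<ge> 0"
  by (induction j arbitrary: F) (auto intro!: sum_nonneg)

text \<open>Expand the square into pairs (y, x) and sort them by h = y - x. The inner interval is
  exactly the set of x for which both x and x + h lie in \<open>{a..b}\<close>.\<close>

lemma norm_sum_unit_exp_squared_le:
  fixes a b :: int
  assumes "card {a..b} \<le> N"
  shows "(norm (\<Sum>x\<in>{a..b}. unit_exp (\<phi> x)))\<^sup>2 \<le>
    (\<Sum>h\<in>{- int N..int N}. norm (\<Sum>x\<in>{max a (a - h)..min b (b - h)}. unit_exp (\<phi> (x + h) - \<phi> x)))"
proof -
  let ?S = "\<Sum>x\<in>{a..b}. unit_exp (\<phi> x)" and ?I = "\<lambda>h. {max a (a - h)..min b (b - h)}"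
  have "complex_of_real ((norm ?S)\<^sup>2) = ?S * cnj ?S" by (rule complex_norm_square)
  also have "\<dots> = (\<Sum>(y, x)\<in>{a..b} \<times> {a..b}. unit_exp (\<phi> y - \<phi> x))"
    by (simp add: sum_product sum.cartesian_product unit_exp_diff)
  also have "\<dots> = (\<Sum>(h, x)\<in>Sigma {- int N..int N} ?I. unit_exp (\<phi> (x + h) - \<phi> x))"
    by (rule sum.reindex_bij_witness[of _ "\<lambda>(h, x). (x + h, x)" "\<lambda>(y, x). (y - x, x)"])
      (use assms in auto)
  also have "\<dots> = (\<Sum>h\<in>{- int N..int N}. \<Sum>x\<in>?I h. unit_exp (\<phi> (x + h) - \<phi> x))"
    by (subst sum.Sigma) auto
  finally have "(norm ?S)\<^sup>2 = norm (\<Sum>h\<in>{- int N..int N}. \<Sum>x\<in>?I h. unit_exp (\<phi> (x + h) - \<phi> x))"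
    by (metis abs_norm_cancel norm_of_real power_abs)
  also have "\<dots> \<le> (\<Sum>h\<in>{- int N..int N}. norm (\<Sum>x\<in>?I h. unit_exp (\<phi> (x + h) - \<phi> x)))"
    by (rule norm_sum)
  finally show ?thesis .
qed

text \<open>Each squaring lowers the degree by one, and the power mean inequality moves the exponent
  2 ^ j inside the sum over shifts, until linear phases remain and geometric series apply. Keeping a
  power of 2 * N + 1 on the left avoids the exponent 2 ^ j - (j + 1).\<close>

lemma weyl_differencing:
  fixes a b :: int
  assumes "polynomial_phase (Suc j) c \<phi>" "card {a..b} \<le> N"
  shows "norm (\<Sum>x\<in>{a..b}. unit_exp (\<phi> x)) ^ (2 ^ j) * (2 * real N + 1) ^ (j + 1)
    \<le> (2 * real N + 1) ^ (2 ^ j) * nested_sum N j (\<lambda>m. geom_bound N (of_int m * c))"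
  using assms
proof (induction j arbitrary: c \<phi> a b)
  case 0
  have lin: "\<phi> x = c * of_int x + \<phi> 0" for x
  proof -
    have "\<forall>h x. \<phi> (x + h) - \<phi> x = of_int h * c" using 0(1) by simp
    then have "\<phi> (0 + x) - \<phi> 0 = of_int x * c" by blast
    then show ?thesis by (simp add: algebra_simps)
  qed
  have "(\<Sum>x\<in>{a..b}. unit_exp (\<phi> x)) = (\<Sum>x\<in>{a..b}. unit_exp (c * of_int x + \<phi> 0))"
    by (intro sum.cong refl arg_cong[where f = unit_exp] lin)
  then have "norm (\<Sum>x\<in>{a..b}. unit_exp (\<phi> x)) \<le> geom_bound N c"
    using norm_sum_linear_phase_le[OF 0(2), of c "\<phi> 0"] by simp
  then show ?case by (simp add: mult.commute mult_left_mono)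
next
  case (Suc j)
  let ?S = "\<Sum>x\<in>{a..b}. unit_exp (\<phi> x)" and ?I = "\<lambda>h. {max a (a - h)..min b (b - h)}"
  let ?T = "\<lambda>h. norm (\<Sum>x\<in>?I h. unit_exp (\<phi> (x + h) - \<phi> x))"
  let ?L = "2 * real N + 1"
  have cardH: "real (card {- int N..int N}) = ?L" by simp
  obtain n where n: "2 ^ j = Suc n" by (metis Suc_pred zero_less_power pos2)
  have "norm ?S ^ (2 ^ Suc j) = ((norm ?S)\<^sup>2) ^ (2 ^ j)" by (simp add: power_mult)
  also have "\<dots> \<le> (\<Sum>h\<in>{- int N..int N}. ?T h) ^ (2 ^ j)"
    by (intro power_mono norm_sum_unit_exp_squared_le Suc.prems) auto
  also have "\<dots> \<le> ?L ^ n * (\<Sum>h\<in>{- int N..int N}. ?T h ^ (2 ^ j))"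
    using weighted_power_mean[of "{- int N..int N}" "\<lambda>_. 1" ?T n] cardH by (simp add: n)
  finally have "norm ?S ^ (2 ^ Suc j) * ?L ^ (Suc j + 1) \<le>
     ?L ^ n * (\<Sum>h\<in>{- int N..int N}. ?T h ^ (2 ^ j)) * ?L ^ (Suc j + 1)"
    by (intro mult_right_mono) auto
  also have "\<dots> = ?L ^ (2 ^ j) * (\<Sum>h\<in>{- int N..int N}. ?T h ^ (2 ^ j) * ?L ^ (j + 1))"
    by (simp add: n sum_distrib_right sum_distrib_left mult_ac)
  also have "\<dots> \<le> ?L ^ (2 ^ j) * (\<Sum>h\<in>{- int N..int N}.
      ?L ^ (2 ^ j) * nested_sum N j (\<lambda>m. geom_bound N (of_int m * (of_int h * c))))"
  proof (intro mult_left_mono sum_mono Suc.IH)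
    fix h
    show "polynomial_phase (Suc j) (of_int h * c) (\<lambda>x. \<phi> (x + h) - \<phi> x)" 
      using Suc.prems(1) polynomial_phase.simps(2)[of "Suc j"] by blast
    have "card (?I h) \<le> card {a..b}" by (intro card_mono) auto
    then show "card (?I h) \<le> N" using Suc.prems(2) by simp
  qed auto
  also have "\<dots> = ?L ^ (2 ^ Suc j) * nested_sum N (Suc j) (\<lambda>m. geom_bound N (of_int m * c))"
    by (simp add: sum_distrib_left power_add mult_2 mult_ac)
  finally show ?case .
qed

section \<open>Products of shifts and the divisor bound\<close>

lemma card_int_divisors_le:
  fixes m :: int
  assumes "m \<noteq> 0"
  shows "card {h. h dvd m} \<le> 2 * card {e. e dvd nat \<bar>m\<bar>}"
proof -
  let ?D = "{e. e dvd nat \<bar>m\<bar>}"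
  have fin: "finite ?D" using assms by (intro finite_divisors_nat) auto
  have "{h. h dvd m} \<subseteq> int ` ?D \<union> (\<lambda>e. - int e) ` ?D"
  proof
    fix h assume "h \<in> {h. h dvd m}"
    then have "nat \<bar>h\<bar> \<in> ?D" by (simp add: nat_abs_dvd_iff)
    moreover have "h = int (nat \<bar>h\<bar>) \<or> h = - int (nat \<bar>h\<bar>)" by auto
    ultimately show "h \<in> int ` ?D \<union> (\<lambda>e. - int e) ` ?D" by blast
  qed
  then have "card {h. h dvd m} \<le> card (int ` ?D \<union> (\<lambda>e. - int e) ` ?D)"
    using fin by (intro card_mono) auto
  also have "\<dots> \<le> card (int ` ?D) + card ((\<lambda>e. - int e) ` ?D)" by (rule card_Un_le)
  also have "\<dots> \<le> 2 * card ?D" using card_image_le[OF fin, of int] card_image_le[OF fin, of "\<lambda>e. - int e"]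
    by linarith
  finally show ?thesis .
qed

text \<open>Tuples are sorted by their product. Product 0 forces a zero entry, which happens for at
  most j * (2 * N + 1) ^ (j - 1) tuples; a nonzero product is attained at most (2 * D) ^ j times,
  each entry being a divisor up to sign. \<open>D\<close> covers all integers up to
  \<open>N ^ J\<close> with \<open>J\<close> fixed, so it survives the induction on
  \<open>j\<close>.\<close>

lemma nested_sum_le:
  fixes F :: "int \<Rightarrow> real"
  assumes "\<And>m. F m \<ge> 0" "\<And>m. 0 < m \<Longrightarrow> m \<le> N ^ J \<Longrightarrow> real (card {e. e dvd m}) \<le> D"
    and "D \<ge> 0" "N \<ge> 1" "j \<le> J"
  shows "nested_sum N j F \<le> real j * (2 * real N + 1) ^ (j - 1) * F 0
    + (2 * D) ^ j * (\<Sum>m\<in>{- int (N ^ j)..int (N ^ j)} - {0}. F m)"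
  using assms(1,5)
proof (induction j arbitrary: F)
  case 0
  have "{- int (N ^ 0)..int (N ^ 0)} - {0} = {-1, 1}" by auto
  then show ?case using 0(1)[of "-1"] by simp
next
  case (Suc j)
  let ?H = "{- int N..int N}" and ?L = "2 * real N + 1"
  let ?M = "\<lambda>j. {- int (N ^ j)..int (N ^ j)} - {0}"
  have const: "nested_sum N j (\<lambda>_. c) = ?L ^ j * c" for c
    by (induction j) auto
  have Hsplit: "?H = insert 0 (?H - {0})" by auto
  have cH: "real (card (?H - {0})) = 2 * real N" by (subst card_Diff_singleton) auto
  \<comment> \<open>A pair (h, m) of nonzero factors is recorded as (h * m, h): the second entry
    divides the first, and together they determine m.\<close>
  have swap: "(\<Sum>h\<in>?H - {0}. \<Sum>m\<in>?M j. F (h * m)) \<le> 2 * D * (\<Sum>n\<in>?M (Suc j). F n)"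
  proof -
    have "(\<Sum>h\<in>?H - {0}. \<Sum>m\<in>?M j. F (h * m)) = (\<Sum>(h, m)\<in>(?H - {0}) \<times> ?M j. F (h * m))"
      by (simp add: sum.cartesian_product)
    also have "\<dots> = (\<Sum>(n, h)\<in>(\<lambda>(h, m). (h * m, h)) ` ((?H - {0}) \<times> ?M j). F n)"
      by (subst sum.reindex) (auto simp: inj_on_def case_prod_beta)
    also have "\<dots> \<le> (\<Sum>(n, h)\<in>Sigma (?M (Suc j)) (\<lambda>n. {h. h dvd n}). F n)"
    proof (rule sum_mono2)
      show "finite (Sigma (?M (Suc j)) (\<lambda>n. {h. h dvd n}))"
        by (intro finite_SigmaI) auto
      show "(\<lambda>(h, m). (h * m, h)) ` ((?H - {0}) \<times> ?M j) \<subseteq> Sigma (?M (Suc j)) (\<lambda>n. {h. h dvd n})"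
      proof
        fix z assume "z \<in> (\<lambda>(h, m). (h * m, h)) ` ((?H - {0}) \<times> ?M j)"
        then obtain y where y: "y \<in> (?H - {0}) \<times> ?M j" "z = (\<lambda>(h, m). (h * m, h)) y" by blast
        obtain h m where "y = (h, m)" by (cases y)
        with y have z: "z = (h * m, h)" "h \<in> ?H - {0}" "m \<in> ?M j" by auto
        have "\<bar>h * m\<bar> \<le> int N * int N ^ j"
          unfolding abs_mult using z by (intro mult_mono) auto
        then have "- (int N * int N ^ j) \<le> h * m \<and> h * m \<le> int N * int N ^ j" by linarith
        then show "z \<in> Sigma (?M (Suc j)) (\<lambda>n. {h. h dvd n})" using z by simp
      qed
    qed (use Suc.prems in auto)
    also have "\<dots> = (\<Sum>n\<in>?M (Suc j). real (card {h. h dvd n}) * F n)"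
      by (subst sum.Sigma[symmetric]) auto
    also have "\<dots> \<le> (\<Sum>n\<in>?M (Suc j). 2 * D * F n)"
    proof (intro sum_mono mult_right_mono Suc.prems)
      fix n assume n: "n \<in> ?M (Suc j)"
      have "\<bar>n\<bar> \<le> int (N ^ Suc j)" using n by auto
      also have "\<dots> \<le> int (N ^ J)" using assms(4) Suc.prems by (intro of_nat_mono power_increasing) auto
      finally have "nat \<bar>n\<bar> \<le> N ^ J" by linarith
      then have "real (card {e. e dvd nat \<bar>n\<bar>}) \<le> D" using n by (intro assms(2)) auto
      then show "real (card {h. h dvd n}) \<le> 2 * D" using card_int_divisors_le[of n] n by auto
    qed
    finally show ?thesis by (simp add: sum_distrib_left)
  qed
  have "nested_sum N (Suc j) F = nested_sum N j (\<lambda>m. F 0) + (\<Sum>h\<in>?H - {0}. nested_sum N j (\<lambda>m. F (h * m)))"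
    unfolding nested_sum.simps by (subst Hsplit, subst sum.insert) auto
  also have "\<dots> \<le> ?L ^ j * F 0 + (\<Sum>h\<in>?H - {0}. real j * ?L ^ (j - 1) * F 0 + (2 * D) ^ j * (\<Sum>m\<in>?M j. F (h * m)))"
  proof (intro add_mono sum_mono)
    fix h
    show "nested_sum N j (\<lambda>m. F (h * m)) \<le> real j * ?L ^ (j - 1) * F 0 + (2 * D) ^ j * (\<Sum>m\<in>?M j. F (h * m))"
      using Suc.IH[of "\<lambda>m. F (h * m)"] Suc.prems by simp
  qed (simp add: const)
  also have "\<dots> = ?L ^ j * F 0 + 2 * real N * (real j * ?L ^ (j - 1) * F 0)
      + (2 * D) ^ j * (\<Sum>h\<in>?H - {0}. \<Sum>m\<in>?M j. F (h * m))"
    by (simp only: sum.distrib sum_constant cH sum_distrib_left add.assoc)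
  also have "\<dots> \<le> ?L ^ j * F 0 + ?L * (real j * ?L ^ (j - 1) * F 0)
      + (2 * D) ^ j * (2 * D * (\<Sum>n\<in>?M (Suc j). F n))"
    using assms(3) Suc.prems
    by (intro add_mono mult_left_mono swap mult_right_mono) auto
  also have "?L ^ j * F 0 + ?L * (real j * ?L ^ (j - 1) * F 0) = real (Suc j) * ?L ^ (Suc j - 1) * F 0"
    by (cases j) (auto simp: algebra_simps)
  finally show ?case by (simp add: mult.assoc mult.left_commute)
qed

section \<open>Reciprocal sums over multiples of a well approximated frequency\<close>

lemma dist_int_ge_frac: "min (frac x) (1 - frac x) \<le> dist_int x"
proof -
  have "min (frac x) (1 - frac x) \<le> \<bar>x - of_int n\<bar>" for n :: int
  proof (cases "n \<le> \<lfloor>x\<rfloor>")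
    case True
    then have "of_int n \<le> (of_int \<lfloor>x\<rfloor> :: real)" by linarith
    then show ?thesis unfolding frac_def by linarith
  next
    case False
    then have "of_int n \<ge> (of_int \<lfloor>x\<rfloor> + 1 :: real)" by linarith
    then show ?thesis unfolding frac_def by linarith
  qed
  then show ?thesis by (simp add: dist_int_def)
qed

text \<open>Since 0 < t < q and \<open>a\<close> is coprime to \<open>q\<close>, the integer a * t -
  n * q is nonzero, so a * t / q has distance at least 1 / q from n. Passing from a / q to \<alpha>
  costs at most t / q ^ 2 \<le> 1 / (2 * q).\<close>

lemma separated_multiples:
  fixes q t :: nat and a n :: int
  assumes "coprime a (int q)" "\<bar>\<alpha> - of_int a / real q\<bar> \<le> 1 / (real q)\<^sup>2" "t > 0" "2 * t \<le> q"
  shows "1 / (2 * real q) \<le> \<bar>\<alpha> * real t - of_int n\<bar>"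
proof -
  have q: "real q > 0" using assms by simp
  have "a * int t - n * int q \<noteq> 0"
  proof
    assume "a * int t - n * int q = 0"
    then have "int q dvd a * int t" by (metis dvd_triv_right eq_iff_diff_eq_0)
    then have "int q dvd int t" using assms(1) by (metis coprime_commute coprime_dvd_mult_right_iff)
    then have "q \<le> t" using assms(3) by (simp add: dvd_imp_le)
    then show False using assms by linarith
  qed
  then have "1 \<le> \<bar>real_of_int (a * int t - n * int q)\<bar>" by linarith
  then have 1: "1 / real q \<le> \<bar>of_int a * real t / real q - of_int n\<bar>"
  proof -
    have "of_int a * real t / real q - of_int n = real_of_int (a * int t - n * int q) / real q"
      using q by (simp add: field_simps)
    then show ?thesis using \<open>1 \<le> \<bar>real_of_int (a * int t - n * int q)\<bar>\<close> q
      by (simp add: abs_divide divide_right_mono)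
  qed
  have "\<bar>(\<alpha> - of_int a / real q) * real t\<bar> \<le> 1 / (real q)\<^sup>2 * (real q / 2)"
    unfolding abs_mult using assms by (intro mult_mono) auto
  also have "\<dots> = 1 / (2 * real q)" using q by (simp add: power2_eq_square)
  finally have 2: "\<bar>\<alpha> * real t - of_int a * real t / real q\<bar> \<le> 1 / (2 * real q)"
    by (simp add: algebra_simps)
  have 3: "1 / real q = 1 / (2 * real q) + 1 / (2 * real q)" by simp
  show ?thesis using 1 2 3 by linarith
qed

lemma sum_inverse_le_ln: "(\<Sum>l = 1..n. 1 / real l) \<le> 1 + ln (real n)"
proof (induction n)
  case (Suc n)
  show ?case
  proof (cases "n = 0")
    case True
    then show ?thesis by simp
  next
    case False
    have "ln (real n / real (Suc n)) \<le> real n / real (Suc n) - 1"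
      using False by (intro ln_le_minus_one) auto
    also have "\<dots> = - (1 / real (Suc n))" by (simp add: field_simps)
    finally have "1 / real (Suc n) \<le> ln (real (Suc n)) - ln (real n)"
      using False by (simp add: ln_div)
    then show ?thesis using Suc by simp
  qed
qed simp

text \<open>Within a block of q div 2 + 1 consecutive integers the fractional parts of \<alpha> * m
  are 1 / (2 * q)-separated, so they occupy different cells when the unit interval is cut into 2 * q
  equal cells. The two cells adjacent to an integer cost N each; the others form a harmonic
  sum.\<close>

lemma sum_geom_bound_block_le:
  fixes q m0 N :: nat and a :: int
  assumes "coprime a (int q)" "\<bar>\<alpha> - of_int a / real q\<bar> \<le> 1 / (real q)\<^sup>2" "q \<ge> 1"
  shows "(\<Sum>m\<in>{m0..<m0 + (q div 2 + 1)}. geom_bound N (\<alpha> * real m))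
    \<le> 2 * real N + 4 * real q * (1 + ln (2 * real q))"
proof -
  let ?B = "{m0..<m0 + (q div 2 + 1)}"
  define l where "l m = nat \<lfloor>2 * real q * frac (\<alpha> * real m)\<rfloor>" for m :: nat
  \<comment> \<open>Majorant on cell \<open>i\<close>, adding the reciprocals of the distances to
    both ends. Division by zero yields 0, which is why the cells 0 and 2 * q - 1 carry
    \<open>N\<close> separately.\<close>
  define G where "G i = (if i = 0 \<or> i = 2 * q - 1 then real N else 0)
    + 2 * real q / real i + 2 * real q / real (2 * q - 1 - i)" for i :: nat
  have q: "real q \<ge> 1" using assms by simp
  have lbd: "real (l m) \<le> 2 * real q * frac (\<alpha> * real m)" "2 * real q * frac (\<alpha> * real m) < real (l m) + 1" for m
  proof -
    have "0 \<le> 2 * real q * frac (\<alpha> * real m)" by simp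
    then show "real (l m) \<le> 2 * real q * frac (\<alpha> * real m)" "2 * real q * frac (\<alpha> * real m) < real (l m) + 1"
      unfolding l_def by linarith+
  qed
  have lless: "l m < 2 * q" for m
  proof -
    have "2 * real q * frac (\<alpha> * real m) < 2 * real q * 1"
      using q by (intro mult_strict_left_mono frac_lt_1) auto
    then have "real (l m) < real (2 * q)" using lbd(1)[of m] by simp
    then show ?thesis by linarith
  qed
  have inj: "inj_on l ?B"
  proof (rule linorder_inj_onI')
    fix i j assume ij: "i \<in> ?B" "j \<in> ?B" "i < j"
    show "l i \<noteq> l j"
    proof
      assume "l i = l j"
      then have *: "2 * real q * \<bar>frac (\<alpha> * real j) - frac (\<alpha> * real i)\<bar> < 1"
        using lbd[of i] lbd[of j] by (simp add: abs_if algebra_simps)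
      have "frac (\<alpha> * real j) - frac (\<alpha> * real i) =
          \<alpha> * real (j - i) - of_int (\<lfloor>\<alpha> * real j\<rfloor> - \<lfloor>\<alpha> * real i\<rfloor>)"
        using ij by (simp add: frac_def of_nat_diff algebra_simps)
      moreover have "1 / (2 * real q) \<le> \<bar>\<alpha> * real (j - i) - of_int (\<lfloor>\<alpha> * real j\<rfloor> - \<lfloor>\<alpha> * real i\<rfloor>)\<bar>"
        using ij by (intro separated_multiples[OF assms(1,2)]) auto
      ultimately have "1 / (2 * real q) \<le> \<bar>frac (\<alpha> * real j) - frac (\<alpha> * real i)\<bar>" by simp
      then show False using * q by (simp add: field_simps)
    qed
  qed
  have le: "geom_bound N (\<alpha> * real m) \<le> G (l m)" for m
  proof (cases "l m = 0 \<or> l m = 2 * q - 1")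
    case True
    then have "real N \<le> G (l m)" unfolding G_def by (auto intro!: add_increasing2 divide_nonneg_nonneg)
    then show ?thesis using geom_bound_le[of N "\<alpha> * real m"] by linarith
  next
    case False
    define x where "x = \<alpha> * real m"
    have l1: "real (l m) > 0" and l2: "real (2 * q - 1 - l m) > 0" using False lless[of m] by auto
    have r2: "real (2 * q - 1 - l m) = 2 * real q - 1 - real (l m)" using lless[of m] by linarith
    have f1: "real (l m) / (2 * real q) \<le> frac x" using lbd(1)[of m] q by (simp add: x_def field_simps)
    have f2: "real (2 * q - 1 - l m) / (2 * real q) \<le> 1 - frac x"
      using lbd(2)[of m] q unfolding r2 by (simp add: x_def field_simps)
    have inv: "1 / dist_int x \<le> 2 * real q / c \<and> dist_int x > 0" if "c > 0" "c / (2 * real q) \<le> dist_int x" for c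
    proof -
      have "0 < c / (2 * real q)" using that q by simp
      then have "dist_int x > 0" using that by linarith
      then show ?thesis using that q by (simp add: field_simps)
    qed
    have "1 / dist_int x \<le> 2 * real q / real (l m) + 2 * real q / real (2 * q - 1 - l m) \<and> dist_int x > 0"
    proof (cases "frac x \<le> 1 - frac x")
      case True
      then have "real (l m) / (2 * real q) \<le> dist_int x" using dist_int_ge_frac[of x] f1 by linarith
      from inv[OF l1 this] show ?thesis by (auto intro: add_increasing2)
    next
      case False
      then have "real (2 * q - 1 - l m) / (2 * real q) \<le> dist_int x"
        using dist_int_ge_frac[of x] f2 by linarith
      from inv[OF l2 this] show ?thesis by (auto intro: add_increasing)
    qed
    then show ?thesis using geom_bound_le_inverse[of x N] False by (auto simp: G_def x_def)
  qed
  have "(\<Sum>m\<in>?B. geom_bound N (\<alpha> * real m)) \<le> (\<Sum>m\<in>?B. G (l m))" by (intro sum_mono le)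
  also have "\<dots> = (\<Sum>i\<in>l ` ?B. G i)" using inj by (simp add: sum.reindex)
  also have "\<dots> \<le> (\<Sum>i<2 * q. G i)"
    using lless by (intro sum_mono2) (auto simp: G_def)
  also have "\<dots> = (\<Sum>i<2 * q. if i = 0 \<or> i = 2 * q - 1 then real N else 0)
     + (\<Sum>i<2 * q. 2 * real q / real i) + (\<Sum>i<2 * q. 2 * real q / real (2 * q - 1 - i))"
    by (simp add: G_def sum.distrib)
  also have "(\<Sum>i<2 * q. 2 * real q / real (2 * q - 1 - i)) = (\<Sum>i<2 * q. 2 * real q / real i)"
    using sum.nat_diff_reindex[of "\<lambda>i. 2 * real q / real i" "2 * q"] by simp
  also have "(\<Sum>i<2 * q. 2 * real q / real i) = 2 * real q * (\<Sum>i = 1..2 * q - 1. 1 / real i)"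
  proof -
    have "(\<Sum>i<2 * q. 2 * real q / real i) = (\<Sum>i = 1..2 * q - 1. 2 * real q / real i)"
      by (rule sum.mono_neutral_right) (use assms in \<open>auto simp: Suc_le_eq\<close>)
    then show ?thesis by (simp add: sum_distrib_left)
  qed
  also have "(\<Sum>i<2 * q. if i = 0 \<or> i = 2 * q - 1 then real N else 0) \<le> 2 * real N"
  proof -
    have "(\<Sum>i<2 * q. if i = 0 \<or> i = 2 * q - 1 then real N else 0) = (\<Sum>i\<in>{0, 2 * q - 1}. real N)"
      by (rule sum.mono_neutral_cong_right) (use assms in auto)
    also have "\<dots> \<le> 2 * real N" by (simp add: card_insert_if)
    finally show ?thesis .
  qed
  also have "(\<Sum>i = 1..2 * q - 1. 1 / real i) \<le> 1 + ln (2 * real q)"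
  proof -
    have "ln (real (2 * q - 1)) \<le> ln (2 * real q)"
      using assms(3) by (subst ln_le_cancel_iff) auto
    then show ?thesis using sum_inverse_le_ln[of "2 * q - 1"] by linarith
  qed
  finally show ?thesis using q by (simp add: algebra_simps)
qed

lemma sum_geom_bound_le:
  fixes q X N :: nat and a :: int
  assumes "coprime a (int q)" "\<bar>\<alpha> - of_int a / real q\<bar> \<le> 1 / (real q)\<^sup>2" "q \<ge> 1"
  shows "(\<Sum>m = 1..X. geom_bound N (\<alpha> * real m))
    \<le> (2 * real X / real q + 1) * (2 * real N + 4 * real q * (1 + ln (2 * real q)))"
proof -
  let ?L = "q div 2 + 1" and ?B = "2 * real N + 4 * real q * (1 + ln (2 * real q))"
  have B0: "?B \<ge> 0" using assms by simp
  have XL: "X < (X div ?L + 1) * ?L" using dividend_less_times_div[of ?L X] by (simp add: mult.commute)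
  have "(\<Sum>m = 1..X. geom_bound N (\<alpha> * real m)) \<le> (\<Sum>m<(X div ?L + 1) * ?L. geom_bound N (\<alpha> * real m))"
    by (intro sum_mono2) (use XL in auto)
  also have "\<dots> = (\<Sum>b<X div ?L + 1. \<Sum>m\<in>{b * ?L..<b * ?L + ?L}. geom_bound N (\<alpha> * real m))"
    by (rule sum.nat_group[symmetric])
  also have "\<dots> \<le> (\<Sum>b<X div ?L + 1. ?B)"
    by (intro sum_mono sum_geom_bound_block_le[OF assms])
  also have "\<dots> = (real (X div ?L) + 1) * ?B" by simp
  also have "\<dots> \<le> (2 * real X / real q + 1) * ?B"
  proof (intro mult_right_mono add_right_mono)
    have "real (X div ?L) \<le> real X / real ?L" by (rule of_nat_div_le_of_nat)
    also have "\<dots> \<le> real X / (real q / 2)" using assms(3) by (intro divide_left_mono) auto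
    finally show "real (X div ?L) \<le> 2 * real X / real q" by (simp add: mult.commute)
  qed (rule B0)
  finally show ?thesis .
qed

section \<open>Weyl sums and the classical estimate\<close>

definition weyl_sum :: "nat \<Rightarrow> nat \<Rightarrow> real \<Rightarrow> complex" where
  "weyl_sum d N \<alpha> = (\<Sum>k = 1..N. unit_exp (\<alpha> * real k ^ d))"

lemma norm_weyl_sum_le: "norm (weyl_sum d N \<alpha>) \<le> real N"
proof -
  have "norm (weyl_sum d N \<alpha>) \<le> (\<Sum>k = 1..N. norm (unit_exp (\<alpha> * real k ^ d)))"
    unfolding weyl_sum_def by (rule norm_sum)
  then show ?thesis by simp
qed

lemma weyl_sum_eq_int: "weyl_sum d N \<alpha> = (\<Sum>x\<in>{1..int N}. unit_exp (\<alpha> * of_int x ^ d))"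
  unfolding weyl_sum_def
  by (rule sum.reindex_bij_witness[of _ nat int]) auto

text \<open>Differencing down to degree one leaves geometric sums at d! * \<alpha> times products of
  d - 1 shifts. The divisor bound reduces these products to single integers m, where the rational
  approximation controls the reciprocals. The divisor count and the logarithm are absorbed into N
  powr \<epsilon>.\<close>

lemma weyl_inequality:
  assumes "d \<ge> 2" "\<epsilon> > 0"
  obtains C where "C > 0" "\<And>N q a \<alpha>. N \<ge> 1 \<Longrightarrow> q \<ge> 1 \<Longrightarrow> q \<le> N ^ d \<Longrightarrow> coprime a (int q) \<Longrightarrow>
    \<bar>\<alpha> - of_int a / real q\<bar> \<le> 1 / (real q)\<^sup>2 \<Longrightarrow>
    norm (weyl_sum d N \<alpha>) ^ (2 ^ (d - 1)) \<le>
      C * real N ^ (2 ^ (d - 1)) * real N powr \<epsilon> * (1 / real q + 1 / real N + real q / real N ^ d)"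
proof -
  define j where "j = d - 1"
  have j: "d = Suc j" "j \<ge> 1" using assms by (auto simp: j_def)
  \<comment> \<open>The divisor bound at N ^ j enters to the power j and costs N powr (j *
    \<epsilon>1 * j) = N powr (\<epsilon> / 2); the other half is left for the logarithm of
    q.\<close>
  define \<epsilon>1 where "\<epsilon>1 = \<epsilon> / (2 * real j * real j)"
  have e1: "\<epsilon>1 > 0" using assms j by (simp add: \<epsilon>1_def)
  obtain Ct where Ct: "Ct \<ge> 1" "\<And>n::nat. n > 0 \<Longrightarrow> real (card {e. e dvd n}) \<le> Ct * real n powr \<epsilon>1"
    using divisor_bound[OF e1] by blast
  define C1 where "C1 = 2 + 2 * real d / \<epsilon>"
  have C1: "C1 \<ge> 1" using assms by (simp add: C1_def)
  define C2 where "C2 = real j * 3 ^ (j - 1) + (2 * Ct) ^ j * (32 * fact d * C1)"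
  have C2: "C2 > 0" using C1 Ct(1) by (auto simp: C2_def intro!: add_nonneg_pos mult_pos_pos)
  show ?thesis
  proof (rule that[of "3 ^ (2 ^ j) * C2"])
    show "3 ^ (2 ^ j) * C2 > 0" using C2 by simp
    fix N q :: nat and a :: int and \<alpha> :: real
    assume N: "N \<ge> 1" and q: "q \<ge> 1" "q \<le> N ^ d" and cop: "coprime a (int q)"
      and app: "\<bar>\<alpha> - of_int a / real q\<bar> \<le> 1 / (real q)\<^sup>2"
    define W where "W = 1 / real q + 1 / real N + real q / real N ^ d"
    define D where "D = Ct * real (N ^ j) powr \<epsilon>1"
    define F where "F m = geom_bound N (of_int m * (fact d * \<alpha>))" for m :: int
    define P where "P = real N powr (\<epsilon> / 2)"
    have P1: "P \<ge> 1" using N assms by (simp add: P_def ge_one_powr_ge_zero)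
    have WN: "1 / real N \<le> W" by (simp add: W_def)
    have Dj: "(2 * D) ^ j = (2 * Ct) ^ j * P"
    proof -
      have "(real (N ^ j) powr \<epsilon>1) ^ j = real N powr (real j * \<epsilon>1 * real j)"
        using N by (simp add: powr_power powr_powr flip: powr_realpow)
      also have "real j * \<epsilon>1 * real j = \<epsilon> / 2" using j by (simp add: \<epsilon>1_def)
      finally show ?thesis by (simp add: D_def P_def power_mult_distrib)
    qed
    have logq: "1 + ln (2 * real q) \<le> C1 * P"
    proof -
      have "ln (2 * real q) = ln 2 + ln (real q)" using q by (simp add: ln_mult)
      also have "ln (real q) \<le> ln (real (N ^ d))" using q N by (subst ln_le_cancel_iff) (auto simp del: of_nat_power)
      also have "ln (real (N ^ d)) = real d * ln (real N)" using N by (simp add: ln_realpow)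
      also have "ln (real N) \<le> P / (\<epsilon> / 2)" unfolding P_def
        using N assms by (intro ln_powr_bound) auto
      finally have "ln (2 * real q) \<le> ln 2 + real d * (P / (\<epsilon> / 2))" by (simp add: mult_left_mono)
      also have "ln 2 \<le> (1::real)" using ln_2_less_1 by simp
      finally have "1 + ln (2 * real q) \<le> 2 * P + real d * (P / (\<epsilon> / 2))" using P1 by linarith
      then show ?thesis using assms by (simp add: C1_def field_simps)
    qed
    have sumF: "(\<Sum>m\<in>{- int (N ^ j)..int (N ^ j)} - {0}. F m) \<le> 32 * fact d * C1 * P * real N ^ d * W"
    proof -
      let ?M = "N ^ j"
      have "(\<Sum>m\<in>{- int ?M..int ?M} - {0}. F m) = (\<Sum>m\<in>{1..int ?M}. F m) + (\<Sum>m\<in>{- int ?M..-1}. F m)"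
        by (subst sum.union_disjoint[symmetric]) (auto intro!: sum.cong)
      also have "(\<Sum>m\<in>{- int ?M..-1}. F m) = (\<Sum>m\<in>{1..int ?M}. F m)"
        by (rule sum.reindex_bij_witness[of _ uminus uminus])
          (auto simp: F_def simp flip: minus_mult_left)
      also have "(\<Sum>m\<in>{1..int ?M}. F m) = (\<Sum>m = 1..?M. geom_bound N (\<alpha> * real (fact d * m)))"
        by (rule sum.reindex_bij_witness[of _ int nat])
          (auto simp: F_def mult_ac nat_le_iff simp del: of_nat_power)
      \<comment> \<open>The multiples of d! are part of a full initial segment, so the approximation
        of \<alpha> can be used instead of one for d! * \<alpha>.\<close>
      also have "\<dots> = (\<Sum>m\<in>(\<lambda>m. fact d * m) ` {1..?M}. geom_bound N (\<alpha> * real m))"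
        by (subst sum.reindex) (auto simp: inj_on_def)
      also have "\<dots> \<le> (\<Sum>m = 1..fact d * ?M. geom_bound N (\<alpha> * real m))"
        by (intro sum_mono2) (auto simp: Suc_le_eq)
      also have "\<dots> \<le> (2 * real (fact d * ?M) / real q + 1) * (2 * real N + 4 * real q * (1 + ln (2 * real q)))"
        by (rule sum_geom_bound_le[OF cop app q(1)])
      also have "\<dots> \<le> (2 * fact d * (real N ^ j / real q + 1)) * (4 * (C1 * P) * (real N + real q))"
      proof (intro mult_mono)
        have "1 \<le> 2 * (fact d :: real)" using fact_ge_1[of d, where 'a = real] by linarith
        then show "2 * real (fact d * ?M) / real q + 1 \<le> 2 * fact d * (real N ^ j / real q + 1)"
          by (simp add: algebra_simps)
        have "1 \<le> C1 * P" using C1 P1 by (simp add: mult_ge1_I)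
        then have "2 * real N \<le> 4 * (C1 * P) * real N" using N by simp
        moreover have "4 * real q * (1 + ln (2 * real q)) \<le> 4 * real q * (C1 * P)"
          using logq q by (intro mult_left_mono) auto
        ultimately show "2 * real N + 4 * real q * (1 + ln (2 * real q)) \<le> 4 * (C1 * P) * (real N + real q)"
          by (simp add: algebra_simps)
      qed (use q in auto)
      also have "\<dots> = 8 * fact d * C1 * P * ((real N ^ j / real q + 1) * (real N + real q))" by simp
      also have "\<dots> \<le> 8 * fact d * C1 * P * (2 * real N ^ d * W)"
      proof (intro mult_left_mono)
        have NW: "real N ^ d * W = real N ^ d / real q + real N ^ j + real q"
          using N q by (simp add: W_def j field_simps)
        have "(real N ^ j / real q + 1) * (real N + real q) = real N ^ d / real q + real N ^ j + real N + real q"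
          using q by (simp add: j field_simps)
        moreover have "real N \<le> real N ^ j" using N j by (intro self_le_power) auto
        moreover have "real N ^ d / real q \<ge> 0" by simp
        ultimately show "(real N ^ j / real q + 1) * (real N + real q) \<le> 2 * real N ^ d * W"
          using NW by linarith
      qed (use C1 P1 in auto)
      finally show ?thesis by (simp add: mult_ac)
    qed
    have ns: "nested_sum N j F \<le> C2 * real N powr \<epsilon> * real N ^ d * W"
    proof -
      have "nested_sum N j F \<le> real j * (2 * real N + 1) ^ (j - 1) * F 0
        + (2 * D) ^ j * (\<Sum>m\<in>{- int (N ^ j)..int (N ^ j)} - {0}. F m)"
      proof (rule nested_sum_le[where J = j])
        fix m :: nat assume m: "0 < m" "m \<le> N ^ j"
        have "real m powr \<epsilon>1 \<le> real (N ^ j) powr \<epsilon>1" using m e1 by (intro powr_mono2) auto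
        then show "real (card {e. e dvd m}) \<le> D"
          unfolding D_def using Ct(2)[OF m(1)] Ct(1) by (smt (verit) mult_left_mono)
      qed (use N Ct(1) in \<open>auto simp: F_def D_def\<close>)
      also have "\<dots> \<le> real j * (3 * real N) ^ (j - 1) * real N
        + (2 * Ct) ^ j * P * (32 * fact d * C1 * P * real N ^ d * W)"
        unfolding Dj using N P1 Ct(1) sumF
        by (intro add_mono mult_mono power_mono mult_left_mono) (auto simp: F_def geom_bound_le)
      \<comment> \<open>Tuples with product zero contribute N ^ j up to constants; the term 1 / N of
        \<open>W\<close> accounts for them.\<close>
      also have "real j * (3 * real N) ^ (j - 1) * real N = real j * 3 ^ (j - 1) * (real N ^ d * (1 / real N))"
        using j N by (cases j) (auto simp: power_mult_distrib)
      also have "\<dots> \<le> real j * 3 ^ (j - 1) * (real N powr \<epsilon> * real N ^ d * W)"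
      proof (intro mult_left_mono)
        have "real N ^ d * (1 / real N) \<le> real N ^ d * W" using WN by (intro mult_left_mono) auto
        also have "\<dots> \<le> real N powr \<epsilon> * (real N ^ d * W)"
        proof -
          have "1 \<le> real N powr \<epsilon>" using N assms by (intro ge_one_powr_ge_zero) auto
          moreover have "0 \<le> real N ^ d * W" by (simp add: W_def)
          ultimately show ?thesis by (metis mult_1 mult_right_mono)
        qed
        finally show "real N ^ d * (1 / real N) \<le> real N powr \<epsilon> * real N ^ d * W" by (simp add: mult.assoc)
      qed auto
      also have "(2 * Ct) ^ j * P * (32 * fact d * C1 * P * real N ^ d * W) =
          (2 * Ct) ^ j * (32 * fact d * C1) * (real N powr \<epsilon> * real N ^ d * W)"
      proof -
        have PP: "real N powr \<epsilon> = P * P" by (simp add: P_def flip: powr_add)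
        show ?thesis unfolding PP by (simp add: mult_ac)
      qed
      finally show ?thesis by (simp add: C2_def algebra_simps)
    qed
    have "norm (weyl_sum d N \<alpha>) ^ (2 ^ j) * real N ^ d \<le> norm (weyl_sum d N \<alpha>) ^ (2 ^ j) * (2 * real N + 1) ^ d"
      by (intro mult_left_mono power_mono) auto
    also have "\<dots> \<le> (2 * real N + 1) ^ (2 ^ j) * nested_sum N j F"
      unfolding weyl_sum_eq_int F_def
      using weyl_differencing[of j "fact d * \<alpha>" "\<lambda>x. \<alpha> * of_int x ^ d" 1 "int N" N]
        polynomial_phase_monomial[of d \<alpha>] by (simp add: j)
    also have "\<dots> \<le> (3 * real N) ^ (2 ^ j) * (C2 * real N powr \<epsilon> * real N ^ d * W)"
      using ns N by (intro mult_mono power_mono) (auto simp: F_def intro!: nested_sum_nonneg)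
    finally have "norm (weyl_sum d N \<alpha>) ^ (2 ^ j) * real N ^ d \<le>
       (3 ^ (2 ^ j) * C2 * real N ^ (2 ^ j) * real N powr \<epsilon> * W) * real N ^ d"
      by (simp add: power_mult_distrib mult_ac)
    then show "norm (weyl_sum d N \<alpha>) ^ (2 ^ (d - 1)) \<le>
      3 ^ (2 ^ j) * C2 * real N ^ (2 ^ (d - 1)) * real N powr \<epsilon> * (1 / real q + 1 / real N + real q / real N ^ d)"
      using N by (simp add: j W_def)
  qed
qed

section \<open>Major arcs\<close>

lemma norm_sum_mult_le_by_parts:
  fixes c w :: "nat \<Rightarrow> complex"
  assumes "\<And>k. k \<le> Suc n \<Longrightarrow> norm (\<Sum>i<k. c i) \<le> B"
  shows "norm (\<Sum>k<Suc n. c k * w k) \<le> B * (norm (w n) + (\<Sum>k<n. norm (w (Suc k) - w k)))"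
proof -
  let ?C = "\<lambda>k. \<Sum>i<k. c i"
  have "(\<Sum>k<Suc n. c k * w k) = ?C (Suc n) * w n - (\<Sum>k<n. ?C (Suc k) * (w (Suc k) - w k))"
  proof (induction n)
    case (Suc n)
    have "(\<Sum>k<Suc (Suc n). c k * w k) = (\<Sum>k<Suc n. c k * w k) + c (Suc n) * w (Suc n)" by simp
    then show ?case unfolding Suc.IH by (simp add: algebra_simps)
  qed simp
  also have "norm \<dots> \<le> norm (?C (Suc n) * w n) + norm (\<Sum>k<n. ?C (Suc k) * (w (Suc k) - w k))"
    by (rule norm_triangle_ineq4)
  also have "\<dots> \<le> B * norm (w n) + (\<Sum>k<n. B * norm (w (Suc k) - w k))"
  proof (intro add_mono order_trans[OF norm_sum] sum_mono)
    show "norm (?C (Suc n) * w n) \<le> B * norm (w n)"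
      unfolding norm_mult by (intro mult_right_mono assms) auto
    show "norm (?C (Suc k) * (w (Suc k) - w k)) \<le> B * norm (w (Suc k) - w k)" if "k \<in> {..<n}" for k
      unfolding norm_mult using that by (intro mult_right_mono assms) auto
  qed
  finally show ?thesis by (simp add: sum_distrib_left algebra_simps)
qed

text \<open>Full periods cancel, so only a remainder of fewer than \<open>q\<close> terms
  survives.\<close>

lemma norm_sum_periodic_le:
  fixes f :: "nat \<Rightarrow> complex"
  assumes "q \<ge> 1" "\<And>i. f (i + q) = f i" "(\<Sum>i<q. f i) = 0" "\<And>i. norm (f i) \<le> B" "B \<ge> 0"
  shows "norm (\<Sum>i<k. f i) \<le> B * real q"
proof (induction k rule: less_induct)
  case (less k)
  show ?case
  proof (cases "k < q")
    case True
    have "norm (\<Sum>i<k. f i) \<le> (\<Sum>i<k. B)" by (intro order_trans[OF norm_sum] sum_mono assms)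
    also have "\<dots> \<le> B * real q" using True assms(5) by (simp add: mult.commute mult_left_mono)
    finally show ?thesis .
  next
    case False
    have "(\<Sum>i<k. f i) = (\<Sum>i=0..<q. f i) + (\<Sum>i=q..<k. f i)"
      unfolding lessThan_atLeast0 using False by (subst sum.atLeastLessThan_concat) auto
    also have "(\<Sum>i=q..<k. f i) = (\<Sum>i=0+q..<(k-q)+q. f i)" using False by simp
    also have "\<dots> = (\<Sum>i=0..<k-q. f (i + q))" by (rule sum.shift_bounds_nat_ivl)
    finally have "(\<Sum>i<k. f i) = (\<Sum>i<k-q. f i)" using assms by (simp add: lessThan_atLeast0)
    then show ?thesis using less[of "k - q"] False assms by simp
  qed
qed

lemma unit_exp_rational_power_periodic:
  fixes a :: int and q k d :: nat
  assumes "q \<ge> 1"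
  shows "unit_exp (of_int a / real q * real (k + q) ^ d) = unit_exp (of_int a / real q * real k ^ d)"
proof -
  have "int (k + q) ^ d mod int q = int k ^ d mod int q"
    by (subst power_mod[symmetric]) (simp add: power_mod)
  then have "int q dvd int (k + q) ^ d - int k ^ d" by (simp add: mod_eq_dvd_iff)
  then obtain z where "int (k + q) ^ d - int k ^ d = int q * z" by (elim dvdE)
  then have "int (k + q) ^ d = int k ^ d + int q * z" by simp
  then have "real_of_int (int (k + q) ^ d) = real_of_int (int k ^ d + int q * z)" by (simp only:)
  then have "real (k + q) ^ d = real k ^ d + real q * of_int z" by simp
  then have "of_int a / real q * real (k + q) ^ d = of_int a / real q * real k ^ d + of_int (a * z)"
    using assms by (simp add: field_simps)
  then show ?thesis by (simp only: unit_exp_add unit_exp_of_int mult_1_right)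
qed

lemma sum_norm_unit_exp_diff_le:
  fixes u :: "nat \<Rightarrow> real"
  assumes "mono u"
  shows "(\<Sum>k<n. norm (unit_exp (\<beta> * u (Suc k)) - unit_exp (\<beta> * u k))) \<le> 2 * pi * \<bar>\<beta>\<bar> * (u n - u 0)"
proof -
  have "norm (unit_exp (\<beta> * u (Suc k)) - unit_exp (\<beta> * u k)) \<le> 2 * pi * \<bar>\<beta>\<bar> * (u (Suc k) - u k)" for k
  proof -
    have "unit_exp (\<beta> * u (Suc k)) = unit_exp (\<beta> * u k) * unit_exp (\<beta> * (u (Suc k) - u k))"
      by (simp flip: unit_exp_add add: algebra_simps)
    then have "unit_exp (\<beta> * u (Suc k)) - unit_exp (\<beta> * u k) =
        unit_exp (\<beta> * u k) * (unit_exp (\<beta> * (u (Suc k) - u k)) - 1)"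
      by (simp add: algebra_simps)
    then have "norm (unit_exp (\<beta> * u (Suc k)) - unit_exp (\<beta> * u k)) =
        norm (unit_exp (\<beta> * (u (Suc k) - u k)) - 1)" by (simp add: norm_mult)
    also have "\<dots> \<le> 2 * pi * \<bar>\<beta> * (u (Suc k) - u k)\<bar>" by (rule norm_unit_exp_minus_one_le)
    also have "\<bar>\<beta> * (u (Suc k) - u k)\<bar> = \<bar>\<beta>\<bar> * (u (Suc k) - u k)"
      using monoD[OF assms, of k "Suc k"] by (simp add: abs_mult)
    finally show ?thesis by (simp add: mult.assoc)
  qed
  then have "(\<Sum>k<n. norm (unit_exp (\<beta> * u (Suc k)) - unit_exp (\<beta> * u k))) \<le>
      (\<Sum>k<n. 2 * pi * \<bar>\<beta>\<bar> * (u (Suc k) - u k))" by (intro sum_mono)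
  also have "\<dots> = 2 * pi * \<bar>\<beta>\<bar> * (u n - u 0)"
    by (simp only: sum_distrib_left[symmetric] sum_lessThan_telescope)
  finally show ?thesis .
qed

lemma weyl_sum_eq_lessThan: "weyl_sum d N \<alpha> = (\<Sum>k<N. unit_exp (\<alpha> * real (Suc k) ^ d))"
  unfolding weyl_sum_def by (rule sum.reindex_bij_witness[of _ Suc "\<lambda>k. k - 1"]) auto

text \<open>The partial sums of \<open>e(a k\<^sup>d / q)\<close> minus its mean over a period stay bounded by \<open>2 q\<close>.\<close>

lemma major_arc_approximation:
  fixes a :: int and q N d :: nat
  assumes "q \<ge> 1"
  shows "norm (weyl_sum d N (of_int a / real q + \<beta>) -
      weyl_sum d q (of_int a / real q) / of_nat q * weyl_sum d N \<beta>)
    \<le> 2 * real q * (1 + 8 * \<bar>\<beta>\<bar> * real N ^ d)"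
proof (cases N)
  case 0
  then show ?thesis by (simp add: weyl_sum_def)
next
  case (Suc n)
  define m where "m = weyl_sum d q (of_int a / real q) / of_nat q"
  define f where "f k = unit_exp (of_int a / real q * real (Suc k) ^ d) - m" for k
  define w where "w k = unit_exp (\<beta> * real (Suc k) ^ d)" for k
  have m1: "norm m \<le> 1"
    using norm_weyl_sum_le[of d q "of_int a / real q"] assms by (simp add: m_def norm_divide divide_le_eq_1)
  have "norm (\<Sum>i<k. f i) \<le> 2 * real q" for k
  proof (rule norm_sum_periodic_le[OF assms])
    show "f (i + q) = f i" for i
      using unit_exp_rational_power_periodic[OF assms, of a "Suc i" d] by (simp add: f_def)
    show "(\<Sum>i<q. f i) = 0"
      using assms by (simp add: f_def sum_subtractf m_def weyl_sum_eq_lessThan)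
    show "norm (f i) \<le> 2" for i
      using norm_triangle_ineq4[of "unit_exp (of_int a / real q * real (Suc i) ^ d)" m] m1 by (simp add: f_def)
  qed simp
  then have "norm (\<Sum>k<Suc n. f k * w k) \<le> 2 * real q * (norm (w n) + (\<Sum>k<n. norm (w (Suc k) - w k)))"
    by (intro norm_sum_mult_le_by_parts)
  also have "\<dots> \<le> 2 * real q * (1 + 8 * \<bar>\<beta>\<bar> * real N ^ d)"
  proof (intro mult_left_mono add_mono)
    have "(\<Sum>k<n. norm (w (Suc k) - w k)) \<le> 2 * pi * \<bar>\<beta>\<bar> * (real (Suc n) ^ d - real (Suc 0) ^ d)"
      unfolding w_def
      by (rule sum_norm_unit_exp_diff_le[of "\<lambda>k. real (Suc k) ^ d"]) (auto simp: mono_def intro!: power_mono)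
    also have "\<dots> \<le> 8 * \<bar>\<beta>\<bar> * real N ^ d"
      using pi_less_4 unfolding Suc by (intro mult_mono) auto
    finally show "(\<Sum>k<n. norm (w (Suc k) - w k)) \<le> 8 * \<bar>\<beta>\<bar> * real N ^ d" .
  qed (auto simp: w_def)
  also have "(\<Sum>k<Suc n. f k * w k) = weyl_sum d N (of_int a / real q + \<beta>) - m * weyl_sum d N \<beta>"
    unfolding weyl_sum_eq_lessThan Suc
    by (simp only: f_def w_def left_diff_distrib sum_subtractf sum_distrib_left distrib_right unit_exp_add)
  finally show ?thesis by (simp add: m_def)
qed

section \<open>Decay near frequency zero\<close>

lemma norm_unit_exp_taylor: "norm (unit_exp x - 1 - 2 * pi * \<i> * x) \<le> (2 * pi * x)\<^sup>2"
proof -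
  let ?y = "2 * pi * x"
  have "norm (unit_exp x - 1 - 2 * pi * \<i> * x) \<le> \<bar>cos ?y - 1\<bar> + \<bar>sin ?y - ?y\<bar>"
    using cmod_le[of "unit_exp x - 1 - 2 * pi * \<i> * x"] by (simp add: unit_exp_def)
  also have "\<bar>cos ?y - 1\<bar> \<le> ?y\<^sup>2 / 2"
  proof -
    have "cos ?y = 1 - 2 * (sin (?y / 2))\<^sup>2" using cos_double_sin[of "?y / 2"] by (simp only: mult_2 field_sum_of_halves)
    moreover have "(sin (?y / 2))\<^sup>2 \<le> (?y / 2)\<^sup>2"
      using abs_sin_x_le_abs_x[of "?y / 2"] by (simp only: abs_le_square_iff)
    ultimately show ?thesis by (simp add: power_mult_distrib)
  qed
  also have "\<bar>sin ?y - ?y\<bar> \<le> ?y\<^sup>2 / 2"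
    using Maclaurin_sin_bound[of ?y 2] by (simp add: numeral_2_eq_2 sin_coeff_def fact_numeral)
  finally show ?thesis by simp
qed

lemma power_Suc_diff_ge:
  assumes "d \<ge> 1"
  shows "real (Suc k) ^ d - real k ^ d \<ge> real k ^ (d - 1)"
proof -
  obtain e where e: "d = Suc e" using assms by (cases d) auto
  have "real k ^ e \<le> real (Suc k) ^ e" by (intro power_mono) auto
  moreover have "real k * real k ^ e \<le> real k * real (Suc k) ^ e" by (intro mult_left_mono power_mono) auto
  ultimately show ?thesis by (simp add: e algebra_simps)
qed

text \<open>Discrete convexity of the power function. It makes the reciprocal gaps decreasing, so
  that their total variation telescopes in the summation by parts.\<close>

lemma power_Suc_diff_mono: "real (Suc k) ^ d - real k ^ d \<le> real (Suc (Suc k)) ^ d - real (Suc k) ^ d"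
proof (induction d)
  case (Suc d)
  have "real k * (real (Suc k) ^ d - real k ^ d) \<le> real (Suc k) * (real (Suc (Suc k)) ^ d - real (Suc k) ^ d)"
    using Suc by (intro mult_mono) (auto intro!: power_mono)
  moreover have "real (Suc k) ^ d \<le> real (Suc (Suc k)) ^ d" by (intro power_mono) auto
  ultimately show ?case by (simp add: algebra_simps)
qed simp

text \<open>
  For \<open>k \<ge> X\<close> replace \<open>e(\<beta> k\<^sup>d)\<close> by its forward difference divided by \<open>2 \<pi> \<i> \<beta> ((k+1)\<^sup>d - k\<^sup>d)\<close> and sum by
  parts; the total replacement error is of the size already present in the major arc approximation.
\<close>

lemma norm_weyl_sum_near_zero_le:
  fixes X :: nat
  assumes "\<beta> \<noteq> 0" "X \<ge> 1" "d \<ge> 1" "N \<ge> 1"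
  shows "norm (weyl_sum d N \<beta>) \<le> real X + 1 / (\<bar>\<beta>\<bar> * real X ^ (d - 1)) + 2 ^ (d + 3) * \<bar>\<beta>\<bar> * real N ^ d"
proof (cases "N < X")
  case True
  have "norm (weyl_sum d N \<beta>) \<le> real X" using norm_weyl_sum_le[of d N \<beta>] True by linarith
  then show ?thesis by (simp add: add_increasing2)
next
  case False
  define n where "n = N - X"
  define E where "E k = unit_exp (\<beta> * real k ^ d)" for k
  define D where "D k = real (Suc k) ^ d - real k ^ d" for k
  have XD: "real X ^ (d - 1) \<le> D X" unfolding D_def by (rule power_Suc_diff_ge[OF assms(3)])
  have Xp: "real X ^ (d - 1) > 0" using assms by simp
  have Dmono: "D (X + k) \<le> D (X + Suc k)" for k
    using power_Suc_diff_mono[of "X + k" d] by (simp add: D_def)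
  have Dpos: "D (X + k) > 0" for k
  proof (induction k)
    case 0
    have "0 < D X" using XD Xp by linarith
    then show ?case by simp
  next
    case (Suc k) then show ?case using Dmono[of k] by linarith
  qed
  define w where "w k = complex_of_real (1 / D (X + k))" for k
  define err where "err k = E k - (E (Suc k) - E k) / (2 * pi * \<i> * \<beta> * D k)" for k
  have errle: "norm (err (X + k)) \<le> 2 * pi * \<bar>\<beta>\<bar> * D (X + k)" for k
  proof -
    let ?g = "\<beta> * D (X + k)"
    have g0: "?g \<noteq> 0" using assms Dpos[of k] by auto
    have "E (Suc (X + k)) = E (X + k) * unit_exp ?g"
      by (simp add: E_def D_def algebra_simps flip: unit_exp_add)
    then have "err (X + k) = - E (X + k) * (unit_exp ?g - 1 - 2 * pi * \<i> * ?g) / (2 * pi * \<i> * ?g)"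
      using g0 by (simp add: err_def field_simps)
    then have "norm (err (X + k)) = norm (unit_exp ?g - 1 - 2 * pi * \<i> * ?g) / (2 * pi * \<bar>?g\<bar>)"
      by (simp add: norm_mult norm_divide E_def abs_mult)
    also have "\<dots> \<le> (2 * pi * ?g)\<^sup>2 / (2 * pi * \<bar>?g\<bar>)"
      by (intro divide_right_mono norm_unit_exp_taylor) auto
    also have "\<dots> = 2 * pi * \<bar>?g\<bar>"
      using g0 by (simp add: power2_eq_square abs_if)
    finally show ?thesis using Dpos[of k] by (simp add: abs_mult mult.assoc)
  qed
  have part: "norm (\<Sum>i<k. E (Suc (X + i)) - E (X + i)) \<le> 2" for k
  proof -
    have "(\<Sum>i<k. E (Suc (X + i)) - E (X + i)) = E (X + k) - E X"
      using sum_lessThan_telescope[of "\<lambda>i. E (X + i)" k] by simp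
    also have "norm \<dots> \<le> 2" using norm_triangle_ineq4[of "E (X + k)" "E X"] by (simp add: E_def)
    finally show ?thesis .
  qed
  \<comment> \<open>The forward differences have partial sums bounded by 2; as the weights decrease,
    their variation plus the last weight equals the first weight.\<close>
  have main: "norm (\<Sum>k<Suc n. (E (Suc (X + k)) - E (X + k)) * w k) \<le> 2 * (1 / D X)"
  proof -
    have "norm (\<Sum>k<Suc n. (E (Suc (X + k)) - E (X + k)) * w k) \<le>
       2 * (norm (w n) + (\<Sum>k<n. norm (w (Suc k) - w k)))"
      by (rule norm_sum_mult_le_by_parts) (rule part)
    also have "(\<Sum>k<n. norm (w (Suc k) - w k)) = (\<Sum>k<n. 1 / D (X + k) - 1 / D (X + Suc k))"
    proof (rule sum.cong[OF refl])
      fix k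
      have "1 / D (X + Suc k) \<le> 1 / D (X + k)"
        using Dmono[of k] Dpos[of k] Dpos[of "Suc k"] by (intro divide_left_mono) auto
      then show "norm (w (Suc k) - w k) = 1 / D (X + k) - 1 / D (X + Suc k)"
        unfolding w_def of_real_diff[symmetric] norm_of_real by simp
    qed
    also have "\<dots> = 1 / D X - 1 / D (X + n)"
      using sum_lessThan_telescope'[of "\<lambda>k. 1 / D (X + k)" n] by simp
    also have "norm (w n) = 1 / D (X + n)" unfolding w_def norm_of_real using Dpos[of n] by simp
    finally show ?thesis by simp
  qed
  have "weyl_sum d N \<beta> = (\<Sum>k=1..<X. E k) + (\<Sum>k=X..<Suc N. E k)"
    unfolding weyl_sum_def E_def[symmetric] using assms False
    by (subst sum.atLeastLessThan_concat) (auto simp: atLeastLessThanSuc_atLeastAtMost)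
  also have "(\<Sum>k=X..<Suc N. E k) = (\<Sum>k<Suc n. E (X + k))"
    using False by (intro sum.reindex_bij_witness[of _ "\<lambda>k. X + k" "\<lambda>k. k - X"]) (auto simp: n_def)
  also have "\<dots> = (\<Sum>k<Suc n. (E (Suc (X + k)) - E (X + k)) * w k / (2 * pi * \<i> * \<beta>)) + (\<Sum>k<Suc n. err (X + k))"
    unfolding sum.distrib[symmetric] by (intro sum.cong refl) (simp add: err_def w_def)
  also have "(\<Sum>k<Suc n. (E (Suc (X + k)) - E (X + k)) * w k / (2 * pi * \<i> * \<beta>)) =
      (\<Sum>k<Suc n. (E (Suc (X + k)) - E (X + k)) * w k) / (2 * pi * \<i> * \<beta>)"
    by (rule sum_divide_distrib[symmetric])
  finally have "norm (weyl_sum d N \<beta>) \<le> norm (\<Sum>k=1..<X. E k) +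
     (norm ((\<Sum>k<Suc n. (E (Suc (X + k)) - E (X + k)) * w k) / (2 * pi * \<i> * \<beta>)) + norm (\<Sum>k<Suc n. err (X + k)))"
    by (simp only:) (rule order_trans[OF norm_triangle_ineq add_left_mono[OF norm_triangle_ineq]])
  also have "\<dots> \<le> real X + (1 / (\<bar>\<beta>\<bar> * real X ^ (d - 1)) + 2 ^ (d + 3) * \<bar>\<beta>\<bar> * real N ^ d)"
  proof (intro add_mono)
    have "norm (\<Sum>k=1..<X. E k) \<le> (\<Sum>k=1..<X. norm (E k))" by (rule norm_sum)
    then show "norm (\<Sum>k=1..<X. E k) \<le> real X" by (simp add: E_def)
    have "norm ((\<Sum>k<Suc n. (E (Suc (X + k)) - E (X + k)) * w k) / (2 * pi * \<i> * \<beta>)) =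
       norm (\<Sum>k<Suc n. (E (Suc (X + k)) - E (X + k)) * w k) / (2 * pi * \<bar>\<beta>\<bar>)"
      by (simp add: norm_divide norm_mult)
    also have "\<dots> \<le> 2 * (1 / D X) / (2 * pi * \<bar>\<beta>\<bar>)" by (intro divide_right_mono main) auto
    also have "\<dots> = 1 / (pi * (\<bar>\<beta>\<bar> * D X))" by simp
    also have "\<dots> \<le> 1 / (1 * (\<bar>\<beta>\<bar> * real X ^ (d - 1)))"
      using XD Xp assms pi_ge_two Dpos[of 0]
      by (intro divide_left_mono mult_mono mult_pos_pos) auto
    finally show "norm ((\<Sum>k<Suc n. (E (Suc (X + k)) - E (X + k)) * w k) / (2 * pi * \<i> * \<beta>)) \<le>
      1 / (\<bar>\<beta>\<bar> * real X ^ (d - 1))" by simp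
    have "norm (\<Sum>k<Suc n. err (X + k)) \<le> (\<Sum>k<Suc n. 2 * pi * \<bar>\<beta>\<bar> * D (X + k))"
      by (intro order_trans[OF norm_sum] sum_mono errle)
    also have "\<dots> = 2 * pi * \<bar>\<beta>\<bar> * (\<Sum>k<Suc n. real (X + Suc k) ^ d - real (X + k) ^ d)"
      by (simp only: sum_distrib_left D_def add_Suc_right)
    also have "(\<Sum>k<Suc n. real (X + Suc k) ^ d - real (X + k) ^ d) = real (X + Suc n) ^ d - real X ^ d"
      using sum_lessThan_telescope[of "\<lambda>k. real (X + k) ^ d" "Suc n"] by simp
    \<comment> \<open>The upper end is X + n + 1 = N + 1, at most 2 * N; together with 2 * pi < 8
      this gives the constant 2 ^ (d + 3).\<close>
    also have "2 * pi * \<bar>\<beta>\<bar> * \<dots> \<le> 8 * \<bar>\<beta>\<bar> * (2 * real N) ^ d"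
    proof (intro mult_mono)
      have "real (X + Suc n) ^ d \<le> (2 * real N) ^ d"
        using False assms by (intro power_mono) (auto simp: n_def)
      then show "real (X + Suc n) ^ d - real X ^ d \<le> (2 * real N) ^ d" by (smt (verit) zero_le_power of_nat_0_le_iff)
    qed (use pi_less_4 in \<open>auto intro!: power_mono\<close>)
    finally show "norm (\<Sum>k<Suc n. err (X + k)) \<le> 2 ^ (d + 3) * \<bar>\<beta>\<bar> * real N ^ d"
      by (simp add: power_mult_distrib power_add algebra_simps)
  qed
  finally show ?thesis by (simp add: add.assoc)
qed

section \<open>Powers of Weyl sums on a major arc\<close>

lemma power_add_le_two_power:
  fixes x y :: real
  assumes "x \<ge> 0" "y \<ge> 0"
  shows "(x + y) ^ r \<le> 2 ^ r * (x ^ r + y ^ r)"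
proof -
  have "(x + y) ^ r \<le> (2 * max x y) ^ r" using assms by (intro power_mono) auto
  also have "\<dots> = 2 ^ r * (max x y) ^ r" by (simp add: power_mult_distrib)
  also have "(max x y) ^ r \<le> x ^ r + y ^ r" using assms by (auto simp: max_def)
  finally show ?thesis by simp
qed

text \<open>With u = N ^ d * |\<beta>|, the sum at \<beta> is at most N when u \<le> 1 and of order
  N * u powr (-1 / d) beyond, apart from an error. The assumption 2 * d \<le> r turns this decay
  into at least u powr (-2), so the single profile 2 / (1 + u ^ 2) serves both regimes and is
  summable across the arc.\<close>

lemma norm_weyl_sum_major_arc_power_le:
  fixes a :: int and q N d r :: nat
  assumes "q \<ge> 1" "N \<ge> 1" "d \<ge> 1" "2 * d \<le> r"
  shows "norm (weyl_sum d N (of_int a / real q + \<beta>)) ^ r \<le>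
    2 ^ r * ((2 * (norm (weyl_sum d q (of_int a / real q)) / real q) * real N) ^ r
        * (2 / (1 + (real N ^ d * \<bar>\<beta>\<bar>)\<^sup>2))
      + (2 ^ (d + 5) * real q * (1 + real N ^ d * \<bar>\<beta>\<bar>)) ^ r)"
proof -
  define u where "u = real N ^ d * \<bar>\<beta>\<bar>"
  define c where "c = norm (weyl_sum d q (of_int a / real q)) / real q"
  define A where "A = 2 * c * real N"
  define B where "B = 2 ^ (d + 5) * real q * (1 + u)"
  have c: "0 \<le> c" "c \<le> 1"
    using norm_weyl_sum_le[of d q "of_int a / real q"] assms by (auto simp: c_def divide_le_eq_1)
  have u0: "u \<ge> 0" by (simp add: u_def)
  have A0: "A \<ge> 0" and B0: "B \<ge> 0" using c u0 by (auto simp: A_def B_def)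
  have split: "norm (weyl_sum d N (of_int a / real q + \<beta>)) \<le> c * norm (weyl_sum d N \<beta>) + 2 * real q * (1 + 8 * u)"
  proof -
    have "norm (weyl_sum d N (of_int a / real q + \<beta>)) \<le>
      norm (weyl_sum d q (of_int a / real q) / of_nat q * weyl_sum d N \<beta>) + 2 * real q * (1 + 8 * \<bar>\<beta>\<bar> * real N ^ d)"
      using major_arc_approximation[OF assms(1), of d N a \<beta>]
      by (smt (verit) norm_triangle_sub)
    then show ?thesis by (simp add: c_def u_def norm_mult norm_divide mult_ac)
  qed
  have "norm (weyl_sum d N (of_int a / real q + \<beta>)) ^ r \<le> 2 ^ r * (A ^ r * (2 / (1 + u\<^sup>2)) + B ^ r)"
  proof (cases "u \<le> 1")
    case True
    have "c * norm (weyl_sum d N \<beta>) \<le> c * real N" by (intro mult_left_mono norm_weyl_sum_le c)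
    also have "\<dots> \<le> A" using c by (simp add: A_def)
    finally have 1: "c * norm (weyl_sum d N \<beta>) \<le> A" .
    have "2 * (1 + 8 * u) \<le> 2 ^ (d + 5) * (1 + u)"
    proof -
      have "(2::real) ^ 5 \<le> 2 ^ (d + 5)" by (intro power_increasing) auto
      then have "2 ^ 5 * (1 + u) \<le> 2 ^ (d + 5) * (1 + u)" using u0 by (intro mult_right_mono) auto
      then show ?thesis using u0 by simp
    qed
    then have "real q * (2 * (1 + 8 * u)) \<le> real q * (2 ^ (d + 5) * (1 + u))" by (intro mult_left_mono) auto
    then have "2 * real q * (1 + 8 * u) \<le> B" by (simp add: B_def mult_ac)
    with 1 split have "norm (weyl_sum d N (of_int a / real q + \<beta>)) \<le> A + B" by linarith
    then have "norm (weyl_sum d N (of_int a / real q + \<beta>)) ^ r \<le> (A + B) ^ r" by (intro power_mono) auto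
    also have "\<dots> \<le> 2 ^ r * (A ^ r + B ^ r)" by (rule power_add_le_two_power[OF A0 B0])
    also have "\<dots> \<le> 2 ^ r * (A ^ r * (2 / (1 + u\<^sup>2)) + B ^ r)"
    proof (intro mult_left_mono add_right_mono)
      have "u\<^sup>2 \<le> 1" using True u0 by (simp add: power_le_one)
      moreover have "1 + u\<^sup>2 > 0" by (simp add: add_pos_nonneg)
      ultimately have "1 \<le> 2 / (1 + u\<^sup>2)" by (simp add: field_simps)
      then have "A ^ r * 1 \<le> A ^ r * (2 / (1 + u\<^sup>2))" using A0 by (intro mult_left_mono) auto
      then show "A ^ r \<le> A ^ r * (2 / (1 + u\<^sup>2))" by simp
    qed simp
    finally show ?thesis .
  next
    case False
    then have \<beta>: "\<beta> \<noteq> 0" by (auto simp: u_def)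
    \<comment> \<open>This cutoff balances the trivial part against the oscillating part: y equals 1
      / (|\<beta>| * y ^ (d - 1)).\<close>
    define y where "y = \<bar>\<beta>\<bar> powr (- 1 / real d)"
    have y0: "y > 0" using \<beta> by (simp add: y_def)
    have yd: "y ^ d = 1 / \<bar>\<beta>\<bar>"
    proof -
      have "y ^ d = \<bar>\<beta>\<bar> powr (- 1 / real d * real d)"
        unfolding y_def using \<beta> by (subst powr_power) auto
      then show ?thesis using assms \<beta> by (simp add: powr_minus_divide)
    qed
    define X where "X = nat \<lceil>y\<rceil>"
    have X: "y \<le> real X" "real X \<le> y + 1" "X \<ge> 1"
      unfolding X_def using y0 by linarith+
    have "y ^ (d - 1) \<le> real X ^ (d - 1)" using X y0 by (intro power_mono) auto
    then have "\<bar>\<beta>\<bar> * y ^ (d - 1) \<le> \<bar>\<beta>\<bar> * real X ^ (d - 1)" by (intro mult_left_mono) auto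
    moreover have "\<bar>\<beta>\<bar> * y ^ (d - 1) = 1 / y"
    proof -
      have "y ^ d = y * y ^ (d - 1)" using assms by (cases d) auto
      then show ?thesis using yd y0 \<beta> by (simp add: field_simps)
    qed
    ultimately have "1 / y \<le> \<bar>\<beta>\<bar> * real X ^ (d - 1)" by simp
    then have inv: "1 / (\<bar>\<beta>\<bar> * real X ^ (d - 1)) \<le> y"
      using y0 \<beta> X by (simp add: field_simps)
    have "norm (weyl_sum d N \<beta>) \<le> real X + 1 / (\<bar>\<beta>\<bar> * real X ^ (d - 1)) + 2 ^ (d + 3) * \<bar>\<beta>\<bar> * real N ^ d"
      by (rule norm_weyl_sum_near_zero_le[OF \<beta> X(3) assms(3,2)])
    also have "\<dots> \<le> 2 * y + (1 + 2 ^ (d + 3) * u)" using X(2) inv by (simp add: u_def mult_ac)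
    finally have "c * norm (weyl_sum d N \<beta>) \<le> c * (2 * y + (1 + 2 ^ (d + 3) * u))"
      using c by (intro mult_left_mono)
    also have "\<dots> = 2 * c * y + c * (1 + 2 ^ (d + 3) * u)" by (simp add: algebra_simps)
    also have "c * (1 + 2 ^ (d + 3) * u) \<le> 1 * (1 + 2 ^ (d + 3) * u)"
      using c u0 by (intro mult_right_mono) auto
    also have "1 * (1 + 2 ^ (d + 3) * u) \<le> real q * (1 + 2 ^ (d + 3) * u)"
      using assms u0 by (intro mult_right_mono) auto
    finally have 1: "c * norm (weyl_sum d N \<beta>) \<le> 2 * c * y + real q * (1 + 2 ^ (d + 3) * u)" by simp
    have yN: "y = real N * u powr (- 1 / real d)"
    proof -
      have "u powr (- 1 / real d) = (real N ^ d) powr (- 1 / real d) * y"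
        unfolding u_def y_def by (rule powr_mult) 
      also have "(real N ^ d) powr (- 1 / real d) = 1 / real N"
        using assms by (simp add: powr_powr powr_minus_divide flip: powr_realpow)
      finally show ?thesis using assms by simp
    qed
    have "real q * (1 + 2 ^ (d + 3) * u) + 2 * real q * (1 + 8 * u) = real q * (3 + 16 * u + 2 ^ (d + 3) * u)"
      by (simp add: algebra_simps)
    also have "\<dots> \<le> real q * (2 ^ (d + 5) * (1 + u))"
    proof (intro mult_left_mono)
      have "(1::real) \<le> 2 ^ d" by simp
      moreover from this have "u \<le> 2 ^ d * u" using u0 mult_right_mono[of 1 "2 ^ d" u] by simp
      ultimately have "3 + 16 * u + 8 * (2 ^ d * u) \<le> 32 * 2 ^ d + 32 * (2 ^ d * u)"
        using u0 by linarith
      then show "3 + 16 * u + 2 ^ (d + 3) * u \<le> 2 ^ (d + 5) * (1 + u)"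
        by (simp add: power_add algebra_simps)
    qed simp
    also have "\<dots> = B" by (simp add: B_def mult_ac)
    finally have "norm (weyl_sum d N (of_int a / real q + \<beta>)) \<le> 2 * c * y + B" using 1 split by linarith
    also have "2 * c * y = A * u powr (- 1 / real d)" by (simp add: A_def yN)
    finally have "norm (weyl_sum d N (of_int a / real q + \<beta>)) ^ r \<le> (A * u powr (- 1 / real d) + B) ^ r"
      by (intro power_mono) auto
    also have "\<dots> \<le> 2 ^ r * ((A * u powr (- 1 / real d)) ^ r + B ^ r)"
      using A0 B0 by (intro power_add_le_two_power) auto
    also have "\<dots> \<le> 2 ^ r * (A ^ r * (2 / (1 + u\<^sup>2)) + B ^ r)"
    proof (intro mult_left_mono add_right_mono)
      have u1: "u > 1" using False by simp
      have "(u powr (- 1 / real d)) ^ r = u powr (- (real r / real d))"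
        using u1 by (simp add: powr_power)
      also have "\<dots> \<le> u powr (- 2)"
        using u1 assms by (intro powr_mono) (auto simp: field_simps simp flip: of_nat_mult)
      also have "\<dots> = 1 / u\<^sup>2" using u1 by (simp add: powr_minus_divide flip: powr_numeral)
      also have "\<dots> \<le> 2 / (1 + u\<^sup>2)"
      proof -
        have "1 / v \<le> 2 / (1 + v)" if "1 < v" for v :: real using that by (simp add: field_simps)
        moreover have "1 < u\<^sup>2" using u1 by (simp add: one_less_power)
        ultimately show ?thesis .
      qed
      finally have "A ^ r * (u powr (- 1 / real d)) ^ r \<le> A ^ r * (2 / (1 + u\<^sup>2))"
        using A0 by (intro mult_left_mono) auto
      then show "(A * u powr (- 1 / real d)) ^ r \<le> A ^ r * (2 / (1 + u\<^sup>2))" by (simp add: power_mult_distrib)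
    qed simp
    finally show ?thesis .
  qed
  then show ?thesis by (simp add: A_def B_def c_def u_def)
qed

section \<open>Counting sample points along an arc\<close>

lemma card_nat_interval_le:
  fixes s l :: real
  assumes "finite J" "l \<ge> 0"
  shows "real (card {j\<in>J. s \<le> real j \<and> real j \<le> s + l}) \<le> l + 1"
proof -
  have "card {j\<in>J. s \<le> real j \<and> real j \<le> s + l} = card (int ` {j\<in>J. s \<le> real j \<and> real j \<le> s + l})"
    by (simp add: card_image)
  also have "\<dots> \<le> card {\<lceil>s\<rceil>..\<lfloor>s + l\<rfloor>}"
    by (intro card_mono) (auto simp: ceiling_le_iff le_floor_iff)
  finally have "real (card {j\<in>J. s \<le> real j \<and> real j \<le> s + l}) \<le> real (card {\<lceil>s\<rceil>..\<lfloor>s + l\<rfloor>})" by linarith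
  also have "\<dots> \<le> l + 1" using assms(2) by simp linarith
  finally show ?thesis .
qed

lemma sum_inverse_one_plus_square_le: "(\<Sum>b<n. 1 / (1 + (real b)\<^sup>2)) \<le> 3"
proof -
  \<comment> \<open>Subtracting 2 / (n + 1) strengthens the claim so that the induction
    telescopes.\<close>
  have "(\<Sum>b<Suc n. 1 / (1 + (real b)\<^sup>2)) \<le> 3 - 2 / (real n + 1)" for n
  proof (induction n)
    case (Suc n)
    have "1 / (1 + (real (Suc n))\<^sup>2) \<le> 2 / (real n + 1) - 2 / (real (Suc n) + 1)"
    proof -
      have "2 / (real n + 1) - 2 / (real (Suc n) + 1) = 2 / ((real n + 1) * (real n + 2))"
        by (simp add: field_simps)
      moreover have "(real n + 1) * (real n + 2) \<le> 2 * (1 + (real (Suc n))\<^sup>2)"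
        by (simp add: power2_eq_square algebra_simps)
      moreover have "1 / x = 2 / (2 * x)" for x :: real by simp
      then have "1 / (1 + (real (Suc n))\<^sup>2) = 2 / (2 * (1 + (real (Suc n))\<^sup>2))" .
      moreover have "2 / (2 * (1 + (real (Suc n))\<^sup>2)) \<le> 2 / ((real n + 1) * (real n + 2))" 
        if "(real n + 1) * (real n + 2) \<le> 2 * (1 + (real (Suc n))\<^sup>2)"
        using that by (intro divide_left_mono mult_pos_pos) (auto intro: add_pos_nonneg)
      ultimately show ?thesis by simp
    qed
    then show ?case using Suc by simp
  qed simp
  from this[of n] have "(\<Sum>b<Suc n. 1 / (1 + (real b)\<^sup>2)) \<le> 3"
    by (smt (verit) divide_nonneg_nonneg of_nat_0_le_iff)
  moreover have "0 \<le> 1 / (1 + (real n)\<^sup>2)" by simp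
  ultimately show ?thesis unfolding sum.lessThan_Suc by linarith
qed

text \<open>Sort the points by the integer part of |j - y| / P. Each class lies in two intervals of
  length P, hence has at most 4 * P members because P \<ge> 1; the unscaled series contributes the
  factor 3.\<close>

lemma sum_inverse_one_plus_square_scaled_le:
  fixes P y :: real
  assumes "finite (J :: nat set)" "P \<ge> 1"
  shows "(\<Sum>j\<in>J. 1 / (1 + ((real j - y) / P)\<^sup>2)) \<le> 12 * P"
proof -
  define b where "b j = nat \<lfloor>\<bar>real j - y\<bar> / P\<rfloor>" for j :: nat
  have bl: "real (b j) \<le> \<bar>real j - y\<bar> / P" "\<bar>real j - y\<bar> / P < real (b j) + 1" for j
  proof -
    have "0 \<le> \<bar>real j - y\<bar> / P" using assms by simp
    then show "real (b j) \<le> \<bar>real j - y\<bar> / P" "\<bar>real j - y\<bar> / P < real (b j) + 1"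
      unfolding b_def by linarith+
  qed
  obtain n where n: "b ` J \<subseteq> {..<n}" using assms(1) finite_nat_iff_bounded by blast
  have "(\<Sum>j\<in>J. 1 / (1 + ((real j - y) / P)\<^sup>2)) \<le> (\<Sum>j\<in>J. 1 / (1 + (real (b j))\<^sup>2))"
  proof (intro sum_mono divide_left_mono add_left_mono)
    fix j
    have "(real (b j))\<^sup>2 \<le> (\<bar>real j - y\<bar> / P)\<^sup>2" using bl(1)[of j] by (intro power_mono) auto
    then show "(real (b j))\<^sup>2 \<le> ((real j - y) / P)\<^sup>2" by (simp add: power_divide)
  qed (auto intro!: mult_pos_pos add_pos_nonneg)
  also have "\<dots> = (\<Sum>i<n. \<Sum>j\<in>{j\<in>J. b j = i}. 1 / (1 + (real (b j))\<^sup>2))"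
    using sum.group[OF assms(1) finite_lessThan n, of "\<lambda>j. 1 / (1 + (real (b j))\<^sup>2)"] by simp
  also have "\<dots> \<le> (\<Sum>i<n. 4 * P * (1 / (1 + (real i)\<^sup>2)))"
  proof (intro sum_mono)
    fix i :: nat
    have "{j\<in>J. b j = i} \<subseteq> {j\<in>J. y + real i * P \<le> real j \<and> real j \<le> (y + real i * P) + P}
        \<union> {j\<in>J. (y - (real i + 1) * P) \<le> real j \<and> real j \<le> (y - (real i + 1) * P) + P}"
    proof
      fix j assume j: "j \<in> {j\<in>J. b j = i}"
      then have "real i * P \<le> \<bar>real j - y\<bar>" "\<bar>real j - y\<bar> \<le> (real i + 1) * P"
        using bl[of j] assms(2) by (auto simp: field_simps)
      then show "j \<in> {j\<in>J. y + real i * P \<le> real j \<and> real j \<le> (y + real i * P) + P}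
        \<union> {j\<in>J. (y - (real i + 1) * P) \<le> real j \<and> real j \<le> (y - (real i + 1) * P) + P}"
        using j by (auto simp: algebra_simps abs_if split: if_splits)
    qed
    then have "card {j\<in>J. b j = i} \<le> card ({j\<in>J. y + real i * P \<le> real j \<and> real j \<le> (y + real i * P) + P}
        \<union> {j\<in>J. (y - (real i + 1) * P) \<le> real j \<and> real j \<le> (y - (real i + 1) * P) + P})"
      using assms(1) by (intro card_mono) auto
    also have "\<dots> \<le> card {j\<in>J. y + real i * P \<le> real j \<and> real j \<le> (y + real i * P) + P}
        + card {j\<in>J. (y - (real i + 1) * P) \<le> real j \<and> real j \<le> (y - (real i + 1) * P) + P}"
      by (rule card_Un_le)
    finally have "real (card {j\<in>J. b j = i}) \<le> 4 * P"
      using card_nat_interval_le[OF assms(1), of P "y + real i * P"]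
        card_nat_interval_le[OF assms(1), of P "y - (real i + 1) * P"] assms(2) by linarith
    then have "real (card {j\<in>J. b j = i}) * (1 / (1 + (real i)\<^sup>2)) \<le> 4 * P * (1 / (1 + (real i)\<^sup>2))"
      by (intro mult_right_mono) auto
    then show "(\<Sum>j\<in>{j\<in>J. b j = i}. 1 / (1 + (real (b j))\<^sup>2)) \<le> 4 * P * (1 / (1 + (real i)\<^sup>2))"
      by simp
  qed
  also have "\<dots> = 4 * P * (\<Sum>i<n. 1 / (1 + (real i)\<^sup>2))" by (simp add: sum_distrib_left)
  also have "\<dots> \<le> 4 * P * 3" using assms(2) by (intro mult_left_mono sum_inverse_one_plus_square_le) auto
  finally show ?thesis by simp
qed

section \<open>The mean value estimate\<close>

lemma power_eq_powr_of_power: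
  fixes x :: real
  assumes "x \<ge> 0" "k > 0" "r > 0"
  shows "x ^ r = (x ^ k) powr (real r / real k)"
proof (cases "x = 0")
  case False
  then have "(x ^ k) powr (real r / real k) = x powr (real k * (real r / real k))"
    using assms by (simp add: powr_powr flip: powr_realpow)
  then show ?thesis using assms False by (simp add: powr_realpow)
qed (use assms in \<open>auto simp: zero_power\<close>)

text \<open>Weyl's inequality controls the power 2 ^ (d - 1), the mean value needs the power r; the
  last assumption tracks the saving through the change of exponent.\<close>

lemma power_le_of_power_le_powr:
  fixes x :: real
  assumes "x \<ge> 0" "k > 0" "r > 0" "x ^ k \<le> B * y powr s" "B \<ge> 0"
    "y \<ge> 1" "s * (real r / real k) \<le> t"
  shows "x ^ r \<le> B powr (real r / real k) * y powr t"
proof -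
  have "x ^ r = (x ^ k) powr (real r / real k)" using assms by (intro power_eq_powr_of_power)
  also have "\<dots> \<le> (B * y powr s) powr (real r / real k)" using assms by (intro powr_mono2) auto
  also have "\<dots> = B powr (real r / real k) * y powr (s * (real r / real k))"
    using assms by (simp add: powr_mult powr_powr)
  also have "\<dots> \<le> B powr (real r / real k) * y powr t"
    using assms by (intro mult_left_mono powr_mono) auto
  finally show ?thesis .
qed

text \<open>A frequency near a / q is charged to a majorant of that arc, and the majorants of all
  arcs are added at every sample point; being nonnegative, they may overlap freely. About q
  numerators share a denominator, which turns the bound q powr (-3) for complete sums into the
  convergent q powr (-2).\<close>

lemma weyl_sum_mean_value:
  assumes "d \<ge> 3" "k = 2 ^ (d - 1)" "r = d * (k + 1)"
  obtains C where "C > 0" "\<And>N M. N \<ge> 1 \<Longrightarrow> M \<ge> 2 * N ^ (d + 1) \<Longrightarrow>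
    (\<Sum>j<M. norm (weyl_sum d N (real j / real M)) ^ r) \<le> C * real M * (real N ^ r / real N ^ d)"
proof -
  define K where "K = real k"
  have k0: "k > 0" and K1: "K \<ge> 1" using assms by (auto simp: K_def)
  have r0: "r > 0" and r2d: "2 * d \<le> r" using assms k0 by auto
  \<comment> \<open>\<eta> + \<epsilon> = 1 / (K + 1) is exactly what makes the saving in the minor
    range equal to N ^ d. The split 2 : 1 gives \<eta> * r = 2 * d / 3 \<ge> 2, which pays for the
    accumulated error of the major arcs.\<close>
  define \<eta> where "\<eta> = 2 / (3 * (K + 1))"
  define \<epsilon> where "\<epsilon> = 1 / (3 * (K + 1))"
  have eta: "0 < \<eta>" "\<eta> < 1" and eps: "\<epsilon> > 0" using K1 by (auto simp: \<eta>_def \<epsilon>_def)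
  have rk: "real r / real k = real d * (K + 1) / K"
    unfolding assms(3) K_def by (simp add: algebra_simps)
  obtain C0 where C0: "C0 > 0" "\<And>N q a \<alpha>. N \<ge> 1 \<Longrightarrow> q \<ge> 1 \<Longrightarrow> q \<le> N ^ d \<Longrightarrow> coprime a (int q) \<Longrightarrow>
    \<bar>\<alpha> - of_int a / real q\<bar> \<le> 1 / (real q)\<^sup>2 \<Longrightarrow>
    norm (weyl_sum d N \<alpha>) ^ k \<le> C0 * real N ^ k * real N powr \<epsilon> * (1 / real q + 1 / real N + real q / real N ^ d)"
    using weyl_inequality[of d \<epsilon>] assms eps by auto
  define C1 where "C1 = (4 * C0) powr (real r / real k)"
  define C2 where "C2 = (3 * C0) powr (real r / real k)"
  define C3 where "C3 = 2 ^ r * (2 ^ r * C2 * 2)"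
  define C4 where "C4 = (2::real) ^ r * (2 ^ (d + 6)) ^ r"
  have Cpos: "C1 > 0" "C2 > 0" "C3 > 0" "C4 > 0" using C0 by (auto simp: C1_def C2_def C3_def C4_def)

  have minor: "norm (weyl_sum d N \<alpha>) ^ r \<le> C1 * (real N ^ r / real N ^ d)"
    if N: "N \<ge> 1" and q: "q \<ge> 1" "q \<le> N ^ d" and cop: "coprime a (int q)"
      and app: "\<bar>\<alpha> - of_int a / real q\<bar> \<le> 1 / (real q)\<^sup>2"
      and ql: "real N powr (1 - \<eta>) \<le> real q" and qu: "real q \<le> 2 * real N powr (real d - 1 + \<eta>)"
    for N q a \<alpha>
  proof -
    let ?Y = "real N powr (- (1 - \<eta>))"
    have "1 / real q \<le> 1 / real N powr (1 - \<eta>)" using ql q N by (intro divide_left_mono) auto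
    then have 1: "1 / real q \<le> ?Y" by (simp only: powr_minus_divide)
    have "real N powr (- 1) \<le> ?Y" using N eta by (intro powr_mono) auto
    then have 2: "1 / real N \<le> ?Y" using N by (simp add: powr_minus_divide)
    have "real q / real N ^ d \<le> 2 * real N powr (real d - 1 + \<eta>) / real N powr real d"
      using qu N by (simp add: powr_realpow divide_right_mono)
    also have "\<dots> = 2 * real N powr ((real d - 1 + \<eta>) - real d)" by (simp only: powr_diff times_divide_eq_right)
    also have "(real d - 1 + \<eta>) - real d = - (1 - \<eta>)" by simp
    finally have 3: "real q / real N ^ d \<le> 2 * ?Y" .
    have "norm (weyl_sum d N \<alpha>) ^ k \<le> C0 * real N ^ k * real N powr \<epsilon> * (1 / real q + 1 / real N + real q / real N ^ d)"
      by (rule C0(2)[OF N q cop app])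
    also have "\<dots> \<le> C0 * real N ^ k * real N powr \<epsilon> * (4 * ?Y)"
      using 1 2 3 C0(1) by (intro mult_left_mono) auto
    finally have "norm (weyl_sum d N \<alpha>) ^ k / real N ^ k \<le> (4 * C0) * (real N powr \<epsilon> * ?Y)"
      using N by (simp add: field_simps)
    also have "real N powr \<epsilon> * ?Y = real N powr (\<epsilon> - (1 - \<eta>))"
      unfolding powr_add[symmetric] by (simp only: diff_conv_add_uminus)
    finally have "(norm (weyl_sum d N \<alpha>) / real N) ^ k \<le> (4 * C0) * real N powr (\<epsilon> - (1 - \<eta>))"
      by (simp add: power_divide)
    moreover have "(\<epsilon> - (1 - \<eta>)) * (real r / real k) \<le> - real d"
    proof -
      have "\<epsilon> + \<eta> = 1 / (K + 1)" using K1 by (simp add: \<epsilon>_def \<eta>_def divide_simps)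
      also have "\<dots> = 1 - K / (K + 1)" using K1 by (simp add: field_simps)
      finally have e: "\<epsilon> - (1 - \<eta>) = - (K / (K + 1))" by simp
      have "K / (K + 1) * (real d * (K + 1) / K) = real d" using K1 by simp
      then show ?thesis unfolding rk e by simp
    qed
    ultimately have "(norm (weyl_sum d N \<alpha>) / real N) ^ r \<le> C1 * real N powr (- real d)"
      unfolding C1_def using C0(1) N k0 r0 by (intro power_le_of_power_le_powr) auto
    then show ?thesis using N by (simp add: power_divide powr_minus_divide powr_realpow field_simps)
  qed

  \<comment> \<open>Weyl's inequality with N = q, where each of the three terms is at most 1 / q.
    After the change of exponent the saving is at least q ^ d, and d \<ge> 3.\<close>
  have complete: "(norm (weyl_sum d q (of_int a / real q)) / real q) ^ r \<le> C2 / real q ^ 3"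
    if q: "q \<ge> 1" and cop: "coprime a (int q)" for q a
  proof -
    have "norm (weyl_sum d q (of_int a / real q)) ^ k \<le>
        C0 * real q ^ k * real q powr \<epsilon> * (1 / real q + 1 / real q + real q / real q ^ d)"
      using q cop assms by (intro C0(2)) (auto intro: self_le_power)
    also have "real q / real q ^ d \<le> 1 / real q"
    proof -
      have "real q ^ 2 \<le> real q ^ d" using q assms by (intro power_increasing) auto
      then show ?thesis using q by (simp add: field_simps power2_eq_square)
    qed
    finally have "norm (weyl_sum d q (of_int a / real q)) ^ k \<le>
        C0 * real q ^ k * real q powr \<epsilon> * (3 * (1 / real q))"
      using C0(1) by (simp add: mult_left_mono)
    then have "norm (weyl_sum d q (of_int a / real q)) ^ k / real q ^ k \<le> (3 * C0) * (real q powr \<epsilon> * (1 / real q))"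
      using q by (simp add: field_simps)
    also have "real q powr \<epsilon> * (1 / real q) = real q powr (\<epsilon> - 1)"
      using q by (simp add: powr_diff)
    finally have "(norm (weyl_sum d q (of_int a / real q)) / real q) ^ k \<le> (3 * C0) * real q powr (\<epsilon> - 1)"
      by (simp add: power_divide)
    moreover have "(\<epsilon> - 1) * (real r / real k) \<le> - 3"
    proof -
      have "\<epsilon> * (K + 1) = 1 / 3" using K1 by (simp add: \<epsilon>_def)
      then have "(1 - \<epsilon>) * (K + 1) = K + 2 / 3" by (simp add: left_diff_distrib)
      then have "(1 - \<epsilon>) * (K + 1) / K \<ge> 1" using K1 by (simp add: le_divide_eq)
      then have "real d * ((1 - \<epsilon>) * (K + 1) / K) \<ge> 3 * 1" using assms by (intro mult_mono) auto
      then show ?thesis unfolding rk by (simp add: algebra_simps diff_divide_distrib)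
    qed
    ultimately have "(norm (weyl_sum d q (of_int a / real q)) / real q) ^ r \<le> C2 * real q powr (- 3)"
      unfolding C2_def using C0(1) q k0 r0 by (intro power_le_of_power_le_powr) auto
    then show ?thesis using q by (simp add: powr_minus_divide)
  qed

  show ?thesis
  proof (rule that[of "C1 + 144 * C3 + 6 * C4"])
    show "C1 + 144 * C3 + 6 * C4 > 0" using Cpos by simp
    fix N M :: nat assume N: "N \<ge> 1" and M: "M \<ge> 2 * N ^ (d + 1)"
    have M0: "real M > 0" using M N by (metis less_le_trans mult_pos_pos of_nat_0_less_iff pos2 zero_less_power One_nat_def Suc_le_eq)
    define Z where "Z = real N ^ r / real N ^ d"
    \<comment> \<open>Dirichlet level: on arcs of half-width 1 / (q * R), the product q * N ^ d *
      |\<beta>| is at most N ^ d / R \<le> Q, so the approximation error on the major arcs is of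
      order \<open>Q\<close>.\<close>
    define R where "R = nat \<lceil>real N powr (real d - 1 + \<eta>)\<rceil>"
    define Q where "Q = real N powr (1 - \<eta>)"
    define P where "P = real M / real N ^ d"
    define V where "V = (real N powr (1 - \<eta>)) ^ r"
    have Np: "real N powr (real d - 1 + \<eta>) \<ge> 1" using N assms eta by (intro ge_one_powr_ge_zero) auto
    have R: "real N powr (real d - 1 + \<eta>) \<le> real R" "real R \<le> 2 * real N powr (real d - 1 + \<eta>)"
      unfolding R_def using Np by linarith+
    have R0: "real R > 0" and Np0: "real N powr (real d - 1 + \<eta>) > 0" using R Np by linarith+
    have Rd: "R \<le> N ^ d"
    proof -
      have "real N powr (real d - 1 + \<eta>) \<le> real N powr real d" using N eta by (intro powr_mono) auto
      also have "\<dots> = real (N ^ d)" using N by (simp add: powr_realpow)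
      finally have "\<lceil>real N powr (real d - 1 + \<eta>)\<rceil> \<le> int (N ^ d)" by (simp add: ceiling_le_iff)
      then show ?thesis by (simp add: R_def nat_le_iff)
    qed
    have Q: "1 \<le> Q" "Q \<le> real N"
    proof -
      show "1 \<le> Q" unfolding Q_def using N eta by (intro ge_one_powr_ge_zero) auto
      have "Q \<le> real N powr 1" unfolding Q_def using N eta by (intro powr_mono) auto
      then show "Q \<le> real N" using N by simp
    qed
    have P1: "P \<ge> 1"
    proof -
      have "real N ^ d \<le> real (2 * N ^ (d + 1))" using N by simp
      also have "\<dots> \<le> real M" using M by (simp only: of_nat_le_iff)
      finally show ?thesis using N by (simp add: P_def)
    qed
    \<comment> \<open>Majorant for the arc at a / q: a peak from the complete sum and the decay in
      \<beta>, plus a constant error supported on the arc. Measured in the sample index the peak has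
      width \<open>P\<close>.\<close>
    define f where "f q a j = C3 * (real N ^ r / real q ^ 3) * (1 / (1 + ((real j - of_int a * real M / real q) / P)\<^sup>2))
       + (if \<bar>real j - of_int a * real M / real q\<bar> \<le> real M / (real q * real R) then C4 * V else 0)"
      for q j :: nat and a :: int
    define n where "n = nat \<lfloor>Q\<rfloor>"
    have n: "real n \<le> Q" using Q by (simp add: n_def)
    let ?A = "Sigma {1..n} (\<lambda>q. {0..int q})"
    have V0: "V \<ge> 0" by (simp add: V_def)
    have f0: "f q a j \<ge> 0" for q a j using Cpos V0 by (auto simp: f_def)
    have pointwise: "norm (weyl_sum d N (real j / real M)) ^ r \<le> C1 * Z + (\<Sum>(q, a)\<in>?A. f q a j)"
      if j: "j < M" for j
    proof -
      define \<alpha> where "\<alpha> = real j / real M"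
      have \<alpha>: "0 \<le> \<alpha>" "\<alpha> < 1" using j by (auto simp: \<alpha>_def)
      obtain a q' where q': "coprime a q'" "0 < q'" "q' \<le> int R" "\<bar>of_int q' * \<alpha> - of_int a\<bar> < 1 / real R"
        using Dirichlet_approx_coprime[of R \<alpha>] R0 by auto
      define q where "q = nat q'"
      have q: "q' = int q" "q \<ge> 1" "q \<le> R" "coprime a (int q)" using q' by (auto simp: q_def)
      have qa: "\<bar>real q * \<alpha> - of_int a\<bar> < 1 / real R" using q' q by simp
      define \<beta> where "\<beta> = \<alpha> - of_int a / real q"
      have \<beta>: "\<bar>\<beta>\<bar> \<le> 1 / (real q * real R)"
      proof -
        have "\<beta> = (real q * \<alpha> - of_int a) / real q" using q by (simp add: \<beta>_def field_simps)
        then have "\<bar>\<beta>\<bar> = \<bar>real q * \<alpha> - of_int a\<bar> / real q" by simp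
        also have "\<dots> \<le> (1 / real R) / real q" using qa by (intro divide_right_mono) auto
        finally show ?thesis by (simp add: mult.commute)
      qed
      show ?thesis
      proof (cases "Q \<le> real q")
        case True
        have "1 / (real q * real R) \<le> 1 / (real q)\<^sup>2"
          using q R0 by (intro divide_left_mono) (auto simp: power2_eq_square intro!: mult_pos_pos)
        then have app: "\<bar>\<alpha> - of_int a / real q\<bar> \<le> 1 / (real q)\<^sup>2" using \<beta> by (simp add: \<beta>_def)
        have "norm (weyl_sum d N \<alpha>) ^ r \<le> C1 * (real N ^ r / real N ^ d)"
          using q R Rd True by (intro minor[OF N _ _ _ app]) (auto simp: Q_def)
        moreover have "0 \<le> (\<Sum>(q, a)\<in>?A. f q a j)" using f0 by (auto intro!: sum_nonneg)
        ultimately show ?thesis by (simp add: \<alpha>_def Z_def)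
      next
        case False
        have R1: "1 / real R \<le> 1" using R0 by simp
        have a: "0 \<le> a" "a \<le> int q"
        proof -
          have "of_int a > real q * \<alpha> - 1" using qa R1 by linarith
          moreover have "real q * \<alpha> \<ge> 0" using \<alpha> by simp
          ultimately have "real_of_int a > -1" by linarith
          then show "0 \<le> a" by linarith
          have "real q * \<alpha> \<le> real q * 1" using \<alpha> by (intro mult_left_mono) auto
          moreover have "real q * \<alpha> < real q * 1" using \<alpha> q by (intro mult_strict_left_mono) auto
          ultimately have "real_of_int a < real q + 1" using qa R1 by linarith
          then show "a \<le> int q" by linarith
        qed
        have qn: "q \<le> n" using False by (simp add: n_def le_nat_floor)
        have eq1: "real N ^ d * \<bar>\<beta>\<bar> = \<bar>(real j - of_int a * real M / real q) / P\<bar>"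
        proof -
          have "\<beta> = (real j - of_int a * real M / real q) / real M"
            using M0 by (simp add: \<beta>_def \<alpha>_def diff_divide_distrib)
          then have "real N ^ d * \<bar>\<beta>\<bar> = \<bar>real N ^ d * ((real j - of_int a * real M / real q) / real M)\<bar>"
            by (simp add: abs_mult)
          also have "real N ^ d * ((real j - of_int a * real M / real q) / real M) = (real j - of_int a * real M / real q) / P"
            using N M0 by (simp add: P_def)
          finally show ?thesis .
        qed
        have close: "\<bar>real j - of_int a * real M / real q\<bar> \<le> real M / (real q * real R)"
        proof -
          have "real j - of_int a * real M / real q = real M * \<beta>"
            using M0 by (simp add: \<beta>_def \<alpha>_def algebra_simps)
          then have "\<bar>real j - of_int a * real M / real q\<bar> = real M * \<bar>\<beta>\<bar>" by (simp add: abs_mult)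
          also have "\<dots> \<le> real M * (1 / (real q * real R))" using \<beta> by (intro mult_left_mono) auto
          finally show ?thesis by simp
        qed
        have err: "real q * (1 + real N ^ d * \<bar>\<beta>\<bar>) \<le> 2 * Q"
        proof -
          have "real q * (real N ^ d * \<bar>\<beta>\<bar>) \<le> real q * (real N ^ d * (1 / (real q * real R)))"
            using \<beta> by (intro mult_left_mono) auto
          also have "\<dots> = real N ^ d / real R" using q by simp
          also have "\<dots> \<le> real N ^ d / real N powr (real d - 1 + \<eta>)"
            by (rule divide_left_mono[OF R(1) _ mult_pos_pos[OF R0 Np0]]) simp
          also have "\<dots> = real N powr real d / real N powr (real d - 1 + \<eta>)" using N by (simp add: powr_realpow)
          also have "\<dots> = real N powr (real d - (real d - 1 + \<eta>))" by (simp only: powr_diff)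
          also have "\<dots> = Q" by (simp add: Q_def)
          finally show ?thesis using False by (simp add: algebra_simps)
        qed
        have "norm (weyl_sum d N (of_int a / real q + \<beta>)) ^ r \<le>
          2 ^ r * ((2 * (norm (weyl_sum d q (of_int a / real q)) / real q) * real N) ^ r
              * (2 / (1 + (real N ^ d * \<bar>\<beta>\<bar>)\<^sup>2))
            + (2 ^ (d + 5) * real q * (1 + real N ^ d * \<bar>\<beta>\<bar>)) ^ r)"
          using q N assms r2d by (intro norm_weyl_sum_major_arc_power_le) auto
        also have "\<dots> \<le> 2 ^ r * ((2 ^ r * (C2 / real q ^ 3) * real N ^ r)
              * (2 / (1 + (real N ^ d * \<bar>\<beta>\<bar>)\<^sup>2)) + (2 ^ (d + 6)) ^ r * V)"
        proof (intro mult_left_mono add_mono mult_right_mono)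
          show "(2 * (norm (weyl_sum d q (of_int a / real q)) / real q) * real N) ^ r
              \<le> 2 ^ r * (C2 / real q ^ 3) * real N ^ r"
            unfolding power_mult_distrib using complete[OF q(2,4)]
            by (intro mult_right_mono mult_left_mono) auto
          have "(2 ^ (d + 5) * real q * (1 + real N ^ d * \<bar>\<beta>\<bar>)) = 2 ^ (d + 5) * (real q * (1 + real N ^ d * \<bar>\<beta>\<bar>))"
            by simp
          also have "\<dots> \<le> 2 ^ (d + 5) * (2 * Q)" using err by (intro mult_left_mono) auto
          also have "\<dots> = 2 ^ (d + 6) * Q" by (simp add: power_add)
          finally have "(2 ^ (d + 5) * real q * (1 + real N ^ d * \<bar>\<beta>\<bar>)) ^ r \<le> (2 ^ (d + 6) * Q) ^ r"
            by (intro power_mono) auto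
          then show "(2 ^ (d + 5) * real q * (1 + real N ^ d * \<bar>\<beta>\<bar>)) ^ r \<le> (2 ^ (d + 6)) ^ r * V"
            by (simp only: V_def Q_def power_mult_distrib)
        qed auto
        also have "\<dots> = f q a j" unfolding eq1 power2_abs f_def C3_def C4_def using close
          by (simp add: algebra_simps)
        also have "\<dots> \<le> (\<Sum>(q, a)\<in>?A. f q a j)"
        proof -
          have "(\<lambda>(q, a). f q a j) (q, a) \<le> (\<Sum>(q, a)\<in>?A. f q a j)"
            using q qn a f0 by (intro member_le_sum) auto
          then show ?thesis by simp
        qed
        finally have "norm (weyl_sum d N \<alpha>) ^ r \<le> (\<Sum>(q, a)\<in>?A. f q a j)" by (simp add: \<beta>_def)
        moreover have "0 \<le> C1 * Z" using Cpos by (simp add: Z_def)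
        ultimately show ?thesis by (simp add: \<alpha>_def)
      qed
    qed
    have sumf: "(\<Sum>j<M. f q a j) \<le> 12 * C3 * real M * Z / real q ^ 3 + 3 * C4 * V * real M / (real q * real R)"
      if q: "q \<in> {1..n}" for q a
    proof -
      let ?y = "of_int a * real M / real q" and ?l = "real M / (real q * real R)"
      have q1: "real q \<ge> 1" using q by simp
      have near: "(\<bar>x - y\<bar> \<le> l) = (y - l \<le> x \<and> x \<le> (y - l) + 2 * l)" for x y l :: real by linarith
      \<comment> \<open>Here M \<ge> 2 * N ^ (d + 1) enters: every arc has half-length l \<ge> 1 in
        sample units, so a count of 2 * l + 1 is at most 3 * l.\<close>
      have qR: "real q * real R \<le> real M"
      proof -
        have "real q \<le> real N" using q n Q by (metis atLeastAtMost_iff of_nat_le_iff order_trans)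
        then have "real q * real R \<le> real N * real (N ^ d)" using Rd by (intro mult_mono) (simp_all only: of_nat_le_iff of_nat_0_le_iff)
        also have "\<dots> \<le> real (2 * N ^ (d + 1))" by simp
        also have "\<dots> \<le> real M" using M by (simp only: of_nat_le_iff)
        finally show ?thesis .
      qed
      then have l1: "1 \<le> ?l" using q1 R0 by (simp add: le_divide_eq)
      have "(\<Sum>j<M. f q a j) = C3 * (real N ^ r / real q ^ 3) * (\<Sum>j<M. 1 / (1 + ((real j - ?y) / P)\<^sup>2))
         + (\<Sum>j<M. if \<bar>real j - ?y\<bar> \<le> ?l then C4 * V else 0)"
        by (simp add: f_def sum.distrib sum_distrib_left)
      also have "(\<Sum>j<M. if \<bar>real j - ?y\<bar> \<le> ?l then C4 * V else 0) = real (card {j\<in>{..<M}. \<bar>real j - ?y\<bar> \<le> ?l}) * (C4 * V)"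
        by (subst sum.inter_filter[symmetric]) auto
      also have "{j\<in>{..<M}. \<bar>real j - ?y\<bar> \<le> ?l} = {j\<in>{..<M}. ?y - ?l \<le> real j \<and> real j \<le> (?y - ?l) + 2 * ?l}"
        by (simp only: near)
      also have "real (card \<dots>) * (C4 * V) \<le> (3 * ?l) * (C4 * V)"
      proof (intro mult_right_mono)
        have "real (card {j\<in>{..<M}. ?y - ?l \<le> real j \<and> real j \<le> (?y - ?l) + 2 * ?l}) \<le> 2 * ?l + 1"
          by (rule card_nat_interval_le) auto
        also have "2 * ?l + 1 \<le> 3 * ?l"
        proof -
          have "2 * l + 1 \<le> 3 * l" if "1 \<le> l" for l :: real using that by linarith
          then show ?thesis using l1 .
        qed
        finally show "real (card {j\<in>{..<M}. ?y - ?l \<le> real j \<and> real j \<le> (?y - ?l) + 2 * ?l}) \<le> 3 * ?l" .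
      qed (use Cpos V0 in auto)
      also have "C3 * (real N ^ r / real q ^ 3) * (\<Sum>j<M. 1 / (1 + ((real j - ?y) / P)\<^sup>2)) \<le>
          C3 * (real N ^ r / real q ^ 3) * (12 * P)"
        using Cpos by (intro mult_left_mono sum_inverse_one_plus_square_scaled_le[OF _ P1]) auto
      finally have "(\<Sum>j<M. f q a j) \<le> C3 * (real N ^ r / real q ^ 3) * (12 * P) + (3 * ?l) * (C4 * V)"
        by simp
      then show ?thesis by (simp add: P_def Z_def mult_ac)
    qed
    \<comment> \<open>Up to constants and the factor M, the left side is the total error: at most Q
      denominators, each with about q arcs of length of order 1 / (q * R) and error V.\<close>
    have VR: "V * Q / real R \<le> Z"
    proof -
      have Veq: "V = real N powr ((1 - \<eta>) * real r)" using N by (simp add: V_def powr_power mult.commute)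
      have "V * Q / real R \<le> V * Q / real N powr (real d - 1 + \<eta>)"
        using V0 Q(1) by (intro divide_left_mono[OF R(1) _ mult_pos_pos[OF R0 Np0]]) simp
      also have "V * Q / real N powr (real d - 1 + \<eta>) =
          real N powr ((1 - \<eta>) * real r + (1 - \<eta>) - (real d - 1 + \<eta>))"
        by (simp only: Veq Q_def powr_add powr_diff)
      also have "\<dots> \<le> real N powr (real r - real d)"
      proof (intro powr_mono)
        have "real r = real d * (K + 1)" unfolding assms(3) K_def by (simp add: algebra_simps)
        then have "\<eta> * real r = 2 * real d / 3" using K1 by (simp add: \<eta>_def field_simps)
        then have "\<eta> * real r \<ge> 2" using assms by simp
        then show "(1 - \<eta>) * real r + (1 - \<eta>) - (real d - 1 + \<eta>) \<le> real r - real d"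
          using eta by (simp add: algebra_simps)
      qed (use N in auto)
      also have "\<dots> = Z" using N by (simp add: Z_def powr_diff powr_realpow)
      finally show ?thesis .
    qed
    have "(\<Sum>j<M. norm (weyl_sum d N (real j / real M)) ^ r) \<le> (\<Sum>j<M. C1 * Z + (\<Sum>(q, a)\<in>?A. f q a j))"
      by (intro sum_mono pointwise) auto
    also have "\<dots> = real M * (C1 * Z) + (\<Sum>j<M. \<Sum>(q, a)\<in>?A. f q a j)" by (simp add: sum.distrib)
    also have "(\<Sum>j<M. \<Sum>(q, a)\<in>?A. f q a j) = (\<Sum>q\<in>{1..n}. \<Sum>a\<in>{0..int q}. \<Sum>j<M. f q a j)"
    proof -
      have "(\<Sum>j<M. \<Sum>(q, a)\<in>?A. f q a j) = (\<Sum>(q, a)\<in>?A. \<Sum>j<M. f q a j)"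
        by (subst sum.swap) (simp only: case_prod_unfold)
      also have "\<dots> = (\<Sum>q\<in>{1..n}. \<Sum>a\<in>{0..int q}. \<Sum>j<M. f q a j)"
        by (rule sum.Sigma[symmetric]) auto
      finally show ?thesis .
    qed
    also have "\<dots> \<le> (\<Sum>q\<in>{1..n}. \<Sum>a\<in>{0..int q}. 12 * C3 * real M * Z / real q ^ 3 + 3 * C4 * V * real M / (real q * real R))"
      by (intro sum_mono sumf)
    also have "\<dots> \<le> (\<Sum>q\<in>{1..n}. 48 * C3 * real M * Z * (1 / (1 + (real q)\<^sup>2)) + 6 * C4 * V * real M / real R)"
    proof (intro sum_mono)
      fix q assume q: "q \<in> {1..n}"
      let ?B = "12 * C3 * real M * Z / real q ^ 3 + 3 * C4 * V * real M / (real q * real R)"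
      have q1: "real q \<ge> 1" using q by simp
      have Z0: "Z \<ge> 0" by (simp add: Z_def)
      have "(\<Sum>a\<in>{0..int q}. ?B) = (real q + 1) * ?B" by simp
      also have "\<dots> \<le> (2 * real q) * ?B"
        using q1 Cpos V0 Z0 R0 by (intro mult_right_mono add_nonneg_nonneg divide_nonneg_nonneg mult_nonneg_nonneg) auto
      also have "\<dots> = 12 * C3 * real M * Z * (2 / (real q)\<^sup>2) + 6 * C4 * V * real M / real R"
        using q1 by (simp add: field_simps power2_eq_square power3_eq_cube)
      also have "12 * C3 * real M * Z * (2 / (real q)\<^sup>2) \<le> 12 * C3 * real M * Z * (4 * (1 / (1 + (real q)\<^sup>2)))"
      proof (intro mult_left_mono)
        have "2 / v \<le> 4 * (1 / (1 + v))" if "1 \<le> v" for v :: real using that by (simp add: field_simps)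
        moreover have "(real q)\<^sup>2 \<ge> 1" using q1 by simp
        ultimately show "2 / (real q)\<^sup>2 \<le> 4 * (1 / (1 + (real q)\<^sup>2))" .
      qed (use Cpos Z0 in auto)
      finally show "(\<Sum>a\<in>{0..int q}. ?B) \<le> 48 * C3 * real M * Z * (1 / (1 + (real q)\<^sup>2)) + 6 * C4 * V * real M / real R"
        by simp
    qed
    also have "\<dots> = 48 * C3 * real M * Z * (\<Sum>q\<in>{1..n}. 1 / (1 + (real q)\<^sup>2)) + real n * (6 * C4 * V * real M / real R)"
      by (simp add: sum.distrib sum_distrib_left)
    also have "\<dots> \<le> 48 * C3 * real M * Z * 3 + 6 * C4 * real M * Z"
    proof (intro add_mono mult_left_mono)
      have "(\<Sum>q\<in>{1..n}. 1 / (1 + (real q)\<^sup>2)) \<le> (\<Sum>q<Suc n. 1 / (1 + (real q)\<^sup>2))"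
        by (intro sum_mono2) auto
      also have "\<dots> \<le> 3" by (rule sum_inverse_one_plus_square_le)
      finally show "(\<Sum>q\<in>{1..n}. 1 / (1 + (real q)\<^sup>2)) \<le> 3" .
      have "real n * (6 * C4 * V * real M / real R) \<le> Q * (6 * C4 * V * real M / real R)"
        using n Cpos V0 by (intro mult_right_mono) auto
      also have "\<dots> = 6 * C4 * real M * (V * Q / real R)" by simp
      also have "\<dots> \<le> 6 * C4 * real M * Z" using VR Cpos by (intro mult_left_mono) auto
      finally show "real n * (6 * C4 * V * real M / real R) \<le> 6 * C4 * real M * Z" .
    qed (use Cpos in \<open>auto simp: Z_def\<close>)
    finally show "(\<Sum>j<M. norm (weyl_sum d N (real j / real M)) ^ r)
        \<le> (C1 + 144 * C3 + 6 * C4) * real M * (real N ^ r / real N ^ d)"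
      by (simp add: Z_def algebra_simps)
  qed
qed

section \<open>Counting power translates and interpolation\<close>

lemma sum_unit_exp_roots:
  fixes n :: int and M :: nat
  assumes "M \<ge> 1"
  shows "(\<Sum>j<M. unit_exp (real j * (of_int n / real M))) = (if int M dvd n then of_nat M else 0)"
proof (cases "int M dvd n")
  case True
  then obtain z where z: "n = int M * z" by (elim dvdE)
  have "real j * (of_int n / real M) = of_int (int j * z)" for j :: nat using assms by (simp add: z)
  then have "unit_exp (real j * (of_int n / real M)) = 1" for j :: nat by (simp only: unit_exp_of_int)
  then show ?thesis using True by simp
next
  case False
  define z where "z = unit_exp (of_int n / real M)"
  have "z \<noteq> 1"
  proof
    assume "z = 1"
    then have "dist_int (of_int n / real M) = 0"
      using norm_unit_exp_minus_one_ge[of "of_int n / real M"] dist_int_nonneg[of "of_int n / real M"]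
      unfolding z_def by simp
    then have "of_int n / real M = of_int (round (of_int n / real M))" by (simp add: dist_int_def)
    then have "real_of_int n = real M * of_int (round (of_int n / real M))"
      using assms by (simp add: field_simps)
    then have "real_of_int n = real_of_int (int M * round (of_int n / real M))" by simp
    then have "n = int M * round (of_int n / real M)" by (simp only: of_int_eq_iff)
    then show False using False by (metis dvd_triv_left)
  qed
  moreover have "z ^ M = 1"
    using assms by (simp add: z_def unit_exp_power)
  ultimately have "(\<Sum>j<M. z ^ j) = 0" by (simp add: sum_gp_strict)
  then show ?thesis using False by (simp add: z_def unit_exp_power)
qed

text \<open>The Fourier transform modulo \<open>M\<close> of the indicator of
  \<open>A\<close>.\<close>

definition exp_sum_on :: "nat \<Rightarrow> int set \<Rightarrow> nat \<Rightarrow> complex" where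
  "exp_sum_on M A j = (\<Sum>x\<in>A. unit_exp (real j * (of_int x / real M)))"

lemma norm_exp_sum_on_le: "norm (exp_sum_on M A j) \<le> real (card A)"
proof -
  have "norm (exp_sum_on M A j) \<le> (\<Sum>x\<in>A. norm (unit_exp (real j * (of_int x / real M))))"
    unfolding exp_sum_on_def by (rule norm_sum)
  then show ?thesis by simp
qed

text \<open>As \<open>A\<close> injects into the residues modulo \<open>M\<close>, only diagonal
  pairs survive orthogonality.\<close>

lemma exp_sum_on_parseval:
  assumes "finite A" "M \<ge> 1" "\<And>x y. x \<in> A \<Longrightarrow> y \<in> A \<Longrightarrow> int M dvd x - y \<Longrightarrow> x = y"
  shows "(\<Sum>j<M. (norm (exp_sum_on M A j))\<^sup>2) = real M * real (card A)"
proof -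
  have "complex_of_real (\<Sum>j<M. (norm (exp_sum_on M A j))\<^sup>2) =
      (\<Sum>j<M. exp_sum_on M A j * cnj (exp_sum_on M A j))"
    unfolding of_real_sum by (intro sum.cong refl complex_norm_square)
  also have "\<dots> = (\<Sum>j<M. \<Sum>x\<in>A. \<Sum>y\<in>A. unit_exp (real j * (of_int (x - y) / real M)))"
    by (intro sum.cong refl)
      (simp add: exp_sum_on_def sum_product diff_divide_distrib right_diff_distrib unit_exp_diff)
  also have "\<dots> = (\<Sum>x\<in>A. \<Sum>y\<in>A. \<Sum>j<M. unit_exp (real j * (of_int (x - y) / real M)))"
    by (subst sum.swap, intro sum.cong refl, subst sum.swap) simp
  also have "\<dots> = (\<Sum>x\<in>A. \<Sum>y\<in>A. if x = y then of_nat M else 0)"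
    unfolding sum_unit_exp_roots[OF assms(2)] using assms(3) by (intro sum.cong refl) auto
  also have "\<dots> = complex_of_real (real M * real (card A))" using assms(1) by simp
  finally show ?thesis by (simp only: of_real_eq_iff)
qed

text \<open>By orthogonality the count is bounded by the mean over j of the Weyl sum against the
  transforms of F and G. The power mean inequality is weighted by the product w of the absolute
  values of the two transforms: with s = sqrt (|F| * |G|), Parseval and Cauchy-Schwarz give total
  weight at most M * s, while each weight is at most s ^ 2. The exponents r - 1 and 2 add up to r +
  1.\<close>

lemma card_power_translates_le:
  assumes "d \<ge> 3" "r = d * (2 ^ (d - 1) + 1)"
  obtains C where "C > 0" "\<And>N F G. N \<ge> 1 \<Longrightarrow> finite F \<Longrightarrow> finite G \<Longrightarrow>
     real (card {(x, k). x \<in> G \<and> k \<in> {1..N} \<and> x + int k ^ d \<in> F}) ^ r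
       \<le> C * (real N ^ r / real N ^ d) * sqrt (real (card F) * real (card G)) ^ (r + 1)"
proof -
  obtain C where C: "C > 0" "\<And>N M. N \<ge> 1 \<Longrightarrow> M \<ge> 2 * N ^ (d + 1) \<Longrightarrow>
    (\<Sum>j<M. norm (weyl_sum d N (real j / real M)) ^ r) \<le> C * real M * (real N ^ r / real N ^ d)"
    using weyl_sum_mean_value[OF assms(1) refl assms(2)] by blast
  show ?thesis
  proof (rule that[OF C(1)])
    fix N :: nat and F G :: "int set"
    assume N: "N \<ge> 1" and F: "finite F" and G: "finite G"
    define T where "T = card {(x, k). x \<in> G \<and> k \<in> {1..N} \<and> x + int k ^ d \<in> F}"
    define s where "s = sqrt (real (card F) * real (card G))"
    have "r > 0" using assms by simp
    then obtain n where n: "r = Suc n" using gr0_implies_Suc by blast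
    have "finite (abs ` (F \<union> G))" using F G by auto
    then obtain B where B: "\<And>x. x \<in> F \<union> G \<Longrightarrow> \<bar>x\<bar> \<le> B"
      by (metis Max_ge imageI)
    \<comment> \<open>Large enough for the mean value bound, and more than 2 * B, so that distinct
      elements of \<open>F\<close>, or of \<open>G\<close>, stay distinct modulo
      \<open>M\<close>.\<close>
    define M where "M = 2 * N ^ (d + 1) + 2 * nat B + 1"
    have M1: "M \<ge> 1" and MN: "M \<ge> 2 * N ^ (d + 1)" by (auto simp: M_def)
    have sep: "x = y" if "\<bar>x\<bar> \<le> B" "\<bar>y\<bar> \<le> B" "int M dvd x - y" for x y
    proof (rule ccontr)
      assume "x \<noteq> y"
      then have "int M \<le> \<bar>x - y\<bar>" using that(3) by (intro zdvd_imp_le) (auto simp: dvd_abs_iff)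
      moreover have "M > 2 * nat B" by (simp add: M_def)
      ultimately show False using that by linarith
    qed
    define w where "w j = norm (exp_sum_on M G j) * norm (exp_sum_on M F j)" for j
    have parF: "(\<Sum>j<M. (norm (exp_sum_on M F j))\<^sup>2) = real M * real (card F)"
      using B sep by (intro exp_sum_on_parseval F M1) auto
    have parG: "(\<Sum>j<M. (norm (exp_sum_on M G j))\<^sup>2) = real M * real (card G)"
      using B sep by (intro exp_sum_on_parseval G M1) auto
    have sumw: "(\<Sum>j<M. w j) \<le> real M * s"
    proof -
      have "(\<Sum>j<M. w j)\<^sup>2 \<le> (real M * real (card G)) * (real M * real (card F))"
        unfolding w_def parF[symmetric] parG[symmetric] by (rule Cauchy_Schwarz_ineq_sum)
      also have "\<dots> = (real M * s)\<^sup>2" by (simp add: s_def power_mult_distrib power2_eq_square)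
      finally show ?thesis by (rule power2_le_imp_le) (auto simp: s_def)
    qed
    have wle: "w j \<le> s\<^sup>2" for j
    proof -
      have "w j \<le> real (card G) * real (card F)"
        unfolding w_def by (intro mult_mono norm_exp_sum_on_le) auto
      then show ?thesis by (simp add: s_def mult.commute)
    qed
    have w0: "w j \<ge> 0" for j by (simp add: w_def)
    have s0: "s \<ge> 0" by (simp add: s_def)
    have ip: "(\<Sum>j<M. weyl_sum d N (real j / real M) * (exp_sum_on M G j * cnj (exp_sum_on M F j)))
        = of_nat (M * card {(k, x, y). k \<in> {1..N} \<and> x \<in> G \<and> y \<in> F \<and> int M dvd int k ^ d + x - y})"
    proof -
      let ?e = "\<lambda>j k x y. unit_exp (real j * (of_int (int k ^ d + x - y) / real M))"
      let ?S = "{1..N} \<times> G \<times> F"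
      have "weyl_sum d N (real j / real M) * (exp_sum_on M G j * cnj (exp_sum_on M F j)) =
          (\<Sum>(k, x, y)\<in>?S. ?e j k x y)" for j
      proof -
        have e: "?e j k x y = unit_exp (real j / real M * real k ^ d) * (unit_exp (real j * (of_int x / real M))
            * cnj (unit_exp (real j * (of_int y / real M))))" for k x y
          by (simp flip: unit_exp_add unit_exp_diff add: algebra_simps diff_divide_distrib add_divide_distrib)
        show ?thesis
          unfolding e weyl_sum_def exp_sum_on_def cnj_sum sum_product
          unfolding sum_distrib_left
          by (simp only: sum.cartesian_product)
      qed
      then have "(\<Sum>j<M. weyl_sum d N (real j / real M) * (exp_sum_on M G j * cnj (exp_sum_on M F j)))
          = (\<Sum>j<M. \<Sum>(k, x, y)\<in>?S. ?e j k x y)" by simp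
      also have "\<dots> = (\<Sum>(k, x, y)\<in>?S. \<Sum>j<M. ?e j k x y)"
        by (subst sum.swap) (simp only: case_prod_unfold)
      also have "\<dots> = (\<Sum>z\<in>?S. if z \<in> {(k, x, y). int M dvd int k ^ d + x - y} then of_nat M else 0)"
        unfolding sum_unit_exp_roots[OF M1] by (intro sum.cong) auto
      also have "\<dots> = of_nat M * of_nat (card {z\<in>?S. z \<in> {(k, x, y). int M dvd int k ^ d + x - y}})"
        using F G by (subst sum.inter_filter[symmetric]) auto
      also have "{z\<in>?S. z \<in> {(k, x, y). int M dvd int k ^ d + x - y}} =
          {(k, x, y). k \<in> {1..N} \<and> x \<in> G \<and> y \<in> F \<and> int M dvd int k ^ d + x - y}" by auto
      finally show ?thesis by simp
    qed
    \<comment> \<open>Every true solution also solves the congruence; additional solutions modulo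
      \<open>M\<close> only enlarge the upper bound.\<close>
    have Tle: "T \<le> card {(k, x, y). k \<in> {1..N} \<and> x \<in> G \<and> y \<in> F \<and> int M dvd int k ^ d + x - y}"
    proof -
      have "finite {(k, x, y). k \<in> {1..N} \<and> x \<in> G \<and> y \<in> F \<and> int M dvd int k ^ d + x - y}"
        by (rule finite_subset[of _ "{1..N} \<times> G \<times> F"]) (use F G in auto)
      then show ?thesis unfolding T_def
        by (rule card_inj_on_le[of "\<lambda>(x, k). (k, x, x + int k ^ d)", rotated -1])
          (auto simp: inj_on_def)
    qed
    have "real M * real T \<le> real (M * card {(k, x, y). k \<in> {1..N} \<and> x \<in> G \<and> y \<in> F \<and> int M dvd int k ^ d + x - y})"
      using Tle by (simp add: mult_left_mono)
    also have "\<dots> = norm (\<Sum>j<M. weyl_sum d N (real j / real M) * (exp_sum_on M G j * cnj (exp_sum_on M F j)))"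
      unfolding ip by (simp only: norm_of_nat)
    also have "\<dots> \<le> (\<Sum>j<M. w j * norm (weyl_sum d N (real j / real M)))"
      by (rule order_trans[OF norm_sum]) (simp add: norm_mult w_def mult_ac)
    finally have "(real M * real T) ^ r \<le> (\<Sum>j<M. w j * norm (weyl_sum d N (real j / real M))) ^ r"
      by (intro power_mono) auto
    also have "\<dots> \<le> (\<Sum>j<M. w j) ^ n * (\<Sum>j<M. w j * norm (weyl_sum d N (real j / real M)) ^ r)"
      unfolding n by (rule weighted_power_mean) (auto simp: w0)
    also have "\<dots> \<le> (real M * s) ^ n * (\<Sum>j<M. s\<^sup>2 * norm (weyl_sum d N (real j / real M)) ^ r)"
      using s0 by (intro mult_mono power_mono sumw sum_mono wle mult_right_mono)
        (auto intro!: sum_nonneg simp: w0)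
    also have "(\<Sum>j<M. s\<^sup>2 * norm (weyl_sum d N (real j / real M)) ^ r) =
        s\<^sup>2 * (\<Sum>j<M. norm (weyl_sum d N (real j / real M)) ^ r)" by (simp add: sum_distrib_left)
    also have "(real M * s) ^ n * (s\<^sup>2 * (\<Sum>j<M. norm (weyl_sum d N (real j / real M)) ^ r)) \<le>
        (real M * s) ^ n * (s\<^sup>2 * (C * real M * (real N ^ r / real N ^ d)))"
      using s0 by (intro mult_left_mono C(2) N MN) auto
    also have "\<dots> = real M ^ r * (C * (real N ^ r / real N ^ d) * s ^ (r + 1))"
      by (simp add: n power_mult_distrib power2_eq_square)
    finally have "real M ^ r * real T ^ r \<le> real M ^ r * (C * (real N ^ r / real N ^ d) * s ^ (r + 1))"
      by (simp add: power_mult_distrib)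
    then show "real T ^ r \<le> C * (real N ^ r / real N ^ d) * s ^ (r + 1)"
      by (rule mult_left_le_imp_le) (use M1 in simp)
  qed
qed

section \<open>Dyadic levels and their interaction\<close>

lemma sum_two_sided_geometric_le:
  fixes J :: "int set" and z x :: real
  assumes "finite J" "0 < z" "z < 1"
  shows "(\<Sum>j\<in>J. z powr \<bar>of_int j - x\<bar>) \<le> 2 / (1 - z)"
proof -
  \<comment> \<open>On each side of x, rounding the distance down gives distinct natural exponents,
    so each half is dominated by part of a geometric series, uniformly in x.\<close>
  have geo: "(\<Sum>j\<in>A. z ^ h j) \<le> 1 / (1 - z)" if "finite A" "inj_on h A" for A :: "int set" and h
  proof -
    have "(\<Sum>j\<in>A. z ^ h j) = (\<Sum>n\<in>h ` A. z ^ n)" using that by (simp add: sum.reindex)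
    also have "\<dots> \<le> (\<Sum>n. z ^ n)"
      using assms that by (intro sum_le_suminf summable_geometric) auto
    also have "\<dots> = 1 / (1 - z)" using assms by (intro suminf_geometric) auto
    finally show ?thesis .
  qed
  let ?J1 = "{j\<in>J. \<lceil>x\<rceil> \<le> j}" and ?J2 = "{j\<in>J. j \<le> \<lfloor>x\<rfloor>}"
  have "J \<subseteq> ?J1 \<union> ?J2" by (auto simp: ceiling_le_iff le_floor_iff)
  then have "(\<Sum>j\<in>J. z powr \<bar>of_int j - x\<bar>) \<le> (\<Sum>j\<in>?J1 \<union> ?J2. z powr \<bar>of_int j - x\<bar>)"
    using assms by (intro sum_mono2) auto
  also have "\<dots> \<le> (\<Sum>j\<in>?J1. z powr \<bar>of_int j - x\<bar>) + (\<Sum>j\<in>?J2. z powr \<bar>of_int j - x\<bar>)"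
    using assms by (subst sum.union_inter[symmetric]) (auto intro!: sum_nonneg)
  also have "(\<Sum>j\<in>?J1. z powr \<bar>of_int j - x\<bar>) \<le> (\<Sum>j\<in>?J1. z ^ nat (j - \<lceil>x\<rceil>))"
  proof (intro sum_mono)
    fix j assume j: "j \<in> ?J1"
    then have "z powr \<bar>of_int j - x\<bar> \<le> z powr (real (nat (j - \<lceil>x\<rceil>)))"
      using assms by (intro powr_mono') (auto, linarith)
    then show "z powr \<bar>of_int j - x\<bar> \<le> z ^ nat (j - \<lceil>x\<rceil>)" using assms by (simp add: powr_realpow)
  qed
  also have "\<dots> \<le> 1 / (1 - z)"
    using assms by (intro geo) (auto simp: inj_on_def)
  also have "(\<Sum>j\<in>?J2. z powr \<bar>of_int j - x\<bar>) \<le> (\<Sum>j\<in>?J2. z ^ nat (\<lfloor>x\<rfloor> - j))"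
  proof (intro sum_mono)
    fix j assume j: "j \<in> ?J2"
    then have "z powr \<bar>of_int j - x\<bar> \<le> z powr (real (nat (\<lfloor>x\<rfloor> - j)))"
      using assms by (intro powr_mono') (auto, linarith)
    then show "z powr \<bar>of_int j - x\<bar> \<le> z ^ nat (\<lfloor>x\<rfloor> - j)" using assms by (simp add: powr_realpow)
  qed
  also have "\<dots> \<le> 1 / (1 - z)"
    using assms by (intro geo) (auto simp: inj_on_def)
  finally show ?thesis by simp
qed

text \<open>For y > 0, level i means 2 powr (-i - 1) < y \<le> 2 powr (-i), so higher levels hold
  smaller values.\<close>

definition dyadic_level :: "real \<Rightarrow> int" where
  "dyadic_level y = \<lfloor>- log 2 y\<rfloor>"

lemma dyadic_level_bounds:
  assumes "y > 0"
  shows "y \<le> 2 powr (- of_int (dyadic_level y))" "2 powr (- of_int (dyadic_level y) - 1) \<le> y"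
proof -
  have "log 2 y \<le> - of_int (dyadic_level y)" "- of_int (dyadic_level y) - 1 \<le> log 2 y"
    unfolding dyadic_level_def by linarith+
  then have "2 powr (log 2 y) \<le> 2 powr (- of_int (dyadic_level y))"
    "2 powr (- of_int (dyadic_level y) - 1) \<le> 2 powr (log 2 y)" by (simp_all only: powr_mono)
  then show "y \<le> 2 powr (- of_int (dyadic_level y))" "2 powr (- of_int (dyadic_level y) - 1) \<le> y"
    using assms by simp_all
qed

text \<open>Chebyshev's inequality on one level set, where f y \<ge> 2 powr (-i - 1).\<close>

lemma card_level_set_le:
  fixes p :: real
  assumes "finite A" "p > 0" "\<And>y. y \<in> A \<Longrightarrow> f y > 0 \<and> dyadic_level (f y) = i"
  shows "real (card A) \<le> 2 powr ((of_int i + 1) * p) * (\<Sum>y\<in>A. f y powr p)"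
proof -
  have "real (card A) = (\<Sum>y\<in>A. 1)" by simp
  also have "\<dots> \<le> (\<Sum>y\<in>A. 2 powr ((of_int i + 1) * p) * f y powr p)"
  proof (intro sum_mono)
    fix y assume y: "y \<in> A"
    have "(2 powr (- of_int i - 1)) powr p \<le> f y powr p"
      using assms(2,3) y dyadic_level_bounds(2)[of "f y"] by (intro powr_mono2) auto
    then have "2 powr ((of_int i + 1) * p) * 2 powr ((- of_int i - 1) * p) \<le> 2 powr ((of_int i + 1) * p) * f y powr p"
      by (intro mult_left_mono) (auto simp: powr_powr)
    moreover have "(2::real) powr ((of_int i + 1) * p) * 2 powr ((- of_int i - 1) * p) = 1"
      by (simp add: powr_add[symmetric] algebra_simps)
    ultimately show "1 \<le> 2 powr ((of_int i + 1) * p) * f y powr p" by linarith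
  qed
  finally show ?thesis by (simp add: sum_distrib_left)
qed

text \<open>A solution is determined by (x, k), and also by (x + k ^ d, k). This gives the bounds
  |G| * N and |F| * N, of which the geometric mean is taken.\<close>

lemma card_power_translates_trivial:
  assumes "finite F" "finite G"
  shows "real (card {(x, k). x \<in> G \<and> k \<in> {1..N} \<and> x + int k ^ d \<in> F}) \<le> real N * sqrt (real (card F) * real (card G))"
proof -
  let ?T = "{(x, k). x \<in> G \<and> k \<in> {1..N} \<and> x + int k ^ d \<in> F}"
  have 1: "card ?T \<le> card (G \<times> {1..N})" using assms by (intro card_mono) auto
  have 2: "card ?T \<le> card (F \<times> {1..N})"
    by (rule card_inj_on_le[of "\<lambda>(x, k). (x + int k ^ d, k)"]) (use assms in \<open>auto simp: inj_on_def\<close>)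
  have "(real (card ?T))\<^sup>2 = real (card ?T) * real (card ?T)" by (simp add: power2_eq_square)
  also have "\<dots> \<le> (real (card F) * real N) * (real (card G) * real N)"
    using 1 2 by (intro mult_mono) (auto simp: card_cartesian_product simp flip: of_nat_mult)
  also have "\<dots> = (real N * sqrt (real (card F) * real (card G)))\<^sup>2"
    by (simp add: power_mult_distrib power2_eq_square)
  finally show ?thesis by (rule power2_le_imp_le) simp
qed

text \<open>The two bounds balance at the pair level \<open>u = u\<^sub>0\<close>, where \<open>2 powr (u\<^sub>0 * p / 2) = N powr d\<close>.\<close>

lemma dyadic_pair_bound:
  fixes p \<tau> C N d u m T \<phi> \<gamma> :: real
  assumes p: "1 \<le> p" "p < 2" and a: "0 < p * (1 + \<tau>) / 2 - 1" and tau: "0 < \<tau>" "\<tau> \<le> 1"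
    and N: "N \<ge> 1" and C: "C \<ge> 0" and m: "0 \<le> m" "m \<le> 2 powr p * 2 powr (u * p / 2) * sqrt (\<phi> * \<gamma>)"
    and T: "T \<le> N * m" "T \<le> C * N * N powr (- d * \<tau>) * m powr (1 + \<tau>)"
    and \<phi>: "0 \<le> \<phi>" "\<phi> \<le> 1" and \<gamma>: "0 \<le> \<gamma>" "\<gamma> \<le> 1"
  shows "2 powr (- u) * (T / N) \<le> (1 + C) * 2 powr (2 * p) * N powr (d * (1 - 2 / p)) *
    ((2 powr (- min (p * (1 + \<tau>) / 2 - 1) (1 - p / 2))) powr \<bar>u - log 2 N * (2 * d / p)\<bar> * ((\<phi> + \<gamma>) / 2))"
proof -
  \<comment> \<open>\<open>a\<close> and \<open>b\<close> are the decay rates below and above the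
    balance point, from the arithmetic and the trivial bound. With \<tau> = 1 / r, a > 0 encodes p >
    2 * r / (r + 1), and b > 0 encodes p < 2.\<close>
  define a where "a = p * (1 + \<tau>) / 2 - 1"
  define b where "b = 1 - p / 2"
  define c where "c = min a b"
  define u0 where "u0 = log 2 N * (2 * d / p)"
  define \<psi> where "\<psi> = sqrt (\<phi> * \<gamma>)"
  have ab: "a > 0" "b > 0" "c > 0" "c \<le> a" "c \<le> b" "a + b = p * \<tau> / 2"
    using assms by (auto simp: a_def b_def c_def algebra_simps add_divide_distrib)
  \<comment> \<open>Passing to the arithmetic mean lets the sums over the two families of levels be
    separated later.\<close>
  have psi: "0 \<le> \<psi>" "\<psi> \<le> 1" "\<psi> \<le> (\<phi> + \<gamma>) / 2"
    using \<phi> \<gamma> arith_geo_mean_sqrt[of \<phi> \<gamma>] by (auto simp: \<psi>_def mult_le_one)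
  have N2: "N powr s = 2 powr (log 2 N * s)" for s using N by (simp flip: powr_powr)
  \<comment> \<open>The value at the balance point is the scale-invariant power of N.\<close>
  have e1: "N powr (d * (1 - 2 / p)) = 2 powr (- u0 * b)"
  proof -
    have "2 * d / p * b = 2 * d / p - d" using p by (simp add: b_def right_diff_distrib)
    then have "d * (1 - 2 / p) = - (2 * d / p * b)" by (simp add: algebra_simps)
    then show ?thesis unfolding N2 u0_def by (simp add: mult.assoc)
  qed
  have e2: "N powr (- d * \<tau>) = 2 powr (- u0 * (a + b))"
  proof -
    have "2 * d / p * (a + b) = d * \<tau>" using p by (simp add: ab(6))
    moreover have "u0 * (a + b) = log 2 N * (2 * d / p * (a + b))" by (simp only: u0_def mult.assoc)
    ultimately have "u0 * (a + b) = log 2 N * (d * \<tau>)" by (simp only:)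
    then show ?thesis unfolding N2 by simp
  qed
  have D: "1 \<le> (2::real) powr p" "(2::real) powr p \<le> 2 powr (2 * p)" using p by (auto simp: ge_one_powr_ge_zero)
  have key: "2 powr (- u) * (T / N) \<le> (1 + C) * 2 powr (2 * p) * (2 powr (- u0 * b) * 2 powr (- c * \<bar>u - u0\<bar>)) * \<psi>"
  proof (cases "u \<ge> u0")
    case True
    have "T / N \<le> m" using T(1) N by (simp add: field_simps)
    then have "2 powr (- u) * (T / N) \<le> 2 powr (- u) * (2 powr p * 2 powr (u * p / 2) * \<psi>)"
      using m by (intro mult_left_mono) (auto simp: \<psi>_def)
    also have "\<dots> = 2 powr p * (2 powr (- u) * 2 powr (u * p / 2)) * \<psi>" by simp
    also have "2 powr (- u) * 2 powr (u * p / 2) = 2 powr (- u0 * b + - b * (u - u0))"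
      unfolding powr_add[symmetric] by (simp add: b_def algebra_simps diff_divide_distrib)
    also have "\<dots> = 2 powr (- u0 * b) * 2 powr (- b * (u - u0))" by (rule powr_add)
    also have "2 powr p * (2 powr (- u0 * b) * 2 powr (- b * (u - u0))) * \<psi> \<le>
       ((1 + C) * 2 powr (2 * p)) * (2 powr (- u0 * b) * 2 powr (- c * \<bar>u - u0\<bar>)) * \<psi>"
    proof (intro mult_right_mono mult_mono mult_left_mono)
      have "1 * 2 powr p \<le> (1 + C) * 2 powr (2 * p)" using D C by (intro mult_mono) auto
      then show "2 powr p \<le> (1 + C) * 2 powr (2 * p)" by simp
      show "2 powr (- b * (u - u0)) \<le> (2::real) powr (- c * \<bar>u - u0\<bar>)"
        using True ab by (intro powr_mono) (auto intro: mult_right_mono)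
    qed (use psi C in auto)
    finally show ?thesis .
  next
    case False
    have "T / N \<le> C * N powr (- d * \<tau>) * m powr (1 + \<tau>)" using T(2) N by (simp add: field_simps)
    also have "\<dots> \<le> C * N powr (- d * \<tau>) * (2 powr p * 2 powr (u * p / 2) * \<psi>) powr (1 + \<tau>)"
      using m C tau by (intro mult_left_mono powr_mono2) (auto simp: \<psi>_def)
    also have "(2 powr p * 2 powr (u * p / 2) * \<psi>) powr (1 + \<tau>) =
        2 powr (p * (1 + \<tau>)) * 2 powr (u * p / 2 * (1 + \<tau>)) * \<psi> powr (1 + \<tau>)"
      using psi by (simp add: powr_mult powr_powr)
    also have "C * N powr (- d * \<tau>) * (2 powr (p * (1 + \<tau>)) * 2 powr (u * p / 2 * (1 + \<tau>)) * \<psi> powr (1 + \<tau>)) \<le>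
       C * N powr (- d * \<tau>) * (2 powr (2 * p) * 2 powr (u * p / 2 * (1 + \<tau>)) * \<psi>)"
    proof (intro mult_left_mono mult_mono)
      have "p * (1 + \<tau>) \<le> p * 2" using p tau by (intro mult_left_mono) auto
      then show "2 powr (p * (1 + \<tau>)) \<le> (2::real) powr (2 * p)" by (simp add: mult.commute)
      have "\<psi> powr (1 + \<tau>) \<le> \<psi> powr 1" using psi tau by (intro powr_mono') auto
      then show "\<psi> powr (1 + \<tau>) \<le> \<psi>" using psi by simp
    qed (use psi C in auto)
    finally have "2 powr (- u) * (T / N) \<le>
        2 powr (- u) * (C * N powr (- d * \<tau>) * (2 powr (2 * p) * 2 powr (u * p / 2 * (1 + \<tau>)) * \<psi>))"
      by (intro mult_left_mono) auto
    also have "\<dots> = (C * 2 powr (2 * p)) * (2 powr (- u) * (N powr (- d * \<tau>) * 2 powr (u * p / 2 * (1 + \<tau>)))) * \<psi>"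
      by (simp add: mult_ac)
    also have "2 powr (- u) * (N powr (- d * \<tau>) * 2 powr (u * p / 2 * (1 + \<tau>))) =
        2 powr (- u0 * b + - a * (u0 - u))"
      unfolding e2 powr_add[symmetric] by (simp add: a_def algebra_simps add_divide_distrib diff_divide_distrib)
    also have "\<dots> = 2 powr (- u0 * b) * 2 powr (- a * (u0 - u))" by (rule powr_add)
    also have "(C * 2 powr (2 * p)) * (2 powr (- u0 * b) * 2 powr (- a * (u0 - u))) * \<psi> \<le>
       ((1 + C) * 2 powr (2 * p)) * (2 powr (- u0 * b) * 2 powr (- c * \<bar>u - u0\<bar>)) * \<psi>"
    proof (intro mult_right_mono mult_mono mult_left_mono)
      show "2 powr (- a * (u0 - u)) \<le> (2::real) powr (- c * \<bar>u - u0\<bar>)"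
        using False ab by (intro powr_mono) (auto intro: mult_right_mono)
    qed (use psi C in auto)
    finally show ?thesis .
  qed
  also have "\<dots> \<le> (1 + C) * 2 powr (2 * p) * (2 powr (- u0 * b) * 2 powr (- c * \<bar>u - u0\<bar>)) * ((\<phi> + \<gamma>) / 2)"
    using psi C by (intro mult_left_mono) auto
  also have "\<dots> = (1 + C) * 2 powr (2 * p) * N powr (d * (1 - 2 / p)) *
     ((2 powr (- c)) powr \<bar>u - u0\<bar> * ((\<phi> + \<gamma>) / 2))"
    by (simp add: e1 powr_powr mult_ac)
  finally show ?thesis by (simp add: c_def a_def b_def u0_def)
qed

text \<open>The pair bound decays geometrically in |i + j - u0|. For fixed i this is a two-sided
  geometric series in j, and conversely. Since the masses of the levels enter additively and total
  at most 1 for each function, the double sum is bounded by one such series, uniformly in N.\<close>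

lemma bilinear_estimate_below_two:
  assumes "d \<ge> 3" "p_tilde d < p" "p < 2"
  obtains C where "C > 0" "\<And>N f g U V. N \<ge> 1 \<Longrightarrow> finite U \<Longrightarrow> finite V \<Longrightarrow>
    (\<And>x. f x \<ge> 0) \<Longrightarrow> (\<And>x. g x \<ge> 0) \<Longrightarrow> (\<And>x. x \<notin> U \<Longrightarrow> f x = 0) \<Longrightarrow>
    (\<Sum>x\<in>U. f x powr p) \<le> 1 \<Longrightarrow> (\<Sum>x\<in>V. g x powr p) \<le> 1 \<Longrightarrow>
    (\<Sum>x\<in>V. g x * avg_op d N f x) \<le> C * real N powr (real d * (1 - 2 / p))"
proof -
  define r where "r = d * (2 ^ (d - 1) + 1)"
  define \<tau> where "\<tau> = 1 / real r"
  have r3: "r \<ge> 3" using assms by (simp add: r_def)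
  have tau: "0 < \<tau>" "\<tau> \<le> 1" using r3 by (auto simp: \<tau>_def)
  \<comment> \<open>From 2 ^ d + 2 = 2 * (2 ^ (d - 1) + 1), the denominator in
    \<open>p_tilde\<close> is 2 * (1 + r).\<close>
  have pt: "p_tilde d = 2 * real r / (1 + real r)"
  proof -
    have "(2::real) ^ d = 2 * 2 ^ (d - 1)" using assms by (cases d) auto
    then have "2 + real d * (2 ^ d + 2) = 2 * (1 + real r)" by (simp add: r_def algebra_simps)
    then show ?thesis by (simp add: p_tilde_def field_simps)
  qed
  have pr: "2 * real r < p * (1 + real r)"
    using assms(2) unfolding pt by (simp add: divide_less_eq add_pos_nonneg)
  have a0: "0 < p * (1 + \<tau>) / 2 - 1"
    using pr r3 by (simp add: \<tau>_def field_simps)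
  have p1: "1 \<le> p"
  proof -
    have "1 \<le> 2 * real r / (1 + real r)" using r3 by (simp add: le_divide_eq)
    then show ?thesis using assms(2) pt by linarith
  qed
  obtain C0 where C0: "C0 > 0" "\<And>N F G. N \<ge> 1 \<Longrightarrow> finite F \<Longrightarrow> finite G \<Longrightarrow>
     real (card {(x, k). x \<in> G \<and> k \<in> {1..N} \<and> x + int k ^ d \<in> F}) ^ r
       \<le> C0 * (real N ^ r / real N ^ d) * sqrt (real (card F) * real (card G)) ^ (r + 1)"
    using card_power_translates_le[OF assms(1) r_def] by blast
  define C1 where "C1 = C0 powr \<tau>"
  define z :: real where "z = 2 powr (- min (p * (1 + \<tau>) / 2 - 1) (1 - p / 2))"
  have z: "0 < z" "z < 1"
  proof -
    have "min (p * (1 + \<tau>) / 2 - 1) (1 - p / 2) > 0" using a0 assms by simp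
    then show "z < 1"
      using powr_less_mono[of "- min (p * (1 + \<tau>) / 2 - 1) (1 - p / 2)" 0 2] by (simp add: z_def)
  qed (simp add: z_def)
  define D where "D = (1 + C1) * 2 powr (2 * p)"
  have D0: "D > 0" by (simp add: D_def C1_def add_pos_nonneg)
  show ?thesis
  proof (rule that[of "D * (2 / (1 - z))"])
    show "D * (2 / (1 - z)) > 0" using D0 z by simp
    fix N :: nat and f g :: "int \<Rightarrow> real" and U V :: "int set"
    assume N: "N \<ge> 1" and U: "finite U" and V: "finite V" and f0: "\<And>x. f x \<ge> 0" and g0: "\<And>x. g x \<ge> 0"
      and fU: "\<And>x. x \<notin> U \<Longrightarrow> f x = 0"
      and fn: "(\<Sum>x\<in>U. f x powr p) \<le> 1" and gn: "(\<Sum>x\<in>V. g x powr p) \<le> 1"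
    have fUD: "x \<in> U" if "f x \<noteq> 0" for x using fU that by blast
    \<comment> \<open>Zeros are removed before decomposing, because \<open>dyadic_level\<close> is
      meaningful only for positive values.\<close>
    define U' where "U' = {x\<in>U. f x > 0}"
    define V' where "V' = {x\<in>V. g x > 0}"
    have fin: "finite U'" "finite V'" using U V by (auto simp: U'_def V'_def)
    define F where "F i = {y\<in>U'. dyadic_level (f y) = i}" for i
    define G where "G j = {x\<in>V'. dyadic_level (g x) = j}" for j
    define I where "I = (\<lambda>y. dyadic_level (f y)) ` U'"
    define J where "J = (\<lambda>x. dyadic_level (g x)) ` V'"
    define \<phi> where "\<phi> i = (\<Sum>y\<in>F i. f y powr p)" for i
    define \<gamma> where "\<gamma> j = (\<Sum>x\<in>G j. g x powr p)" for j
    define T where "T i j = card {(x, k). x \<in> G j \<and> k \<in> {1..N} \<and> x + int k ^ d \<in> F i}" for i j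
    define u0 where "u0 = log 2 (real N) * (2 * real d / p)"
    define E where "E = real N powr (real d * (1 - 2 / p))"
    have finIJ: "finite I" "finite J" "finite (F i)" "finite (G j)" for i j
      using fin by (auto simp: I_def J_def F_def G_def)
    have sum\<phi>: "(\<Sum>i\<in>I. \<phi> i) \<le> 1"
    proof -
      have "(\<Sum>i\<in>I. \<phi> i) = (\<Sum>y\<in>U'. f y powr p)"
        unfolding \<phi>_def F_def by (rule sum.group) (use fin finIJ in \<open>auto simp: I_def\<close>)
      also have "\<dots> \<le> (\<Sum>x\<in>U. f x powr p)" by (intro sum_mono2) (auto simp: U'_def U)
      finally show ?thesis using fn by linarith
    qed
    have sum\<gamma>: "(\<Sum>j\<in>J. \<gamma> j) \<le> 1"
    proof -
      have "(\<Sum>j\<in>J. \<gamma> j) = (\<Sum>y\<in>V'. g y powr p)"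
        unfolding \<gamma>_def G_def by (rule sum.group) (use fin finIJ in \<open>auto simp: J_def\<close>)
      also have "\<dots> \<le> (\<Sum>x\<in>V. g x powr p)" by (intro sum_mono2) (auto simp: V'_def V)
      finally show ?thesis using gn by linarith
    qed
    have \<phi>0: "0 \<le> \<phi> i" and \<gamma>0: "0 \<le> \<gamma> i" for i by (auto simp: \<phi>_def \<gamma>_def intro!: sum_nonneg)
    have \<phi>1: "\<phi> i \<le> 1" if "i \<in> I" for i
      using member_le_sum[OF that, of \<phi>] \<phi>0 finIJ sum\<phi> by fastforce
    have \<gamma>1: "\<gamma> j \<le> 1" if "j \<in> J" for j
      using member_le_sum[OF that, of \<gamma>] \<gamma>0 finIJ sum\<gamma> by fastforce
    have pair: "2 powr (- of_int i) * 2 powr (- of_int j) * (real (T i j) / real N) \<le>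
        D * E * (z powr \<bar>of_int i + of_int j - u0\<bar> * ((\<phi> i + \<gamma> j) / 2))"
      if i: "i \<in> I" and j: "j \<in> J" for i j
    proof -
      define m where "m = sqrt (real (card (F i)) * real (card (G j)))"
      have m0: "m \<ge> 0" by (simp add: m_def)
      have cF: "real (card (F i)) \<le> 2 powr ((of_int i + 1) * p) * \<phi> i"
        unfolding \<phi>_def using p1 finIJ by (intro card_level_set_le) (auto simp: F_def U'_def)
      have cG: "real (card (G j)) \<le> 2 powr ((of_int j + 1) * p) * \<gamma> j"
        unfolding \<gamma>_def using p1 finIJ by (intro card_level_set_le) (auto simp: G_def V'_def)
      have mle: "m \<le> 2 powr p * 2 powr ((of_int i + of_int j) * p / 2) * sqrt (\<phi> i * \<gamma> j)"
      proof -
        let ?h = "(2::real) powr p * 2 powr ((of_int i + of_int j) * p / 2)"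
        have "real (card (F i)) * real (card (G j)) \<le>
            (2 powr ((of_int i + 1) * p) * \<phi> i) * (2 powr ((of_int j + 1) * p) * \<gamma> j)"
          using \<phi>0 by (intro mult_mono cF cG) auto
        also have "\<dots> = (2 powr ((of_int i + 1) * p) * 2 powr ((of_int j + 1) * p)) * (\<phi> i * \<gamma> j)" by simp
        also have "2 powr ((of_int i + 1) * p) * 2 powr ((of_int j + 1) * p) = ?h\<^sup>2"
          unfolding power2_eq_square powr_add[symmetric] by (simp add: algebra_simps add_divide_distrib)
        finally have "m \<le> sqrt (?h\<^sup>2 * (\<phi> i * \<gamma> j))" unfolding m_def by (rule real_sqrt_le_mono)
        also have "\<dots> = ?h * sqrt (\<phi> i * \<gamma> j)" by (simp add: real_sqrt_mult)
        finally show ?thesis .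
      qed
      have T1: "real (T i j) \<le> real N * m"
        unfolding T_def m_def by (rule card_power_translates_trivial[OF finIJ(3,4)])
      \<comment> \<open>The r-th root of the counting bound, with \<tau> = 1 / r.\<close>
      have T2: "real (T i j) \<le> C1 * real N * real N powr (- real d * \<tau>) * m powr (1 + \<tau>)"
      proof -
        have "real (T i j) ^ r \<le> C0 * (real N ^ r / real N ^ d) * m ^ (r + 1)"
          unfolding T_def m_def by (rule C0(2)[OF N finIJ(3,4)])
        then have "(real (T i j) ^ r) powr \<tau> \<le> (C0 * (real N ^ r / real N ^ d) * m ^ (r + 1)) powr \<tau>"
          using tau by (intro powr_mono2) auto
        also have "(real (T i j) ^ r) powr \<tau> = real (T i j)"
        proof -
          have "real (T i j) ^ 1 = (real (T i j) ^ r) powr (real 1 / real r)"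
            using r3 by (intro power_eq_powr_of_power) auto
          then show ?thesis by (simp add: \<tau>_def)
        qed
        also have "(C0 * (real N ^ r / real N ^ d) * m ^ (r + 1)) powr \<tau> =
            C1 * ((real N ^ r) powr \<tau> / (real N ^ d) powr \<tau>) * (m ^ (r + 1)) powr \<tau>"
          using C0(1) m0 by (simp add: powr_mult powr_divide C1_def)
        also have "(real N ^ r) powr \<tau> = real N"
          using N r3 by (simp add: \<tau>_def powr_powr flip: powr_realpow)
        also have "(real N ^ d) powr \<tau> = real N powr (real d * \<tau>)"
          using N by (simp add: powr_powr flip: powr_realpow)
        also have "(m ^ (r + 1)) powr \<tau> = m powr (1 + \<tau>)"
        proof (cases "m = 0")
          case False
          then have "(m ^ (r + 1)) powr \<tau> = m powr (real (r + 1) * \<tau>)"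
            using m0 by (simp add: powr_powr flip: powr_realpow del: power_Suc)
          also have "real (r + 1) * \<tau> = 1 + \<tau>" using r3 by (simp add: \<tau>_def field_simps)
          finally show ?thesis .
        qed auto
        finally show ?thesis by (simp add: powr_minus_divide)
      qed
      have "2 powr (- (of_int i + of_int j)) * (real (T i j) / real N) \<le>
        (1 + C1) * 2 powr (2 * p) * real N powr (real d * (1 - 2 / p)) *
        ((2 powr (- min (p * (1 + \<tau>) / 2 - 1) (1 - p / 2))) powr
          \<bar>(of_int i + of_int j) - log 2 (real N) * (2 * real d / p)\<bar> * ((\<phi> i + \<gamma> j) / 2))"
        by (rule dyadic_pair_bound[OF p1 assms(3) a0 tau _ _ m0 mle T1 T2 \<phi>0 \<phi>1[OF i] \<gamma>0 \<gamma>1[OF j]])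
          (use N in \<open>auto simp: C1_def\<close>)
      moreover have "2 powr (- (of_int i + of_int j)) = 2 powr (- of_int i) * (2 powr (- of_int j) :: real)"
        by (simp flip: powr_add)
      ultimately show ?thesis by (simp add: D_def E_def z_def u0_def)
    qed
    define \<Omega> where "\<Omega> = {(x, k). x \<in> V' \<and> k \<in> {1..N} \<and> x + int k ^ d \<in> U'}"
    have fin\<Omega>: "finite \<Omega>"
      by (rule finite_subset[of _ "V' \<times> {1..N}"]) (use fin in \<open>auto simp: \<Omega>_def\<close>)
    define lev where "lev = (\<lambda>(x, k). (dyadic_level (f (x + int k ^ d)), dyadic_level (g x)))"
    have "(\<Sum>x\<in>V. g x * avg_op d N f x) = (\<Sum>x\<in>V. \<Sum>k\<in>{1..N}. g x * f (x + int k ^ d)) / real N"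
      by (simp add: avg_op_def sum_distrib_left sum_divide_distrib)
    also have "(\<Sum>x\<in>V. \<Sum>k\<in>{1..N}. g x * f (x + int k ^ d)) = (\<Sum>(x, k)\<in>V \<times> {1..N}. g x * f (x + int k ^ d))"
      by (simp add: sum.cartesian_product)
    also have "\<dots> = (\<Sum>(x, k)\<in>\<Omega>. g x * f (x + int k ^ d))"
    proof (rule sum.mono_neutral_right)
      show "\<forall>z\<in>V \<times> {1..N} - \<Omega>. (case z of (x, k) \<Rightarrow> g x * f (x + int k ^ d)) = 0"
        using f0 g0 by (auto simp: \<Omega>_def V'_def U'_def less_le intro: fUD)
    qed (use V in \<open>auto simp: \<Omega>_def V'_def\<close>)
    also have "\<dots> \<le> (\<Sum>w\<in>\<Omega>. 2 powr (- of_int (fst (lev w))) * 2 powr (- of_int (snd (lev w))))"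
    proof (intro sum_mono)
      fix w assume w: "w \<in> \<Omega>"
      obtain x k where xk: "w = (x, k)" by (cases w)
      have pos: "g x > 0" "f (x + int k ^ d) > 0" using w by (auto simp: xk \<Omega>_def V'_def U'_def)
      have "f (x + int k ^ d) * g x \<le> 2 powr (- of_int (dyadic_level (f (x + int k ^ d)))) * 2 powr (- of_int (dyadic_level (g x)))"
        using pos by (intro mult_mono dyadic_level_bounds) auto
      then show "(case w of (x, k) \<Rightarrow> g x * f (x + int k ^ d)) \<le>
          2 powr (- of_int (fst (lev w))) * 2 powr (- of_int (snd (lev w)))"
        by (simp add: xk lev_def mult.commute)
    qed
    also have "\<dots> = (\<Sum>ij\<in>I \<times> J. \<Sum>w\<in>{w\<in>\<Omega>. lev w = ij}. 2 powr (- of_int (fst (lev w))) * 2 powr (- of_int (snd (lev w))))"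
      by (rule sum.group[symmetric]) (use fin\<Omega> finIJ in \<open>auto simp: lev_def \<Omega>_def I_def J_def\<close>)
    also have "\<dots> = (\<Sum>(i, j)\<in>I \<times> J. 2 powr (- of_int i) * 2 powr (- of_int j) * real (T i j))"
    proof (intro sum.cong refl)
      fix ij assume "ij \<in> I \<times> J"
      obtain i j where ij: "ij = (i, j)" by (cases ij)
      have "{w\<in>\<Omega>. lev w = ij} = {(x, k). x \<in> G j \<and> k \<in> {1..N} \<and> x + int k ^ d \<in> F i}"
        by (auto simp: \<Omega>_def lev_def ij F_def G_def)
      moreover have "(\<Sum>w\<in>{w\<in>\<Omega>. lev w = ij}. 2 powr (- of_int (fst (lev w))) * 2 powr (- of_int (snd (lev w)))) =
          (\<Sum>w\<in>{w\<in>\<Omega>. lev w = ij}. 2 powr (- of_int i) * (2 powr (- of_int j) :: real))"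
        by (intro sum.cong refl) (auto simp: ij)
      ultimately show "(\<Sum>w\<in>{w\<in>\<Omega>. lev w = ij}. 2 powr (- of_int (fst (lev w))) * 2 powr (- of_int (snd (lev w)))) =
         (case ij of (i, j) \<Rightarrow> 2 powr (- of_int i) * 2 powr (- of_int j) * real (T i j))"
        by (simp add: ij T_def)
    qed
    finally have "(\<Sum>x\<in>V. g x * avg_op d N f x) \<le>
        (\<Sum>(i, j)\<in>I \<times> J. 2 powr (- of_int i) * 2 powr (- of_int j) * real (T i j)) / real N"
      by (simp add: divide_right_mono)
    also have "\<dots> = (\<Sum>i\<in>I. \<Sum>j\<in>J. 2 powr (- of_int i) * 2 powr (- of_int j) * (real (T i j) / real N))"
      by (simp add: sum_divide_distrib sum.cartesian_product case_prod_unfold)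
    also have "\<dots> \<le> (\<Sum>i\<in>I. \<Sum>j\<in>J. D * E * (z powr \<bar>of_int i + of_int j - u0\<bar> * ((\<phi> i + \<gamma> j) / 2)))"
      by (intro sum_mono pair)
    also have "\<dots> = D * E * (\<Sum>i\<in>I. \<Sum>j\<in>J. z powr \<bar>of_int i + of_int j - u0\<bar> * ((\<phi> i + \<gamma> j) / 2))"
      by (simp only: sum_distrib_left)
    also have "\<dots> \<le> D * E * (2 / (1 - z))"
    proof (intro mult_left_mono)
      let ?K = "2 / (1 - z)"
      have K0: "?K \<ge> 0" using z by simp
      have "(\<Sum>i\<in>I. \<Sum>j\<in>J. z powr \<bar>of_int i + of_int j - u0\<bar> * ((\<phi> i + \<gamma> j) / 2)) =
        (\<Sum>i\<in>I. \<phi> i / 2 * (\<Sum>j\<in>J. z powr \<bar>of_int j - (u0 - of_int i)\<bar>)) +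
        (\<Sum>j\<in>J. \<gamma> j / 2 * (\<Sum>i\<in>I. z powr \<bar>of_int i - (u0 - of_int j)\<bar>))"
      proof -
        have "(\<Sum>j\<in>J. \<gamma> j / 2 * (\<Sum>i\<in>I. z powr \<bar>of_int i - (u0 - of_int j)\<bar>)) =
            (\<Sum>i\<in>I. \<Sum>j\<in>J. \<gamma> j / 2 * z powr \<bar>of_int i - (u0 - of_int j)\<bar>)"
          unfolding sum_distrib_left by (rule sum.swap)
        then show ?thesis
          by (simp add: sum_distrib_left sum.distrib[symmetric] algebra_simps add_divide_distrib)
      qed
      also have "\<dots> \<le> (\<Sum>i\<in>I. \<phi> i / 2 * ?K) + (\<Sum>j\<in>J. \<gamma> j / 2 * ?K)"
        using \<phi>0 \<gamma>0 finIJ z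
        by (intro add_mono sum_mono mult_left_mono sum_two_sided_geometric_le) auto
      also have "\<dots> = ((\<Sum>i\<in>I. \<phi> i) / 2 + (\<Sum>j\<in>J. \<gamma> j) / 2) * ?K"
        by (simp only: sum_distrib_right[symmetric] sum_divide_distrib[symmetric] distrib_right)
      also have "\<dots> \<le> 1 * ?K" using sum\<phi> sum\<gamma> K0 by (intro mult_right_mono) auto
      finally show "(\<Sum>i\<in>I. \<Sum>j\<in>J. z powr \<bar>of_int i + of_int j - u0\<bar> * ((\<phi> i + \<gamma> j) / 2)) \<le> ?K" by simp
    qed (use D0 in \<open>auto simp: E_def\<close>)
    finally show "(\<Sum>x\<in>V. g x * avg_op d N f x) \<le> D * (2 / (1 - z)) * real N powr (real d * (1 - 2 / p))"
      by (simp add: E_def mult_ac)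
  qed
qed

text \<open>At p = 2 the decay rate 1 - p / 2 of the trivial bound vanishes, so dyadic summation
  gives no convergent series. But N has exponent 0 there, and x * y \<le> (x ^ 2 + y ^ 2) / 2
  suffices for each single translate.\<close>

lemma bilinear_estimate_two:
  fixes f g :: "int \<Rightarrow> real"
  assumes "N \<ge> 1" "finite U" "finite V"
    "\<And>x. f x \<ge> 0" "\<And>x. g x \<ge> 0" "\<And>x. x \<notin> U \<Longrightarrow> f x = 0"
    "(\<Sum>x\<in>U. f x powr 2) \<le> 1" "(\<Sum>x\<in>V. g x powr 2) \<le> 1"
  shows "(\<Sum>x\<in>V. g x * avg_op d N f x) \<le> 1"
proof -
  have row: "(\<Sum>x\<in>V. g x * f (x + int k ^ d)) \<le> 1" for k :: nat
  proof -
    have "(\<Sum>x\<in>V. g x * f (x + int k ^ d)) \<le> (\<Sum>x\<in>V. (g x powr 2 + f (x + int k ^ d) powr 2) / 2)"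
    proof (intro sum_mono)
      fix x
      have "0 \<le> (g x - f (x + int k ^ d))\<^sup>2" by simp
      then show "g x * f (x + int k ^ d) \<le> (g x powr 2 + f (x + int k ^ d) powr 2) / 2"
        using assms(4,5) by (simp add: power2_eq_square algebra_simps)
    qed
    also have "\<dots> = ((\<Sum>x\<in>V. g x powr 2) + (\<Sum>x\<in>V. f (x + int k ^ d) powr 2)) / 2"
      by (simp only: sum.distrib[symmetric] sum_divide_distrib)
    also have "\<dots> \<le> (1 + 1) / 2"
    proof (intro divide_right_mono add_mono assms(8))
      have "(\<Sum>x\<in>V. f (x + int k ^ d) powr 2) = (\<Sum>y\<in>(\<lambda>x. x + int k ^ d) ` V. f y powr 2)"
        by (subst sum.reindex) (auto simp: inj_on_def)
      also have "\<dots> = (\<Sum>y\<in>(\<lambda>x. x + int k ^ d) ` V \<inter> U. f y powr 2)"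
        using assms(3,6) by (intro sum.mono_neutral_right) auto
      also have "\<dots> \<le> (\<Sum>y\<in>U. f y powr 2)" using assms(2) by (intro sum_mono2) auto
      finally show "(\<Sum>x\<in>V. f (x + int k ^ d) powr 2) \<le> 1" using assms(7) by linarith
    qed simp
    finally show ?thesis by simp
  qed
  have "(\<Sum>x\<in>V. g x * avg_op d N f x) = (\<Sum>k = 1..N. \<Sum>x\<in>V. g x * f (x + int k ^ d)) / real N"
    unfolding avg_op_def by (subst sum.swap) (simp add: sum_distrib_left sum_divide_distrib)
  also have "\<dots> \<le> (\<Sum>k = 1..N. 1) / real N" by (intro divide_right_mono sum_mono row) auto
  also have "\<dots> = 1" using assms(1) by simp
  finally show ?thesis .
qed

section \<open>Homogeneity and duality\<close>

lemma bilinear_estimate: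
  assumes "d \<ge> 3" "p_tilde d < p" "p \<le> 2"
  obtains C where "C > 0" "\<And>N f g U V A B. N \<ge> 1 \<Longrightarrow> finite U \<Longrightarrow> finite V \<Longrightarrow>
    (\<And>x. f x \<ge> 0) \<Longrightarrow> (\<And>x. g x \<ge> 0) \<Longrightarrow> (\<And>x. x \<notin> U \<Longrightarrow> f x = 0) \<Longrightarrow> A > 0 \<Longrightarrow> B > 0 \<Longrightarrow>
    (\<Sum>x\<in>U. f x powr p) \<le> A \<Longrightarrow> (\<Sum>x\<in>V. g x powr p) \<le> B \<Longrightarrow>
    (\<Sum>x\<in>V. g x * avg_op d N f x) \<le> C * real N powr (real d * (1 - 2 / p)) * A powr (1 / p) * B powr (1 / p)"
proof -
  have p0: "p > 0"
  proof -
    have "4 / (2 + real d * (2 ^ d + 2)) \<le> 4 / 2" by (intro divide_left_mono mult_pos_pos add_pos_nonneg) auto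
    then show ?thesis using assms(2) by (simp add: p_tilde_def)
  qed
  obtain C where C: "C > 0" "\<And>N f g U V. N \<ge> 1 \<Longrightarrow> finite U \<Longrightarrow> finite V \<Longrightarrow>
    (\<And>x. f x \<ge> 0) \<Longrightarrow> (\<And>x. g x \<ge> 0) \<Longrightarrow> (\<And>x. x \<notin> U \<Longrightarrow> f x = 0) \<Longrightarrow>
    (\<Sum>x\<in>U. f x powr p) \<le> 1 \<Longrightarrow> (\<Sum>x\<in>V. g x powr p) \<le> 1 \<Longrightarrow>
    (\<Sum>x\<in>V. g x * avg_op d N f x) \<le> C * real N powr (real d * (1 - 2 / p))"
  proof (cases "p = 2")
    case True
    show ?thesis
    proof (rule that[of 1])
      fix N :: nat and f g :: "int \<Rightarrow> real" and U V :: "int set"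
      assume "N \<ge> 1" "finite U" "finite V" "\<And>x. f x \<ge> 0" "\<And>x. g x \<ge> 0" "\<And>x. x \<notin> U \<Longrightarrow> f x = 0"
        "(\<Sum>x\<in>U. f x powr p) \<le> 1" "(\<Sum>x\<in>V. g x powr p) \<le> 1"
      then show "(\<Sum>x\<in>V. g x * avg_op d N f x) \<le> 1 * real N powr (real d * (1 - 2 / p))"
        using bilinear_estimate_two[of N U V f g d] by (simp add: True)
    qed simp
  next
    case False
    then have "p < 2" using assms by simp
    from bilinear_estimate_below_two[OF assms(1,2) this] show ?thesis using that by blast
  qed
  show ?thesis
  proof (rule that[OF C(1)])
    fix N :: nat and f g :: "int \<Rightarrow> real" and U V :: "int set" and A B :: real
    assume N: "N \<ge> 1" and U: "finite U" and V: "finite V" and f0: "\<And>x. f x \<ge> 0" and g0: "\<And>x. g x \<ge> 0"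
      and fU: "\<And>x. x \<notin> U \<Longrightarrow> f x = 0" and A: "A > 0" and B: "B > 0"
      and fn: "(\<Sum>x\<in>U. f x powr p) \<le> A" and gn: "(\<Sum>x\<in>V. g x powr p) \<le> B"
    \<comment> \<open>Rescaling by the p-th roots reduces to the normalised case. Taking upper
      bounds \<open>A\<close> and \<open>B\<close> instead of exact sums lets the infinite norm of f
      be inserted later.\<close>
    define a where "a = A powr (1 / p)"
    define b where "b = B powr (1 / p)"
    have ab: "a > 0" "b > 0" "a powr p = A" "b powr p = B"
      using A B p0 by (auto simp: a_def b_def powr_powr)
    have "(\<Sum>x\<in>V. g x / b * avg_op d N (\<lambda>y. f y / a) x) \<le> C * real N powr (real d * (1 - 2 / p))"
    proof (rule C(2)[OF N U V])
      have "(\<Sum>x\<in>U. (f x / a) powr p) = (\<Sum>x\<in>U. f x powr p) / A"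
        using f0 ab by (simp add: powr_divide sum_divide_distrib)
      then show "(\<Sum>x\<in>U. (f x / a) powr p) \<le> 1" using fn A by simp
      have "(\<Sum>x\<in>V. (g x / b) powr p) = (\<Sum>x\<in>V. g x powr p) / B"
        using g0 ab by (simp add: powr_divide sum_divide_distrib)
      then show "(\<Sum>x\<in>V. (g x / b) powr p) \<le> 1" using gn B by simp
    qed (use f0 g0 fU ab in auto)
    moreover have "(\<Sum>x\<in>V. g x / b * avg_op d N (\<lambda>y. f y / a) x) = (\<Sum>x\<in>V. g x * avg_op d N f x) / (a * b)"
      by (simp add: avg_op_def sum_divide_distrib[symmetric] mult_ac)
    ultimately have "(\<Sum>x\<in>V. g x * avg_op d N f x) / (a * b) \<le> C * real N powr (real d * (1 - 2 / p))"
      by simp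
    then show "(\<Sum>x\<in>V. g x * avg_op d N f x) \<le>
        C * real N powr (real d * (1 - 2 / p)) * A powr (1 / p) * B powr (1 / p)"
      using ab unfolding a_def[symmetric] b_def[symmetric] by (simp add: pos_divide_le_eq mult.assoc)
  qed
qed

text \<open>Duality on finite sets: testing the averages of |f| against their own power s - 1 bounds
  the finite sum H of their s-th powers by L * H powr (1 / p). As H is finite it can be divided out,
  and the resulting bound is the same for every finite set, which yields summability and the norm
  inequality together.\<close>

theorem theorem3:
  fixes d :: nat and p :: real
  assumes "d > 2" and "p_tilde d < p" and "p \<le> 2"
  shows "\<exists>C>0. \<forall>N::nat. \<forall>f::int \<Rightarrow> real. N \<ge> 1 \<longrightarrow> in_lp p f \<longrightarrow>
           in_lp (conj_exp p) (avg_op d N f) \<and>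
           lp_norm (conj_exp p) (avg_op d N f)
             \<le> C * real N powr (real d / conj_exp p - real d / p) * lp_norm p f"
proof -
  have d3: "d \<ge> 3" using assms by simp
  have p1: "p > 1"
  proof -
    have "real d * (2 ^ d + 2) \<ge> 3 * 2" using d3 by (intro mult_mono) auto
    then have "4 / (2 + real d * (2 ^ d + 2)) \<le> 4 / 8" by (intro divide_left_mono mult_pos_pos add_pos_nonneg) auto
    then show ?thesis using assms(2) by (simp add: p_tilde_def)
  qed
  define s where "s = conj_exp p"
  have s1: "s > 1" "1 / p + 1 / s = 1" "(s - 1) * p = s"
    using p1 by (auto simp: s_def conj_exp_def field_simps)
  have expo: "real d * (1 - 2 / p) = real d / s - real d / p"
  proof -
    have "1 / s = 1 - 1 / p" using s1(2) by linarith
    then have "real d / s = real d * (1 - 1 / p)" by (metis mult.right_neutral times_divide_eq_right)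
    then show ?thesis by (simp add: algebra_simps)
  qed
  obtain C where C: "C > 0" "\<And>N f g U V A B. N \<ge> 1 \<Longrightarrow> finite U \<Longrightarrow> finite V \<Longrightarrow>
    (\<And>x. f x \<ge> 0) \<Longrightarrow> (\<And>x. g x \<ge> 0) \<Longrightarrow> (\<And>x. x \<notin> U \<Longrightarrow> f x = 0) \<Longrightarrow> A > 0 \<Longrightarrow> B > 0 \<Longrightarrow>
    (\<Sum>x\<in>U. f x powr p) \<le> A \<Longrightarrow> (\<Sum>x\<in>V. g x powr p) \<le> B \<Longrightarrow>
    (\<Sum>x\<in>V. g x * avg_op d N f x) \<le> C * real N powr (real d / s - real d / p) * A powr (1 / p) * B powr (1 / p)"
    using bilinear_estimate[OF d3 assms(2,3)] unfolding expo by blast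
  show ?thesis
  proof (intro exI[of _ C] conjI allI impI C(1), fold s_def)
    fix N :: nat and f :: "int \<Rightarrow> real"
    assume N: "N \<ge> 1" and f: "in_lp p f"
    define \<Phi> where "\<Phi> = (\<Sum>\<^sub>\<infinity>x\<in>UNIV. \<bar>f x\<bar> powr p)"
    define L where "L = C * real N powr (real d / s - real d / p) * \<Phi> powr (1 / p)"
    have summ: "(\<lambda>x. \<bar>f x\<bar> powr p) summable_on UNIV" using f by (simp add: in_lp_def)
    have \<Phi>0: "\<Phi> \<ge> 0" unfolding \<Phi>_def by (intro infsum_nonneg) auto
    have L0: "L \<ge> 0" using C(1) by (simp add: L_def)
    have fin\<Phi>: "(\<Sum>x\<in>U. \<bar>f x\<bar> powr p) \<le> \<Phi>" if "finite U" for U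
      unfolding \<Phi>_def using summ that by (intro finite_sum_le_infsum) auto
    have bound: "(\<Sum>x\<in>E. \<bar>avg_op d N f x\<bar> powr s) \<le> L powr s" if E: "finite E" for E
    proof -
      \<comment> \<open>Passing to |f| makes all functions nonnegative, as the bilinear estimate
        requires.\<close>
      define h where "h x = avg_op d N (\<lambda>y. \<bar>f y\<bar>) x" for x
      have h: "\<bar>avg_op d N f x\<bar> \<le> h x" for x
        unfolding h_def avg_op_def by (simp add: abs_mult divide_right_mono)
      have h0: "h x \<ge> 0" for x using h[of x] by linarith
      define H where "H = (\<Sum>x\<in>E. h x powr s)"
      have H0: "H \<ge> 0" by (simp add: H_def sum_nonneg)
      \<comment> \<open>The bilinear estimate asks for positive bounds and a power of H is
        cancelled; the degenerate cases force H = 0.\<close>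
      have "H \<le> L powr s"
      proof (cases "H = 0 \<or> \<Phi> = 0")
        case True
        have "H = 0"
        proof (cases "H = 0")
          case False
          then have "\<Phi> = 0" using True by simp
          then have "\<bar>f x\<bar> powr p \<le> 0" for x using fin\<Phi>[of "{x}"] by simp
          then have "f x = 0" for x by (metis abs_eq_0 antisym powr_ge_zero powr_eq_0_iff)
          then have "h x = 0" for x by (simp add: h_def avg_op_def)
          then show ?thesis using s1 by (simp add: H_def)
        qed
        then show ?thesis by simp
      next
        case False
        then have pos: "H > 0" "\<Phi> > 0" using H0 \<Phi>0 by auto
        \<comment> \<open>\<open>U\<close> contains every point at which an average over
          \<open>E\<close> samples f, so truncating to \<open>U\<close> leaves \<open>h\<close>
          unchanged on \<open>E\<close>.\<close>
        define U where "U = (\<lambda>(x, k). x + int k ^ d) ` (E \<times> {1..N})"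
        have U: "finite U" using E by (simp add: U_def)
        define f' where "f' y = (if y \<in> U then \<bar>f y\<bar> else 0)" for y
        have hf': "h x = avg_op d N f' x" if "x \<in> E" for x
          unfolding h_def avg_op_def f'_def using that by (intro arg_cong2[where f = "(*)"] sum.cong refl) (force simp: U_def)
        \<comment> \<open>The test function is h powr (s - 1); its p-th power is h powr s because (s
          - 1) * p = s.\<close>
        have "H = (\<Sum>x\<in>E. h x powr (s - 1) * avg_op d N f' x)"
          unfolding H_def
        proof (intro sum.cong refl)
          fix x assume x: "x \<in> E"
          have "h x powr s = h x powr (s - 1) * h x"
          proof (cases "h x = 0")
            case False
            then have "h x powr (s - 1) * h x = h x powr (s - 1) * h x powr 1" using h0[of x] by simp
            also have "\<dots> = h x powr ((s - 1) + 1)" by (rule powr_add[symmetric])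
            finally show ?thesis by simp
          qed auto
          then show "h x powr s = h x powr (s - 1) * avg_op d N f' x" using hf'[OF x] by simp
        qed
        also have "\<dots> \<le> C * real N powr (real d / s - real d / p) * \<Phi> powr (1 / p) * H powr (1 / p)"
        proof (rule C(2)[OF N U E])
          show "(\<Sum>x\<in>U. f' x powr p) \<le> \<Phi>" using fin\<Phi>[OF U] by (simp add: f'_def)
          show "(\<Sum>x\<in>E. (h x powr (s - 1)) powr p) \<le> H" by (simp add: H_def powr_powr s1(3))
        qed (use pos in \<open>auto simp: f'_def\<close>)
        finally have "H \<le> L * H powr (1 / p)" by (simp add: L_def)
        moreover have "H = H powr (1 / s) * H powr (1 / p)"
          using pos s1(2) by (simp add: add.commute flip: powr_add)
        ultimately have "H powr (1 / s) * H powr (1 / p) \<le> L * H powr (1 / p)" by simp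
        then have "H powr (1 / s) \<le> L" using pos by simp
        then have "(H powr (1 / s)) powr s \<le> L powr s" using s1 by (intro powr_mono2) auto
        then show ?thesis using pos s1 by (simp add: powr_powr)
      qed
      moreover have "(\<Sum>x\<in>E. \<bar>avg_op d N f x\<bar> powr s) \<le> H"
        unfolding H_def using h s1 by (intro sum_mono powr_mono2) auto
      ultimately show ?thesis by linarith
    qed
    have sm: "(\<lambda>x. \<bar>avg_op d N f x\<bar> powr s) summable_on UNIV"
      by (rule nonneg_bdd_above_summable_on) (auto intro!: bdd_aboveI2[where M = "L powr s"] bound)
    then show "in_lp s (avg_op d N f)" by (simp add: in_lp_def)
    have "(\<Sum>\<^sub>\<infinity>x\<in>UNIV. \<bar>avg_op d N f x\<bar> powr s) \<le> L powr s"
      using sm bound by (intro infsum_le_finite_sums) auto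
    then have "lp_norm s (avg_op d N f) \<le> (L powr s) powr (1 / s)"
      unfolding lp_norm_def using s1 by (intro powr_mono2) (auto intro: infsum_nonneg)
    also have "\<dots> = L" using s1 L0 by (simp add: powr_powr)
    finally show "lp_norm s (avg_op d N f) \<le> C * real N powr (real d / s - real d / p) * lp_norm p f"
      by (simp add: L_def lp_norm_def \<Phi>_def)
  qed
qed

end
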